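(* Let $w=(w_n)_{n\geq1}$ be a positive and bounded weight sequence and let $B_w:l^\infty\to l^\infty$, $B_w(x_1,x_2,x_3,\ldots)=(w_1x_2,w_2x_3,\ldots)$, be the weighted backward shift. Assume that $T:=f(B_w)$ is $J$-class, where $f$ is a holomorphic function defined on an open neighborhood of $\sigma(B_w)$. Then $A_T=c_0$.
   Context: $l^\infty$ is the complex Banach space of bounded sequences with the sup-norm and $c_0$ its subspace of null sequences; $\sigma(\cdot)$ denotes the spectrum and $f(B_w)$ is defined by the holomorphic functional calculus. For a bounded linear operator $T$ on a Banach space $X$ and $x\in X$, $J_T(x)$ is the set of all $y\in X$ for which there exist a strictly increasing sequence $(k_n)$ of natural numbers and a sequence $(x_n)$ in $X$ with $x_n\to x$ and $T^{k_n}x_n\to y$. The operator $T$ is called $J$-class if $J_T(x)=X$ for some $x\in X\setminus\{0\}$, and $A_T:=\{x\in X: J_T(x)=X\}$. *)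

theory Defs
  imports "HOL-Complex_Analysis.Complex_Analysis"
begin

section \<open>J-sets and J-class operators\<close>

definition J_set :: "('a::banach \<Rightarrow>\<^sub>L 'a) \<Rightarrow> 'a \<Rightarrow> 'a set" where
  "J_set T x = {y. \<exists>(k :: nat \<Rightarrow> nat) (xs :: nat \<Rightarrow> 'a). strict_mono k \<and>
     xs \<longlonglongrightarrow> x \<and> (\<lambda>n. (blinfun_apply T ^^ k n) (xs n)) \<longlonglongrightarrow> y}"

definition J_class :: "('a::banach \<Rightarrow>\<^sub>L 'a) \<Rightarrow> bool" where
  "J_class T \<longleftrightarrow> (\<exists>x. x \<noteq> 0 \<and> J_set T x = UNIV)"

definition A_set :: "('a::banach \<Rightarrow>\<^sub>L 'a) \<Rightarrow> 'a set" where
  "A_set T = {x. J_set T x = UNIV}"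


section \<open>The complex Banach space of bounded sequences\<close>

text \<open>
  Every function on the discrete space \<^typ>\<open>nat\<close> is continuous, so the bounded continuous
  functions below are exactly the bounded sequences, with the sup-norm. Sequences are indexed
  from 0. The library proves completeness of this function space only over metric domains, hence
  the metric on \<^typ>\<open>nat\<close>, which induces the given discrete topology. It also provides only the
  real Banach space structure; multiplication by complex scalars is the operator \<open>cscale\<close>.
\<close>

instantiation nat :: metric_space
begin

definition dist_nat :: "nat \<Rightarrow> nat \<Rightarrow> real" where
  "dist_nat m n = \<bar>real m - real n\<bar>"

definition uniformity_nat :: "(nat \<times> nat) filter" where
  "uniformity_nat = (INF e\<in>{0<..}. principal {(x, y). dist x y < e})"

instance
proof
  show "uniformity = (INF e\<in>{0<..}. principal {(x :: nat, y). dist x y < e})"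
    by (rule uniformity_nat_def)
  show "open S \<longleftrightarrow> (\<forall>x\<in>S. \<forall>\<^sub>F (x', y) in uniformity. x' = x \<longrightarrow> y \<in> S)" for S :: "nat set"
  proof -
    have "\<forall>\<^sub>F (x', y :: nat) in uniformity. x' = y"
      unfolding uniformity_nat_def
      by (rule eventually_INF1[of 1]) (auto simp: eventually_principal dist_nat_def)
    then have "\<forall>\<^sub>F (x', y) in uniformity. x' = x \<longrightarrow> y \<in> S" if "x \<in> S" for x
      by (rule eventually_mono) (use that in auto)
    then show ?thesis
      by (simp add: open_discrete)
  qed
qed (auto simp: dist_nat_def)

end

instance bcontfun :: (metric_space, banach) banach ..

type_synonym linf = "nat \<Rightarrow>\<^sub>C complex"

definition c0 :: "linf set" where
  "c0 = {x. apply_bcontfun x \<longlonglongrightarrow> 0}"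

lemma bounded_seq_bcontfun:
  fixes g :: "nat \<Rightarrow> complex"
  assumes "\<And>n. norm (g n) \<le> C"
  shows "g \<in> bcontfun"
  using assms by (auto simp: bcontfun_def bounded_iff)

lemma bounded_mult_bcontfun:
  fixes x :: linf and a :: "nat \<Rightarrow> complex"
  assumes "\<And>n. norm (a n) \<le> C"
  shows "(\<lambda>n. a n * apply_bcontfun x (s n)) \<in> bcontfun"
proof (rule bounded_seq_bcontfun)
  fix n
  have "0 \<le> C" using assms[of 0] norm_ge_zero order_trans by blast
  then show "norm (a n * apply_bcontfun x (s n)) \<le> C * norm x"
    unfolding norm_mult by (intro mult_mono assms norm_bounded) auto
qed

lemma bounded_linear_mult_bcontfun:
  fixes a :: "nat \<Rightarrow> complex"
  assumes "\<And>n. norm (a n) \<le> C"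
  shows "bounded_linear (\<lambda>x :: linf. Bcontfun (\<lambda>n. a n * apply_bcontfun x (s n)))"
proof (rule bounded_linear_intro[where K = C])
  have app: "apply_bcontfun (Bcontfun (\<lambda>n. a n * apply_bcontfun x (s n))) =
      (\<lambda>n. a n * apply_bcontfun x (s n))" for x :: linf
    by (rule Bcontfun_inverse[OF bounded_mult_bcontfun[OF assms]])
  have C: "0 \<le> C" using assms[of 0] norm_ge_zero order_trans by blast
  fix x y :: linf and r :: real
  show "Bcontfun (\<lambda>n. a n * apply_bcontfun (x + y) (s n)) =
      Bcontfun (\<lambda>n. a n * apply_bcontfun x (s n)) + Bcontfun (\<lambda>n. a n * apply_bcontfun y (s n))"
    by (rule bcontfun_eqI)
      (simp add: app app[of "x + y", unfolded plus_bcontfun.rep_eq distrib_left] distrib_left)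
  show "Bcontfun (\<lambda>n. a n * apply_bcontfun (r *\<^sub>R x) (s n)) =
      r *\<^sub>R Bcontfun (\<lambda>n. a n * apply_bcontfun x (s n))"
    by (rule bcontfun_eqI) (simp add: app app[of "r *\<^sub>R x", simplified])
  show "norm (Bcontfun (\<lambda>n. a n * apply_bcontfun x (s n))) \<le> norm x * C"
  proof (rule norm_bound)
    fix n
    show "norm (apply_bcontfun (Bcontfun (\<lambda>n. a n * apply_bcontfun x (s n))) n) \<le> norm x * C"
      unfolding app norm_mult mult.commute[of "norm x"]
      using C by (intro mult_mono assms norm_bounded) auto
  qed
qed

definition cscale :: "complex \<Rightarrow> linf \<Rightarrow>\<^sub>L linf" where
  "cscale c = Blinfun (\<lambda>x. Bcontfun (\<lambda>n. c * apply_bcontfun x n))"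

lemma cscale_apply: "apply_bcontfun (blinfun_apply (cscale c) x) n = c * apply_bcontfun x n"
  unfolding cscale_def
  using bounded_linear_mult_bcontfun[of "\<lambda>_. c" "norm c" "\<lambda>n. n"]
    bounded_mult_bcontfun[of "\<lambda>_. c" "norm c" x "\<lambda>n. n"]
  by (simp add: bounded_linear_Blinfun_apply Bcontfun_inverse)

definition backward_shift :: "(nat \<Rightarrow> real) \<Rightarrow> linf \<Rightarrow>\<^sub>L linf" where
  "backward_shift w =
     Blinfun (\<lambda>x. Bcontfun (\<lambda>n. complex_of_real (w n) * apply_bcontfun x (Suc n)))"

lemma backward_shift_apply:
  assumes "bounded (range w)"
  shows "apply_bcontfun (blinfun_apply (backward_shift w) x) n =
    complex_of_real (w n) * apply_bcontfun x (Suc n)"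
proof -
  obtain C where C: "\<And>n. norm (complex_of_real (w n)) \<le> C"
    using assms by (auto simp: bounded_iff)
  show ?thesis
    unfolding backward_shift_def
    using bounded_linear_mult_bcontfun[of "\<lambda>n. complex_of_real (w n)", OF C]
      bounded_mult_bcontfun[of "\<lambda>n. complex_of_real (w n)", OF C]
    by (simp add: bounded_linear_Blinfun_apply Bcontfun_inverse)
qed


section \<open>Spectrum and holomorphic functional calculus\<close>

text \<open>
  The definitions are meant for complex-linear \<open>T\<close>. A bounded inverse of \<open>zI - T\<close> is then
  automatically complex-linear, so this need not be demanded.
\<close>

definition is_resolvent :: "(linf \<Rightarrow>\<^sub>L linf) \<Rightarrow> complex \<Rightarrow> (linf \<Rightarrow>\<^sub>L linf) \<Rightarrow> bool" where
  "is_resolvent T z R \<longleftrightarrow>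
     R o\<^sub>L (cscale z - T) = id_blinfun \<and> (cscale z - T) o\<^sub>L R = id_blinfun"

definition op_spectrum :: "(linf \<Rightarrow>\<^sub>L linf) \<Rightarrow> complex set" where
  "op_spectrum T = {z. \<not> (\<exists>R. is_resolvent T z R)}"

definition resolvent :: "(linf \<Rightarrow>\<^sub>L linf) \<Rightarrow> complex \<Rightarrow> (linf \<Rightarrow>\<^sub>L linf)" where
  "resolvent T z = (THE R. is_resolvent T z R)"

text \<open>
  A cycle, given as a list of closed piecewise continuously differentiable paths, that
  surrounds \<open>K\<close> in \<open>U\<close>.
\<close>

definition surrounds_in :: "(real \<Rightarrow> complex) list \<Rightarrow> complex set \<Rightarrow> complex set \<Rightarrow> bool" where
  "surrounds_in \<Gamma> K U \<longleftrightarrow>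
     (\<forall>\<gamma>\<in>set \<Gamma>. valid_path \<gamma> \<and> pathfinish \<gamma> = pathstart \<gamma> \<and> path_image \<gamma> \<subseteq> U - K) \<and>
     (\<forall>z\<in>K. (\<Sum>\<gamma>\<leftarrow>\<Gamma>. winding_number \<gamma> z) = 1) \<and>
     (\<forall>z. z \<notin> U \<longrightarrow> (\<Sum>\<gamma>\<leftarrow>\<Gamma>. winding_number \<gamma> z) = 0)"

text \<open>
  The library's contour integral is complex-valued only; this is the operator-valued analogue,
  an integral in the Banach space of bounded operators.
\<close>

definition op_contour_integral ::
    "(real \<Rightarrow> complex) \<Rightarrow> (complex \<Rightarrow> linf \<Rightarrow>\<^sub>L linf) \<Rightarrow> linf \<Rightarrow>\<^sub>L linf" where
  "op_contour_integral \<gamma> F =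
     integral {0..1} (\<lambda>t. cscale (vector_derivative \<gamma> (at t within {0..1})) o\<^sub>L F (\<gamma> t))"

text \<open>
  The Riesz--Dunford integral of \<open>f\<close>, holomorphic on the open neighbourhood \<open>U\<close> of the spectrum.
  Surrounding cycles exist, and by Cauchy's theorem the value does not depend on the chosen one.
\<close>

definition hol_calc ::
    "(complex \<Rightarrow> complex) \<Rightarrow> complex set \<Rightarrow> (linf \<Rightarrow>\<^sub>L linf) \<Rightarrow> linf \<Rightarrow>\<^sub>L linf" where
  "hol_calc f U T =
     (let \<Gamma> = (SOME \<Gamma>. surrounds_in \<Gamma> (op_spectrum T) U)
      in cscale (1 / (2 * of_real pi * \<i>)) o\<^sub>L
         (\<Sum>\<gamma>\<leftarrow>\<Gamma>. op_contour_integral \<gamma> (\<lambda>z. cscale (f z) o\<^sub>L resolvent T z)))"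

end

(* Put W_n = w_0 ... w_(n-1), so that (B^k x)_n = (W_(n+k) / W_n) x_(n+k). The spectrum of B is the
   closed disc whose radius rad is the infimum of all t with W_(n+k) <= C t^k W_n. Every cycle used
   for f(B) stays outside this disc, where the Neumann series of the resolvent converges, so
   T = f(B) is a norm-convergent series sum_k c_k B^k with symbol g(z) = sum_k c_k z^k holomorphic
   on a larger disc.

   If T is J-class then 0 lies in A_T. This excludes functionals phi with finite supports escaping
   to infinity and phi o T close to alpha phi, |alpha| <= 1. Truncations of the formal eigenfunctional
   (W_j / z^j)_j are such functionals with alpha = g(z) unless the W_j / |z|^j uniformly grow or decay
   geometrically. Hence |z| <= rad and |g(z)| <= 1 force a lower bound W_(n+k) >= c t^k W_n with
   t > |z|. With a the supremum of all t admitting a lower bound, |g| > 1 on a <= |z| <= rad.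

   A_T is contained in c_0: on a slightly larger annulus 1 / g^n is bounded by 1 for all n, and its
   Laurent coefficients recover x from T^n x, giving |x_j| <= K |T^n x| + M q^j with q < 1 and K
   independent of n. Apply this to x' near x with T^n x' near 0. If |g| > 1 on the whole disc, the
   term M q^j is absent and A_T = {0}, contradicting that T is J-class.

   c_0 is contained in A_T: by the maximum principle for 1 / g there is z with |g(z)| < 1 and a lower
   bound for some t > |z|. The eigenvectors (z^n / W_n)_n for such z have null orbits, and by analytic
   continuation in z their closed span contains all finitely supported sequences. *)
theory Submission
  imports Defs
begin


section \<open>J-sets\<close>

text \<open>For |z| <= rad the sequence (W_j / z^j) need not be summable, so it need not define a
  functional on l^inf. Restricted to an interval, it fails the eigenvalue equation only through its
  two end terms. If no such restriction has a relatively small defect, the ends always carry a fixed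
  share of the total mass, and this self-bounding inequality forces geometric growth or decay. Decay
  would give an upper rate below |z| <= rad, against the choice of rad; so only the lower bound
  survives. Initial segments affect constants alone, hence the supports can be pushed beyond any
  index. In the sup-norm, pieces on disjoint supports glue to one bounded vector, and that vector is
  not a null sequence.

  Both inclusions rest on strict inequalities. Since |g| > 1 on a closed annulus, compactness lets
  both of its circles move outwards: inside to a radius i < a, where a lower rate t > i gives q = i
  / t < 1, and outside to a radius above rad, where the generating series of x converges. The gap t
  > |z| also makes the eigenvectors an analytic family on the whole disc |z| < t; its Taylor
  coefficients at 0 are multiples of the unit vectors.\<close>

lemma J_set_iff:
  "y \<in> J_set T x \<longleftrightarrow>
     (\<forall>e>0. \<forall>K. \<exists>k>K. \<exists>x'. dist x' x < e \<and> dist ((blinfun_apply T ^^ k) x') y < e)"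
  (is "_ \<longleftrightarrow> ?R")
proof
  assume "y \<in> J_set T x"
  then obtain k xs where k: "strict_mono k" and xs: "xs \<longlonglongrightarrow> x"
    and T: "(\<lambda>n. (blinfun_apply T ^^ k n) (xs n)) \<longlonglongrightarrow> y"
    by (auto simp: J_set_def)
  show ?R
  proof (intro allI impI)
    fix e :: real and K :: nat assume e: "e > 0"
    have "\<forall>\<^sub>F n in sequentially. dist (xs n) x < e \<and>
        dist ((blinfun_apply T ^^ k n) (xs n)) y < e \<and> n > K"
      by (intro eventually_conj tendstoD[OF xs e] tendstoD[OF T e] eventually_gt_at_top)
    then obtain n where "dist (xs n) x < e" "dist ((blinfun_apply T ^^ k n) (xs n)) y < e" "n > K"
      using eventually_happens' sequentially_bot by blast
    moreover have "k n \<ge> n" using k by (rule seq_suble)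
    ultimately show "\<exists>k>K. \<exists>x'. dist x' x < e \<and> dist ((blinfun_apply T ^^ k) x') y < e"
      by (meson less_le_trans)
  qed
next
  assume R: ?R
  define P where "P n k x' \<longleftrightarrow> dist x' x < inverse (real (Suc n)) \<and>
    dist ((blinfun_apply T ^^ k) x') y < inverse (real (Suc n))" for n k x'
  have "\<exists>k. \<forall>n. (\<exists>x'. P n (k n) x') \<and> k n < k (Suc n)"
  proof (rule dependent_nat_choice)
    show "\<exists>k x'. P 0 k x'"
      using R[rule_format, of "inverse (real (Suc 0))" 0] unfolding P_def by auto
    fix k n
    show "\<exists>k'. (\<exists>x'. P (Suc n) k' x') \<and> k < k'"
      using R[rule_format, of "inverse (real (Suc (Suc n)))" k, OF positive_imp_inverse_positive] unfolding P_def
      by (metis of_nat_0_less_iff zero_less_Suc)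
  qed
  then obtain k where k: "\<And>n. \<exists>x'. P n (k n) x'" "\<And>n. k n < k (Suc n)" by blast
  then obtain xs where xs: "\<And>n. P n (k n) (xs n)" by metis
  have "\<forall>n. dist (xs n) x \<le> inverse (real (Suc n))"
    "\<forall>n. dist ((blinfun_apply T ^^ k n) (xs n)) y \<le> inverse (real (Suc n))"
    using xs less_imp_le unfolding P_def by blast+
  then have "(\<lambda>n. dist (xs n) x) \<longlonglongrightarrow> 0" "(\<lambda>n. dist ((blinfun_apply T ^^ k n) (xs n)) y) \<longlonglongrightarrow> 0"
    by (auto intro: tendsto_sandwich[OF _ _ tendsto_const LIMSEQ_inverse_real_of_nat])
  then have "xs \<longlonglongrightarrow> x" "(\<lambda>n. (blinfun_apply T ^^ k n) (xs n)) \<longlonglongrightarrow> y"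
    by (simp_all add: tendsto_dist_iff[symmetric])
  then show "y \<in> J_set T x"
    using k(2) by (auto simp: J_set_def strict_mono_Suc_iff)
qed

lemma A_set_iff:
  "x \<in> A_set T \<longleftrightarrow>
     (\<forall>y. \<forall>e>0. \<forall>K. \<exists>k>K. \<exists>x'. dist x' x < e \<and> dist ((blinfun_apply T ^^ k) x') y < e)"
  unfolding A_set_def mem_Collect_eq set_eq_iff J_set_iff by simp

lemma bounded_linear_blinfun_funpow:
  fixes T :: "'a::real_normed_vector \<Rightarrow>\<^sub>L 'a"
  shows "bounded_linear (blinfun_apply T ^^ k)"
proof (induction k)
  case 0
  show ?case using bounded_linear_ident unfolding funpow_0 id_def[symmetric] by (simp add: id_def)
next
  case (Suc k)
  then show ?case
    using bounded_linear_compose[OF blinfun.bounded_linear_right[of T] Suc] by (simp add: o_def)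
qed

lemma norm_blinfun_funpow_le:
  fixes T :: "'a::real_normed_vector \<Rightarrow>\<^sub>L 'a"
  shows "norm ((blinfun_apply T ^^ k) x) \<le> norm T ^ k * norm x"
proof (induction k)
  case (Suc k)
  have "norm (blinfun_apply T ((blinfun_apply T ^^ k) x)) \<le> norm T * (norm T ^ k * norm x)"
    by (rule order_trans[OF norm_blinfun mult_left_mono[OF Suc]]) simp
  then show ?case by simp
qed simp

lemma closed_A_set: "closed (A_set T)"
  unfolding closure_subset_eq[symmetric]
proof
  fix x assume x: "x \<in> closure (A_set T)"
  show "x \<in> A_set T"
    unfolding A_set_iff
  proof (intro allI impI)
    fix y and e :: real and K :: nat assume e: "e > 0"
    obtain a where a: "a \<in> A_set T" "dist a x < e / 2"
      using x e by (auto simp: closure_approachable dest: spec[of _ "e / 2"])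
    then obtain k x' where k: "k > K" "dist x' a < e / 2" "dist ((blinfun_apply T ^^ k) x') y < e / 2"
      using e half_gt_zero[OF e] unfolding A_set_iff by blast
    have "dist x' x < e"
      using k(2) a(2) dist_triangle_half_r[of a x' e x] by (simp add: dist_commute)
    with k e show "\<exists>k>K. \<exists>x'. dist x' x < e \<and> dist ((blinfun_apply T ^^ k) x') y < e"
      by force
  qed
qed

text \<open>By linearity \<open>r *\<^sub>R x\<close> inherits full J-set from \<open>x\<close>:
  approximate \<open>y / r\<close> and rescale. Here \<open>r\<close> is chosen so small that
  \<open>r *\<^sub>R x\<close> has norm \<open>e / 2\<close>, and the tolerance
  \<open>e / 2 / r\<close> becomes \<open>e / 2\<close> after scaling.\<close>

lemma zero_mem_A_set_of_J_class:
  assumes "J_class T"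
  shows "0 \<in> A_set T"
  unfolding A_set_iff
proof (intro allI impI)
  fix y and e :: real and K :: nat assume e: "e > 0"
  obtain x where x: "x \<noteq> 0" "x \<in> A_set T"
    using assms by (auto simp: J_class_def A_set_def)
  define r where "r = e / (2 * norm x)"
  have r: "r > 0" "r * norm x = e / 2" using x e by (auto simp: r_def)
  have "e / 2 / r > 0" using r e by simp
  then obtain k x' where k: "k > K" "dist x' x < e / 2 / r"
      "dist ((blinfun_apply T ^^ k) x') ((1/r) *\<^sub>R y) < e / 2 / r"
    using x(2) unfolding A_set_iff by blast
  have "norm (r *\<^sub>R x') \<le> norm (r *\<^sub>R x) + norm (r *\<^sub>R (x' - x))"
    by (metis norm_triangle_sub scaleR_diff_right)
  also have "\<dots> = r * norm x + r * norm (x' - x)" using r by simp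
  also have "\<dots> < e / 2 + e / 2"
    using k(2) r by (simp add: dist_norm field_simps)
  finally have 1: "dist (r *\<^sub>R x') 0 < e" by simp
  have eq: "(blinfun_apply T ^^ k) (r *\<^sub>R x') - y = r *\<^sub>R ((blinfun_apply T ^^ k) x' - (1/r) *\<^sub>R y)"
    using r linear_cmul[OF bounded_linear.linear[OF bounded_linear_blinfun_funpow[where T = T and k = k]]]
    by (simp add: scaleR_diff_right)
  then have "dist ((blinfun_apply T ^^ k) (r *\<^sub>R x')) y < e"
    unfolding dist_norm eq norm_scaleR using k(3) r(1) e by (simp add: dist_norm field_simps)
  with 1 k(1) show "\<exists>k>K. \<exists>x'. dist x' 0 < e \<and> dist ((blinfun_apply T ^^ k) x') y < e"
    by blast
qed

text \<open>Adding a vector \<open>z\<close> with null orbit moves a point near 0 to a point near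
  \<open>z\<close>, and for late \<open>k\<close> it hardly changes the image under the
  \<open>k\<close>-th iterate. Closedness of \<open>A_set T\<close> does the rest.\<close>

lemma closure_null_orbits_subset_A_set:
  assumes "0 \<in> A_set T"
  shows "closure {z. (\<lambda>n. (blinfun_apply T ^^ n) z) \<longlonglongrightarrow> 0} \<subseteq> A_set T"
proof (rule closure_minimal[OF _ closed_A_set], safe)
  fix z assume z: "(\<lambda>n. (blinfun_apply T ^^ n) z) \<longlonglongrightarrow> 0"
  show "z \<in> A_set T"
    unfolding A_set_iff
  proof (intro allI impI)
    fix y and e :: real and K :: nat assume e: "e > 0"
    obtain N where N: "\<And>n. n \<ge> N \<Longrightarrow> norm ((blinfun_apply T ^^ n) z) < e / 2"
      using LIMSEQ_D[OF z, of "e / 2"] e by auto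
    obtain k x' where k: "k > max K N" "dist x' 0 < e / 2" "dist ((blinfun_apply T ^^ k) x') y < e / 2"
      using assms half_gt_zero[OF e] unfolding A_set_iff by blast
    have eq: "(blinfun_apply T ^^ k) (x' + z) - y
        = ((blinfun_apply T ^^ k) x' - y) + (blinfun_apply T ^^ k) z"
      using linear_add[OF bounded_linear.linear[OF bounded_linear_blinfun_funpow[where T = T and k = k]]] by simp
    then have "dist ((blinfun_apply T ^^ k) (x' + z)) y < e"
      unfolding dist_norm eq
      using k N[of k] norm_triangle_ineq[of "(blinfun_apply T ^^ k) x' - y" "(blinfun_apply T ^^ k) z"]
      unfolding dist_norm by auto
    moreover have "dist (x' + z) z < e" using k(2) e by (simp add: dist_norm)
    ultimately show "\<exists>k>K. \<exists>x'. dist x' z < e \<and> dist ((blinfun_apply T ^^ k) x') y < e"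
      using k(1) by force
  qed
qed

section \<open>Approximate eigenfunctionals with supports escaping to infinity\<close>

lemma mult_cnj_sgn: "z * cnj (sgn z) = of_real (norm z)"
proof (cases "z = 0")
  case False
  have "z * cnj z = of_real (norm z) * of_real (norm z)"
    by (metis complex_norm_square power2_eq_square of_real_mult)
  then show ?thesis
    using False by (simp add: sgn_div_norm scaleR_conv_of_real field_simps)
qed simp

definition fin_functional :: "(nat \<Rightarrow> complex) \<Rightarrow> nat set \<Rightarrow> linf \<Rightarrow> complex" where
  "fin_functional v S x = (\<Sum>j\<in>S. v j * apply_bcontfun x j)"

lemma norm_fin_functional_le: "norm (fin_functional v S x) \<le> (\<Sum>j\<in>S. norm (v j)) * norm x"
  unfolding fin_functional_def sum_distrib_right
  by (intro sum_norm_le) (auto simp: norm_mult intro!: mult_left_mono norm_bounded)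

lemma bounded_linear_fin_functional: "bounded_linear (fin_functional v S)"
  by (rule bounded_linear_intro[where K = "\<Sum>j\<in>S. norm (v j)"])
    (use norm_fin_functional_le[of v S] in
      \<open>auto simp: fin_functional_def distrib_left sum.distrib scaleR_sum_right mult.commute\<close>)

text \<open>Each further application of \<open>T\<close> adds a new error of at most
  \<open>e * norm T ^ k * norm x\<close>, while the old error is multiplied by \<alpha> and does not
  grow because its modulus is at most 1.\<close>

lemma fin_functional_funpow:
  fixes T :: "linf \<Rightarrow>\<^sub>L linf"
  assumes T: "\<And>x. norm (fin_functional v S (blinfun_apply T x) - \<alpha> * fin_functional v S x) \<le> e * norm x"
    and "norm \<alpha> \<le> 1" "e \<ge> 0"
  shows "norm (fin_functional v S ((blinfun_apply T ^^ k) x) - \<alpha> ^ k * fin_functional v S x)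
    \<le> e * (\<Sum>l<k. norm T ^ l) * norm x"
proof (induction k)
  case (Suc k)
  let ?y = "(blinfun_apply T ^^ k) x"
  let ?d = "fin_functional v S ?y - \<alpha> ^ k * fin_functional v S x"
  have "norm (fin_functional v S (blinfun_apply T ?y) - \<alpha> * fin_functional v S ?y) \<le> e * (norm T ^ k * norm x)"
    by (rule order_trans[OF T]) (intro mult_left_mono norm_blinfun_funpow_le assms)
  moreover have "norm (\<alpha> * ?d) \<le> e * (\<Sum>l<k. norm T ^ l) * norm x"
    using Suc mult_mono[OF assms(2) Suc] by (simp add: norm_mult)
  moreover have "fin_functional v S (blinfun_apply T ?y) - \<alpha> ^ Suc k * fin_functional v S x =
     (fin_functional v S (blinfun_apply T ?y) - \<alpha> * fin_functional v S ?y) + \<alpha> * ?d"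
    by (simp add: algebra_simps)
  ultimately show ?case
    using norm_triangle_ineq[of "fin_functional v S (blinfun_apply T ?y) - \<alpha> * fin_functional v S ?y" "\<alpha> * ?d"]
    by (simp add: algebra_simps)
qed simp

text \<open>
  On the union of disjoint supports one builds a single \<open>y\<close> at which every functional takes the
  value 1; a small \<open>x'\<close> with \<open>T\<^sup>k x'\<close> close to \<open>y\<close> is then impossible, since far out
  the functionals are nearly multiplied by \<open>\<alpha>\<^sup>k\<close>.
\<close>

lemma no_escaping_eigenfunctionals:
  fixes T :: "linf \<Rightarrow>\<^sub>L linf"
  assumes T: "0 \<in> A_set T" and \<alpha>: "norm \<alpha> \<le> 1"
    and ex: "\<And>N e. e > 0 \<Longrightarrow> \<exists>S v. finite S \<and> S \<subseteq> {N..} \<and> (\<Sum>j\<in>S. norm (v j)) = 1 \<and>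
      (\<forall>x. norm (fin_functional v S (blinfun_apply T x) - \<alpha> * fin_functional v S x) \<le> e * norm x)"
  shows False
proof -
  \<comment> \<open>A state is a triple of a lower index bound, a support and coefficients.
    \<open>P\<close> asks for accuracy \<open>1 / (i + 1)\<close> at stage \<open>i\<close>;
    \<open>Q\<close> puts the next bound beyond the current support, so that the supports are
    disjoint.\<close>
  define P where "P i s \<longleftrightarrow> (case s of (N, S, v) \<Rightarrow> finite S \<and> S \<subseteq> {N..} \<and> (\<Sum>j\<in>S. norm (v j)) = 1 \<and>
      (\<forall>x. norm (fin_functional v S (blinfun_apply T x) - \<alpha> * fin_functional v S x)
        \<le> inverse (real (Suc i)) * norm x))" for i :: nat and s :: "nat \<times> nat set \<times> (nat \<Rightarrow> complex)"
  define Q where "Q s s' \<longleftrightarrow> fst s \<le> fst s' \<and> fst (snd s) \<subseteq> {..<fst s'}"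
    for s s' :: "nat \<times> nat set \<times> (nat \<Rightarrow> complex)"
  have "\<exists>s. \<forall>i. P i (s i) \<and> Q (s i) (s (Suc i))"
  proof (rule dependent_nat_choice)
    show "\<exists>s. P 0 s" using ex[of "inverse (real (Suc 0))" 0] by (auto simp: P_def)
    fix s i assume "P i s"
    then have "finite (fst (snd s))" by (auto simp: P_def)
    then obtain M where M: "fst (snd s) \<subseteq> {..<M}" using finite_nat_iff_bounded by blast
    obtain S v where "finite S \<and> S \<subseteq> {max M (fst s)..} \<and> (\<Sum>j\<in>S. norm (v j)) = 1 \<and>
      (\<forall>x. norm (fin_functional v S (blinfun_apply T x) - \<alpha> * fin_functional v S x)
        \<le> inverse (real (Suc (Suc i))) * norm x)"
      using ex[of "inverse (real (Suc (Suc i)))" "max M (fst s)"] by auto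
    then show "\<exists>s'. P (Suc i) s' \<and> Q s s'"
      using M by (intro exI[of _ "(max M (fst s), S, v)"]) (auto simp: P_def Q_def)
  qed
  then obtain s where s: "\<And>i. P i (s i)" "\<And>i. Q (s i) (s (Suc i))" by blast
  define N S v where "N i = fst (s i)" and "S i = fst (snd (s i))" and "v i = snd (snd (s i))" for i
  have S: "finite (S i)" "S i \<subseteq> {N i..}" "(\<Sum>j\<in>S i. norm (v i j)) = 1"
    and ev: "norm (fin_functional (v i) (S i) (blinfun_apply T x) - \<alpha> * fin_functional (v i) (S i) x)
        \<le> inverse (real (Suc i)) * norm x" for i x
    using s(1)[of i] by (auto simp: P_def N_def S_def v_def split: prod.splits)
  have Q: "N i \<le> N (Suc i)" "S i \<subseteq> {..<N (Suc i)}" for i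
    using s(2)[of i] by (auto simp: Q_def N_def S_def)
  have disj: "S i \<inter> S j = {}" if "i < j" for i j
  proof -
    have "N (Suc i) \<le> N j" using lift_Suc_mono_le[of N "Suc i" j] Q(1) that by simp
    then have "S i \<subseteq> {..<N j}" using Q(2)[of i] by auto
    then show ?thesis using S(2)[of j] by (meson atLeast_iff disjoint_iff lessThan_iff not_le subsetD)
  qed
  then have uniq: "i = j" if "a \<in> S i" "a \<in> S j" for a i j
    using that disj[of i j] disj[of j i] by (meson disjoint_iff linorder_neqE_nat)
  \<comment> \<open>The block containing \<open>a\<close> is unique, so \<open>SOME\<close> picks
    it. Conjugate phases turn each pairing into a sum of moduli, which is 1 by normalisation, while
    all entries of \<open>h\<close> stay within the unit disc.\<close>
  define h where "h a = (if \<exists>i. a \<in> S i then cnj (sgn (v (SOME i. a \<in> S i) a)) else 0)" for a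
  have h: "h a = cnj (sgn (v i a))" if "a \<in> S i" for a i
  proof -
    have "(SOME i. a \<in> S i) = i" using that uniq by (intro some_equality) auto
    then show ?thesis using that by (auto simp: h_def)
  qed
  have "norm (h a) \<le> 1" for a by (auto simp: h_def norm_sgn)
  then have "h \<in> bcontfun" by (rule bounded_seq_bcontfun)
  then have app: "apply_bcontfun (Bcontfun h) = h" by (rule Bcontfun_inverse)
  have one: "fin_functional (v i) (S i) (Bcontfun h) = 1" for i
  proof -
    have "fin_functional (v i) (S i) (Bcontfun h) = (\<Sum>j\<in>S i. of_real (norm (v i j)))"
      by (simp add: fin_functional_def app h mult_cnj_sgn)
    then show ?thesis using S(3)[of i] by (simp flip: of_real_sum)
  qed
  \<comment> \<open>The iterate \<open>k\<close> is fixed first and the functional \<open>i\<close>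
    afterwards, with \<open>i\<close> large enough to absorb the factor \<open>D\<close> that
    depends on \<open>k\<close>. The number 1 is then a sum of three terms, each below 1/4.\<close>
  obtain k x' where k: "dist x' 0 < 1/4" "dist ((blinfun_apply T ^^ k) x') (Bcontfun h) < 1/4"
    using T[unfolded A_set_iff, rule_format, of "1/4" 0 "Bcontfun h"] by auto
  define D where "D = (\<Sum>l<k. norm T ^ l)"
  have D: "D \<ge> 0" by (auto simp: D_def intro: sum_nonneg)
  obtain i :: nat where i: "D < real (Suc i)"
    using reals_Archimedean2[of D] by (metis less_trans of_nat_less_iff lessI)
  let ?\<phi> = "fin_functional (v i) (S i)"
  have "norm (?\<phi> ((blinfun_apply T ^^ k) x') - \<alpha> ^ k * ?\<phi> x') \<le> inverse (real (Suc i)) * D * norm x'"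
    unfolding D_def by (rule fin_functional_funpow[OF ev \<alpha>]) simp
  also have "\<dots> \<le> 1 * norm x'"
    using i D by (intro mult_right_mono) (auto simp: field_simps)
  finally have 1: "norm (?\<phi> ((blinfun_apply T ^^ k) x') - \<alpha> ^ k * ?\<phi> x') \<le> norm x'" by simp
  have 2: "norm (\<alpha> ^ k * ?\<phi> x') \<le> norm x'"
    using mult_mono[OF power_le_one[of "norm \<alpha>" k] norm_fin_functional_le[of "v i" "S i" x']] \<alpha> S(3)[of i]
    by (simp add: norm_mult norm_power)
  have 3: "norm (?\<phi> ((blinfun_apply T ^^ k) x') - 1) \<le> dist ((blinfun_apply T ^^ k) x') (Bcontfun h)"
    using norm_fin_functional_le[of "v i" "S i" "(blinfun_apply T ^^ k) x' - Bcontfun h"] S(3)[of i] one[of i]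
    by (simp add: linear_diff[OF bounded_linear.linear[OF bounded_linear_fin_functional]] dist_norm)
  have "norm (1::complex) \<le> norm (?\<phi> ((blinfun_apply T ^^ k) x') - 1) +
      norm (?\<phi> ((blinfun_apply T ^^ k) x') - \<alpha> ^ k * ?\<phi> x') + norm (\<alpha> ^ k * ?\<phi> x')"
    by (smt (verit) norm_minus_commute norm_triangle_sub)
  then show False using 1 2 3 k by (simp add: dist_norm)
qed


section \<open>Growth of positive sequences\<close>

text \<open>The constant is uniform in the starting index \<open>n\<close>. For the weight products
  the quotients \<open>W (n + k) / W n\<close> are the entries of the \<open>k\<close>-th power of
  the shift, so an upper rate is a bound \<open>C * t ^ k\<close> on the norms of the powers; a
  lower rate bounds all these entries from below.\<close>

definition upper_growth :: "(nat \<Rightarrow> real) \<Rightarrow> real \<Rightarrow> bool" where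
  "upper_growth W t \<longleftrightarrow> 0 < t \<and> (\<exists>C. \<forall>n k. W (n + k) \<le> C * t ^ k * W n)"

definition lower_growth :: "(nat \<Rightarrow> real) \<Rightarrow> real \<Rightarrow> bool" where
  "lower_growth W t \<longleftrightarrow> 0 < t \<and> (\<exists>C. \<forall>n k. t ^ k * W n \<le> C * W (n + k))"

text \<open>Starting indices are added one at a time downwards. A step from \<open>N\<close> to
  \<open>N + 1\<close> costs only the fixed factor \<open>q (Suc N) / q N\<close>, and the maximum
  with 1 takes care of \<open>k = 0\<close>.\<close>

lemma bounded_ratio_from:
  fixes q :: "nat \<Rightarrow> real"
  assumes q: "\<And>n. q n > 0" and "\<exists>C. \<forall>n\<ge>N. \<forall>k. q (n + k) \<le> C * q n"
  shows "\<exists>C. \<forall>n k. q (n + k) \<le> C * q n"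
  using assms(2)
proof (induction N)
  case (Suc N)
  then obtain C where C: "q (n + k) \<le> C * q n" if "n \<ge> Suc N" for n k by blast
  define C' where "C' = max 1 (max C (C * q (Suc N) / q N))"
  have "q (n + k) \<le> C' * q n" if "n \<ge> N" for n k
  proof (cases "n = N")
    case False
    then have "q (n + k) \<le> C * q n" using that C by auto
    also have "\<dots> \<le> C' * q n"
      using q[of n] by (intro mult_right_mono) (auto simp: C'_def)
    finally show ?thesis .
  next
    case True
    show ?thesis
    proof (cases k)
      case 0
      have "1 * q n \<le> C' * q n" using q[of n] by (intro mult_right_mono) (auto simp: C'_def)
      then show ?thesis using 0 by simp
    next
      case (Suc k')
      have "q (n + k) \<le> C * q (Suc N)" using C[of "Suc N" k'] True Suc by simp
      also have "\<dots> = (C * q (Suc N) / q N) * q n" using q[of N] True by simp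
      also have "\<dots> \<le> C' * q n" using q[of n] by (intro mult_right_mono) (auto simp: C'_def)
      finally show ?thesis .
    qed
  qed
  then show ?case using Suc.IH by blast
qed simp

text \<open>A lower bound with rate \<open>r\<close> for \<open>q\<close> is the bound of
  \<open>bounded_ratio_from\<close> for the sequence \<open>r ^ n / q n\<close>.\<close>

lemma lower_ratio_from:
  fixes q :: "nat \<Rightarrow> real"
  assumes q: "\<And>n. q n > 0" and r: "r > 0" and le: "\<And>n k. n \<ge> N \<Longrightarrow> r ^ k * q n \<le> C * q (n + k)"
  shows "\<exists>C. \<forall>n k. r ^ k * q n \<le> C * q (n + k)"
proof -
  have "\<exists>C. \<forall>n k. r ^ (n + k) / q (n + k) \<le> C * (r ^ n / q n)"
  proof (rule bounded_ratio_from[where N = N])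
    show "\<exists>C. \<forall>n\<ge>N. \<forall>k. r ^ (n + k) / q (n + k) \<le> C * (r ^ n / q n)"
    proof (intro exI allI impI)
      fix n k assume "n \<ge> N"
      from mult_left_mono[OF le[OF this, of k], of "r ^ n"] r
      show "r ^ (n + k) / q (n + k) \<le> C * (r ^ n / q n)"
        using q[of n] q[of "n + k"] by (simp add: field_simps power_add)
    qed
  qed (use q r in auto)
  then obtain D where D: "r ^ (n + k) / q (n + k) \<le> D * (r ^ n / q n)" for n k by blast
  have "r ^ k * q n \<le> D * q (n + k)" for n k
  proof -
    have "r ^ n * (r ^ k * q n) \<le> r ^ n * (D * q (n + k))"
      using D[of n k] q[of n] q[of "n + k"] by (simp add: field_simps power_add)
    then show ?thesis using r by simp
  qed
  then show ?thesis by blast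
qed

text \<open>If \<open>p\<close> is summable, letting \<open>b\<close> tend to infinity bounds the
  tail sum \<open>S a\<close> by \<open>M' * p a\<close>; removing \<open>p a\<close> then shrinks
  the tail by a fixed factor. If not, the partial sums \<open>Q b\<close> eventually outweigh the
  contribution of the left end, so \<open>Q b\<close> is bounded by a multiple of the next term
  \<open>p (Suc b)\<close>, and adding this term enlarges the sum by a fixed factor.\<close>

lemma geometric_dichotomy:
  fixes p :: "nat \<Rightarrow> real"
  assumes p: "\<And>n. p n > 0"
    and M: "\<And>a b. N \<le> a \<Longrightarrow> a \<le> b \<Longrightarrow> (\<Sum>j=a..b. p j) \<le> M * (p a + p (Suc b))"
  shows "(\<exists>r. 0 < r \<and> r < 1 \<and> (\<exists>C. \<forall>n k. p (n + k) \<le> C * r ^ k * p n)) \<or>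
    (\<exists>r>1. \<exists>C. \<forall>n k. r ^ k * p n \<le> C * p (n + k))"
proof -
  \<comment> \<open>At least 2, so that the decay factor \<open>1 - 1 / M'\<close> is
    positive.\<close>
  define M' where "M' = max M 2"
  have M': "M' \<ge> 2" by (simp add: M'_def)
  have le: "(\<Sum>j=a..b. p j) \<le> M' * (p a + p (Suc b))" if "N \<le> a" "a \<le> b" for a b
    by (rule order_trans[OF M[OF that] mult_right_mono]) (use p[of a] p[of "Suc b"] in \<open>auto simp: M'_def\<close>)
  show ?thesis
  proof (cases "summable p")
    case True
    define S where "S a = (\<Sum>k. p (a + k))" for a
    have summ: "summable (\<lambda>k. p (a + k))" for a
      using summable_iff_shift[of p a] True by (simp add: add.commute)
    have S_le: "S a \<le> M' * p a" if "a \<ge> N" for a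
    proof -
      have "(\<lambda>n. \<Sum>k<n. p (a + k)) \<longlonglongrightarrow> S a"
        unfolding S_def using summable_LIMSEQ[OF summ] .
      then have lim: "(\<lambda>n. \<Sum>k<Suc n. p (a + k)) \<longlonglongrightarrow> S a" by (rule LIMSEQ_Suc)
      have "(\<lambda>n. p (a + n)) \<longlonglongrightarrow> 0" by (rule summable_LIMSEQ_zero[OF summ])
      then have "(\<lambda>n. M' * (p a + p (a + Suc n))) \<longlonglongrightarrow> M' * (p a + 0)"
        by (intro tendsto_intros LIMSEQ_Suc[of "\<lambda>n. p (a + n)"])
      moreover have "(\<Sum>k<Suc n. p (a + k)) \<le> M' * (p a + p (a + Suc n))" for n
      proof -
        have "(\<Sum>k<Suc n. p (a + k)) = (\<Sum>j=a..a+n. p j)"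
          by (rule sum.reindex_bij_witness[of _ "\<lambda>j. j - a" "\<lambda>k. a + k"]) auto
        then show ?thesis using le[of a "a + n"] that by simp
      qed
      ultimately show ?thesis using LIMSEQ_le[OF lim] by fastforce
    qed
    define r where "r = 1 - 1 / M'"
    have r: "0 < r" "r < 1" using M' by (auto simp: r_def field_simps)
    have S_Suc: "S (Suc a) = S a - p a" for a
      unfolding S_def using suminf_split_head[OF summ[of a]] by simp
    have S_pow: "S (a + k) \<le> r ^ k * S a" if "a \<ge> N" for a k
    proof (induction k)
      case (Suc k)
      have "S (a + Suc k) = S (a + k) - p (a + k)" using S_Suc[of "a + k"] by simp
      also have "\<dots> \<le> r * S (a + k)" using S_le[of "a + k"] that M' by (simp add: r_def field_simps)
      also have "\<dots> \<le> r * (r ^ k * S a)" using Suc r by (intro mult_left_mono) auto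
      finally show ?case by simp
    qed simp
    have p_le: "p a \<le> S a" for a
      unfolding S_def using sum_le_suminf[OF summ, of "{0}" a] p by (auto intro: less_imp_le)
    have "p (a + k) \<le> M' * r ^ k * p a" if "a \<ge> N" for a k
    proof -
      have "p (a + k) \<le> S (a + k)" by (rule p_le)
      also have "\<dots> \<le> r ^ k * S a" by (rule S_pow[OF that])
      also have "\<dots> \<le> r ^ k * (M' * p a)" using r S_le[OF that] by (intro mult_left_mono) auto
      finally show ?thesis by (simp add: mult_ac)
    qed
    \<comment> \<open>The powers of \<open>r\<close> are divided out so that the extension to
      indices below \<open>N\<close> applies to a sequence without rate.\<close>
    then have "\<exists>C. \<forall>n k. p (n + k) / r ^ (n + k) \<le> C * (p n / r ^ n)"
      using r p by (intro bounded_ratio_from[where N = N] exI[of _ M'])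
        (auto simp: divide_le_eq power_add mult_ac)
    then have "\<exists>C. \<forall>n k. p (n + k) \<le> C * r ^ k * p n"
      using r by (simp add: divide_le_eq power_add mult_ac)
    then show ?thesis using r by blast
  next
    case False
    define Q where "Q b = (\<Sum>j=N..b. p j)" for b
    \<comment> \<open>From this size on, the left-end term \<open>M' * p N\<close> is at most half
      of \<open>Q b\<close>, so half of \<open>Q b\<close> has to be paid for by the right
      end.\<close>
    have "\<exists>b. Q b \<ge> 2 * M' * p N"
    proof (rule ccontr)
      assume "\<not> ?thesis"
      then have *: "Q b \<le> 2 * M' * p N" for b by (meson linear)
      have "(\<Sum>j<n. p j) \<le> (\<Sum>j<N. p j) + 2 * M' * p N" for n
      proof -
        have "(\<Sum>j<n. p j) \<le> (\<Sum>j\<in>{..<N} \<union> {N..n}. p j)"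
          using p by (intro sum_mono2) (auto intro: less_imp_le)
        also have "\<dots> = (\<Sum>j<N. p j) + Q n"
          unfolding Q_def by (intro sum.union_disjoint) auto
        finally show ?thesis using *[of n] by simp
      qed
      then have "summable p" using p by (intro summableI_nonneg_bounded) (auto intro: less_imp_le)
      with False show False by simp
    qed
    then obtain b0 where b0: "Q b0 \<ge> 2 * M' * p N" by blast
    have Q_mono: "Q b \<le> Q b'" if "b \<le> b'" for b b'
      unfolding Q_def using that p by (intro sum_mono2) (auto intro: less_imp_le)
    define N' where "N' = max N b0"
    have Q_le: "Q b \<le> 2 * M' * p (Suc b)" if "b \<ge> N'" for b
      using le[of N b] Q_mono[of b0 b] b0 that unfolding Q_def N'_def by (simp add: algebra_simps)
    define r where "r = 1 + 1 / (2 * M')"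
    have r: "r > 1" using M' by (simp add: r_def)
    have Q_pow: "r ^ k * Q b \<le> Q (b + k)" if "b \<ge> N'" for b k
    proof (induction k)
      case (Suc k)
      have "r ^ Suc k * Q b \<le> r * Q (b + k)" using Suc r by (simp add: mult_left_mono)
      also have "\<dots> \<le> Q (b + k) + p (Suc (b + k))"
        using Q_le[of "b + k"] that M' by (simp add: r_def field_simps)
      also have "\<dots> = Q (b + Suc k)" using that by (simp add: Q_def N'_def)
      finally show ?case .
    qed simp
    have pQ: "p n \<le> Q n" if "n \<ge> N" for n
      unfolding Q_def using member_le_sum[of n "{N..n}" p] that p by (auto intro: less_imp_le)
    have main: "r ^ k * p n \<le> 2 * M' * r * p (n + k)" if "n \<ge> N'" for n k
    proof (cases k)
      case 0
      have "1 \<le> 2 * M' * r" using M' r by (smt (verit) mult_le_cancel_left1)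
      then show ?thesis using mult_right_mono[of 1 "2 * M' * r" "p n"] p[of n] 0 by simp
    next
      case (Suc k')
      have "r ^ k' * p n \<le> r ^ k' * Q n" using r pQ[of n] that by (intro mult_left_mono) (auto simp: N'_def)
      also have "\<dots> \<le> 2 * M' * p (n + k)"
        using Q_pow[of n k'] Q_le[of "n + k'"] that Suc by simp
      finally show ?thesis using r Suc mult_left_mono[of "r ^ k' * p n" _ r] by (simp add: mult_ac)
    qed
    have "\<exists>C. \<forall>n k. r ^ k * p n \<le> C * p (n + k)"
      by (rule lower_ratio_from[OF p _ main]) (use r in auto)
    then show ?thesis using r by blast
  qed
qed

text \<open>For \<open>s = norm z\<close> the hypothesis says that every truncation of the formal
  eigenfunctional has a share of its mass bounded below at its two ends. Its negation, used later,
  provides a truncation with negligible ends. The rate \<open>s\<close> is split off and put back at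
  the end.\<close>

lemma growth_dichotomy:
  assumes W: "\<And>n. W n > 0" and s: "s > 0"
    and M: "\<And>a b. N \<le> a \<Longrightarrow> a \<le> b \<Longrightarrow>
      (\<Sum>j=a..b. W j / s ^ j) \<le> M * (W a / s ^ a + W (Suc b) / s ^ Suc b)"
  shows "(\<exists>t<s. upper_growth W t) \<or> (\<exists>t>s. lower_growth W t)"
proof -
  consider (up) r C where "0 < r" "r < 1" "\<And>n k. W (n + k) / s ^ (n + k) \<le> C * r ^ k * (W n / s ^ n)"
    | (low) r C where "r > 1" "\<And>n k. r ^ k * (W n / s ^ n) \<le> C * (W (n + k) / s ^ (n + k))"
    using geometric_dichotomy[of "\<lambda>j. W j / s ^ j", OF _ M] divide_pos_pos[OF W zero_less_power[OF s]]
    by metis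
  then show ?thesis
  proof cases
    case up
    have "W (n + k) \<le> C * (r * s) ^ k * W n" for n k
      using up(3)[of n k] s by (simp add: field_simps power_add power_mult_distrib)
    then have "upper_growth W (r * s)" using up s by (auto simp: upper_growth_def)
    then show ?thesis using up s by (intro disjI1 exI[of _ "r * s"]) auto
  next
    case low
    have "(r * s) ^ k * W n \<le> C * W (n + k)" for n k
      using low(2)[of k n] s by (simp add: field_simps power_add power_mult_distrib)
    then have "lower_growth W (r * s)" using low s by (auto simp: lower_growth_def)
    then show ?thesis using low s by (intro disjI2 exI[of _ "r * s"]) auto
  qed
qed


section \<open>Complex scalars, coordinates and powers\<close>

lemma linf_eqI: "(\<And>n. apply_bcontfun x n = apply_bcontfun y n) \<Longrightarrow> x = (y :: linf)"
  by (rule bcontfun_eqI) auto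

lemma cscale_one: "blinfun_apply (cscale 1) x = x"
  by (rule linf_eqI) (simp add: cscale_apply)

lemma cscale_cscale: "blinfun_apply (cscale a) (blinfun_apply (cscale b) x) = blinfun_apply (cscale (a * b)) x"
  by (rule linf_eqI) (simp add: cscale_apply)

lemma cscale_add_left:
  "blinfun_apply (cscale (a + b)) x = blinfun_apply (cscale a) x + blinfun_apply (cscale b) x"
  by (rule linf_eqI) (simp add: cscale_apply algebra_simps)

lemma norm_linf_le: "(\<And>n. norm (apply_bcontfun x n) \<le> b) \<Longrightarrow> norm (x :: linf) \<le> b"
  by (rule norm_bound)

lemma norm_cscale_apply: "norm (blinfun_apply (cscale a) x) = norm a * norm x"
proof -
  have le: "norm (blinfun_apply (cscale a) x) \<le> norm a * norm x" for a x
    by (rule norm_linf_le) (auto simp: cscale_apply norm_mult intro!: mult_left_mono norm_bounded)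
  show ?thesis
  proof (cases "a = 0")
    case True
    then show ?thesis using le[of 0 x] by simp
  next
    case False
    have "norm x = norm (blinfun_apply (cscale (1 / a)) (blinfun_apply (cscale a) x))"
      using False by (simp add: cscale_cscale cscale_one)
    also have "\<dots> \<le> norm (1 / a) * norm (blinfun_apply (cscale a) x)" by (rule le)
    finally show ?thesis using False le[of a x] by (simp add: norm_divide field_simps)
  qed
qed

lemma norm_cscale_le: "norm (cscale a) \<le> norm a"
  by (rule norm_blinfun_bound) (auto simp: norm_cscale_apply)

lemma bounded_linear_coordinate: "bounded_linear (\<lambda>x :: linf. apply_bcontfun x n)"
  by (rule bounded_linear_intro[where K = 1]) (auto intro: norm_bounded)

lemma sums_coordinate:
  "X sums (x :: linf) \<Longrightarrow> (\<lambda>k. apply_bcontfun (X k) n) sums apply_bcontfun x n"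
  by (rule bounded_linear.sums[OF bounded_linear_coordinate])

definition blinfun_power :: "('a::real_normed_vector \<Rightarrow>\<^sub>L 'a) \<Rightarrow> nat \<Rightarrow> 'a \<Rightarrow>\<^sub>L 'a" where
  "blinfun_power T k = Blinfun (blinfun_apply T ^^ k)"

lemma blinfun_power_apply: "blinfun_apply (blinfun_power T k) = blinfun_apply T ^^ k"
  unfolding blinfun_power_def
  by (simp add: bounded_linear_Blinfun_apply bounded_linear_blinfun_funpow)

section \<open>Resolvent and spectrum of a weighted shift\<close>

locale weighted_shift =
  fixes w :: "nat \<Rightarrow> real"
  assumes w_pos: "\<And>n. 0 < w n" and bounded_w: "bounded (range w)"
begin

abbreviation B where "B \<equiv> backward_shift w"

section \<open>Weight products, growth rates and formal eigenfunctionals\<close>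

definition W :: "nat \<Rightarrow> real" where "W n = (\<Prod>j<n. w j)"

lemma W_pos: "W n > 0"
  by (auto simp: W_def w_pos intro!: prod_pos)

lemma W_0: "W 0 = 1" by (simp add: W_def)

lemma W_Suc: "W (Suc n) = w n * W n" by (simp add: W_def)

lemma W_neq_0 [simp]: "W n \<noteq> 0" using W_pos[of n] by simp

lemma B_apply: "apply_bcontfun (blinfun_apply B x) n = of_real (w n) * apply_bcontfun x (Suc n)"
  by (rule backward_shift_apply[OF bounded_w])

lemma B_funpow_apply:
  "apply_bcontfun ((blinfun_apply B ^^ k) x) n = of_real (W (n + k) / W n) * apply_bcontfun x (n + k)"
proof (induction k arbitrary: n)
  case (Suc k)
  show ?case
    using Suc[of "Suc n"] w_pos[of n] by (simp add: B_apply W_Suc field_simps)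
qed simp

lemma B_cscale: "blinfun_apply B (blinfun_apply (cscale a) x) = blinfun_apply (cscale a) (blinfun_apply B x)"
  by (rule linf_eqI) (simp add: B_apply cscale_apply)

lemma norm_B_funpow_le:
  assumes "upper_growth W t"
  obtains C where "C > 0" "\<And>k x. norm ((blinfun_apply B ^^ k) x) \<le> C * t ^ k * norm x"
proof -
  obtain C where t: "t > 0" and C: "\<And>n k. W (n + k) \<le> C * t ^ k * W n"
    using assms by (auto simp: upper_growth_def)
  have "1 \<le> C" using C[of 0 0] W_0 by simp
  moreover have "norm ((blinfun_apply B ^^ k) x) \<le> C * t ^ k * norm x" for k x
  proof (rule norm_linf_le)
    fix n
    have "W (n + k) / W n \<le> C * t ^ k" using C[of n k] W_pos[of n] by (simp add: field_simps)
    then have "\<bar>W (n + k) / W n\<bar> \<le> C * t ^ k" using W_pos[of n] W_pos[of "n + k"] by simp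
    then show "norm (apply_bcontfun ((blinfun_apply B ^^ k) x) n) \<le> C * t ^ k * norm x"
      unfolding B_funpow_apply norm_mult norm_of_real
      using t \<open>1 \<le> C\<close> by (intro mult_mono norm_bounded) auto
  qed
  ultimately show ?thesis using that[of C] by simp
qed

text \<open>This is the spectral radius of \<open>B\<close>, expressed by growth rates of the weight
  products.\<close>

definition rad :: real where "rad = Inf {t. upper_growth W t}"

lemma upper_growth_mono:
  assumes "upper_growth W t" "t \<le> t'"
  shows "upper_growth W t'"
proof -
  obtain C where t: "t > 0" and C: "\<And>n k. W (n + k) \<le> C * t ^ k * W n"
    using assms by (auto simp: upper_growth_def)
  have "1 \<le> C" using C[of 0 0] W_0 by simp
  have "W (n + k) \<le> C * t' ^ k * W n" for n k
    using t assms(2) W_pos[of n] \<open>1 \<le> C\<close>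
    by (intro order_trans[OF C] mult_right_mono mult_left_mono power_mono) auto
  then show ?thesis using t assms(2) by (auto simp: upper_growth_def)
qed

lemma rad_le: "upper_growth W t \<Longrightarrow> rad \<le> t"
  unfolding rad_def by (rule cInf_lower) (auto simp: upper_growth_def intro!: bdd_belowI[of _ 0])

lemma upper_growth_exists: "\<exists>t. upper_growth W t"
proof -
  obtain b where b: "\<And>n. \<bar>w n\<bar> \<le> b" using bounded_w by (auto simp: bounded_iff)
  have w: "w n \<le> b" for n using b[of n] by simp
  have "b > 0" using w[of 0] w_pos[of 0] by simp
  have "W (n + k) \<le> 1 * b ^ k * W n" for n k
  proof (induction k)
    case (Suc k)
    have "w (n + k) * W (n + k) \<le> b * (1 * b ^ k * W n)"
      using Suc w W_pos[of "n + k"] \<open>b > 0\<close> by (intro mult_mono) auto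
    then show ?case by (simp add: W_Suc)
  qed simp
  then show ?thesis using \<open>b > 0\<close> unfolding upper_growth_def by blast
qed

lemma rad_nonneg: "rad \<ge> 0"
  unfolding rad_def by (rule cInf_greatest) (use upper_growth_exists in \<open>auto simp: upper_growth_def\<close>)

lemma upper_growth_of_rad_less: "rad < t \<Longrightarrow> upper_growth W t"
  using cInf_lessD[of "{t. upper_growth W t}" t] upper_growth_exists upper_growth_mono
  unfolding rad_def by (auto intro: less_imp_le)

text \<open>Starting at index 0, a lower rate \<open>t\<close> and an upper rate
  \<open>r < t\<close> would keep the powers of \<open>t / r > 1\<close> bounded.\<close>

lemma lower_growth_le_rad:
  assumes "lower_growth W t"
  shows "t \<le> rad"
proof (rule ccontr)
  assume "\<not> t \<le> rad"
  then obtain r where r: "rad < r" "r < t" using dense[of rad t] by auto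
  obtain C where t: "t > 0" and C: "\<And>n k. t ^ k * W n \<le> C * W (n + k)"
    using assms by (auto simp: lower_growth_def)
  obtain D where "r > 0" and D: "\<And>n k. W (n + k) \<le> D * r ^ k * W n"
    using upper_growth_of_rad_less[OF r(1)] by (auto simp: upper_growth_def)
  have "1 \<le> C" using C[of 0 0] W_0 by simp
  have "(t / r) ^ k \<le> C * D" for k
  proof -
    have "t ^ k \<le> C * W k" using C[of k 0] W_0 by simp
    also have "\<dots> \<le> C * (D * r ^ k)" using D[of 0 k] \<open>1 \<le> C\<close> W_0 by (intro mult_left_mono) auto
    finally show ?thesis using \<open>r > 0\<close> by (simp add: power_divide field_simps)
  qed
  moreover obtain k where "C * D < (t / r) ^ k"
    using real_arch_pow[of "t / r" "C * D"] r \<open>r > 0\<close> by auto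
  ultimately show False by (meson not_le)
qed

text \<open>The only candidate, up to a factor, for an eigenvector of \<open>B\<close> at
  \<open>z\<close>. It is a plain sequence because it may be unbounded.\<close>

definition eigenseq :: "complex \<Rightarrow> nat \<Rightarrow> complex" where
  "eigenseq z n = z ^ n / of_real (W n)"

text \<open>
  The formal eigenfunctional \<open>x \<mapsto> \<Sum>\<^sub>j W\<^sub>j x\<^sub>j / z\<^sup>j\<close>, truncated to an interval;
  only the two ends contribute to the error.
\<close>

lemma truncated_eigenfunctional:
  assumes z: "z \<noteq> 0" and "a \<le> b"
  defines "v \<equiv> \<lambda>j. of_real (W j) / z ^ j"
  shows "fin_functional v {a..b} (blinfun_apply B x) - z * fin_functional v {a..b} x
    = z * (v (Suc b) * apply_bcontfun x (Suc b) - v a * apply_bcontfun x a)"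
  using assms(2)
proof (induction b rule: dec_induct)
  case base
  show ?case using z by (simp add: fin_functional_def v_def B_apply W_Suc field_simps)
next
  case (step b)
  have "{a..Suc b} = insert (Suc b) {a..b}" using step by auto
  then have *: "fin_functional v {a..Suc b} y = v (Suc b) * apply_bcontfun y (Suc b) + fin_functional v {a..b} y" for y
    by (simp add: fin_functional_def)
  have "v (Suc b) * apply_bcontfun (blinfun_apply B x) (Suc b)
      = z * (v (Suc (Suc b)) * apply_bcontfun x (Suc (Suc b)))"
    using z by (simp add: v_def B_apply W_Suc field_simps)
  then show ?case using step.IH unfolding * by (simp add: algebra_simps)
qed

lemma norm_truncated_eigenfunctional:
  assumes z: "z \<noteq> 0" and "a \<le> b"
  defines "v \<equiv> \<lambda>j. of_real (W j) / z ^ j"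
  shows "norm (fin_functional v {a..b} (blinfun_apply B x) - z * fin_functional v {a..b} x)
    \<le> norm z * (W a / norm z ^ a + W (Suc b) / norm z ^ Suc b) * norm x"
proof -
  have v: "norm (v j) = W j / norm z ^ j" for j
    using W_pos[of j] by (simp add: v_def norm_divide norm_power)
  have "norm (v (Suc b) * apply_bcontfun x (Suc b) - v a * apply_bcontfun x a)
     \<le> norm (v (Suc b)) * norm x + norm (v a) * norm x"
    by (intro order_trans[OF norm_triangle_ineq4] add_mono)
      (auto simp: norm_mult intro!: mult_left_mono norm_bounded)
  also have "\<dots> = (W a / norm z ^ a + W (Suc b) / norm z ^ Suc b) * norm x"
    by (simp add: v algebra_simps)
  finally have "norm z * norm (v (Suc b) * apply_bcontfun x (Suc b) - v a * apply_bcontfun x a)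
     \<le> norm z * ((W a / norm z ^ a + W (Suc b) / norm z ^ Suc b) * norm x)"
    by (rule mult_left_mono) simp
  then show ?thesis
    unfolding v_def truncated_eigenfunctional[OF assms(1,2)] norm_mult mult.assoc .
qed

section \<open>The spectrum is the full disc of radius \<open>rad\<close>\<close>

lemma resolvent_unique:
  assumes "is_resolvent T z R" "is_resolvent T z R'"
  shows "R = R'"
proof -
  have id: "R o\<^sub>L id_blinfun = R" "id_blinfun o\<^sub>L R' = R'" by (auto intro: blinfun_eqI)
  have "R = R o\<^sub>L ((cscale z - T) o\<^sub>L R')" using assms by (simp add: is_resolvent_def id)
  also have "\<dots> = (R o\<^sub>L (cscale z - T)) o\<^sub>L R'" by (rule blinfun_eqI) simp
  finally show ?thesis using assms by (simp add: is_resolvent_def id)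
qed

text \<open>Both halves of invertibility are used. Injectivity keeps \<open>eigenseq z\<close>
  unbounded and so excludes lower rates above \<open>norm z\<close>. A bounded right inverse bounds
  the mass of each truncated eigenfunctional by its end terms, so the growth dichotomy leaves only
  an upper rate below \<open>norm z\<close>.\<close>

lemma upper_growth_of_resolvent:
  assumes R: "is_resolvent B z R"
  shows "\<exists>t<norm z. upper_growth W t"
proof -
  have RL: "blinfun_apply R (blinfun_apply (cscale z) x - blinfun_apply B x) = x"
    and LR: "blinfun_apply (cscale z) (blinfun_apply R x) - blinfun_apply B (blinfun_apply R x) = x" for x
  proof -
    have "blinfun_apply (R o\<^sub>L (cscale z - B)) x = x" "blinfun_apply ((cscale z - B) o\<^sub>L R) x = x"
      using R by (auto simp: is_resolvent_def)
    then show "blinfun_apply R (blinfun_apply (cscale z) x - blinfun_apply B x) = x"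
      "blinfun_apply (cscale z) (blinfun_apply R x) - blinfun_apply B (blinfun_apply R x) = x"
      by (auto simp: blinfun.diff_left)
  qed
  have no_kernel: "x = 0" if "blinfun_apply B x = blinfun_apply (cscale z) x" for x
    using RL[of x] that by simp
  have not_bounded: "\<nexists>C. \<forall>n. norm (eigenseq z n) \<le> C"
  proof
    assume "\<exists>C. \<forall>n. norm (eigenseq z n) \<le> C"
    then have app: "apply_bcontfun (Bcontfun (eigenseq z)) = eigenseq z"
      using bounded_seq_bcontfun Bcontfun_inverse by blast
    have "Bcontfun (eigenseq z) = 0"
      by (rule no_kernel, rule linf_eqI)
        (use w_pos in \<open>simp add: app B_apply cscale_apply eigenseq_def W_Suc less_imp_neq[THEN not_sym]\<close>)
    then have "eigenseq z 0 = 0" using app by (metis zero_bcontfun.rep_eq)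
    then show False by (simp add: eigenseq_def)
  qed
  \<comment> \<open>At 0 the sequence is (1, 0, 0, ...), since \<open>0 ^ 0 = 1\<close>, and this is
    bounded.\<close>
  have z: "z \<noteq> 0"
  proof
    assume "z = 0"
    then have "norm (eigenseq z n) \<le> 1" for n by (cases n) (auto simp: eigenseq_def W_0)
    with not_bounded show False by blast
  qed
  have not_lower: "\<not> lower_growth W t" if "t > norm z" for t
  proof
    assume "lower_growth W t"
    then obtain C where t: "t > 0" and C: "\<And>k n. t ^ k * W n \<le> C * W (n + k)"
      by (auto simp: lower_growth_def)
    have "norm (eigenseq z n) \<le> C" for n
    proof -
      have "norm z ^ n \<le> t ^ n" using that by (intro power_mono) auto
      also have "\<dots> \<le> C * W n" using C[of n 0] W_0 by simp
      finally show ?thesis using W_pos[of n] by (simp add: eigenseq_def norm_divide norm_power field_simps)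
    qed
    with not_bounded show False by blast
  qed
  define v where "v j = of_real (W j) / z ^ j" for j
  have v: "norm (v j) = W j / norm z ^ j" for j
    using W_pos[of j] by (simp add: v_def norm_divide norm_power)
  \<comment> \<open>The functional is tested on the vector \<open>h\<close> of conjugate phases. As
    \<open>h\<close> is the image of \<open>R h\<close> under \<open>z - B\<close>, its value is the
    eigenvalue defect at \<open>R h\<close>, which only sees the ends.\<close>
  have "(\<Sum>j=a..b. W j / norm z ^ j)
      \<le> (norm z * norm R) * (W a / norm z ^ a + W (Suc b) / norm z ^ Suc b)" if "a \<le> b" for a b
  proof -
    define h where "h j = (if j \<in> {a..b} then cnj (sgn (v j)) else 0)" for j
    have "norm (h j) \<le> 1" for j by (auto simp: h_def norm_sgn)
    then have h: "h \<in> bcontfun" by (rule bounded_seq_bcontfun)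
    then have app: "apply_bcontfun (Bcontfun h) = h" by (rule Bcontfun_inverse)
    have norm_h: "norm (Bcontfun h) \<le> 1"
      by (rule norm_linf_le) (use \<open>\<And>j. norm (h j) \<le> 1\<close> in \<open>simp add: app\<close>)
    have fh: "fin_functional v {a..b} (Bcontfun h) = of_real (\<Sum>j=a..b. norm (v j))"
      by (simp add: fin_functional_def app h_def mult_cnj_sgn)
    then have "(\<Sum>j=a..b. norm (v j)) = norm (fin_functional v {a..b} (Bcontfun h))"
      unfolding fh norm_of_real by (simp add: sum_nonneg)
    also have "\<dots> = norm (fin_functional v {a..b} (blinfun_apply B (blinfun_apply R (Bcontfun h)))
       - z * fin_functional v {a..b} (blinfun_apply R (Bcontfun h)))"
    proof -
      have "fin_functional v {a..b} (Bcontfun h)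
         = z * fin_functional v {a..b} (blinfun_apply R (Bcontfun h))
          - fin_functional v {a..b} (blinfun_apply B (blinfun_apply R (Bcontfun h)))"
        by (subst LR[symmetric])
          (simp add: fin_functional_def cscale_apply algebra_simps sum_subtractf sum_distrib_left)
      then show ?thesis by (simp add: norm_minus_commute)
    qed
    also have "\<dots> \<le> norm z * (W a / norm z ^ a + W (Suc b) / norm z ^ Suc b) * norm (blinfun_apply R (Bcontfun h))"
      unfolding v_def by (rule norm_truncated_eigenfunctional[OF z that])
    also have "\<dots> \<le> norm z * (W a / norm z ^ a + W (Suc b) / norm z ^ Suc b) * norm R"
    proof (rule mult_left_mono)
      have "norm (blinfun_apply R (Bcontfun h)) \<le> norm R * norm (Bcontfun h)" by (rule norm_blinfun)
      also have "\<dots> \<le> norm R * 1" using norm_h by (intro mult_left_mono) auto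
      finally show "norm (blinfun_apply R (Bcontfun h)) \<le> norm R" by simp
      show "0 \<le> norm z * (W a / norm z ^ a + W (Suc b) / norm z ^ Suc b)"
        using W_pos[of a] W_pos[of "Suc b"] by (intro mult_nonneg_nonneg add_nonneg_nonneg divide_nonneg_nonneg) auto
    qed
    finally show ?thesis by (simp add: v mult_ac)
  qed
  then have "(\<exists>t<norm z. upper_growth W t) \<or> (\<exists>t>norm z. lower_growth W t)"
    using z W_pos by (intro growth_dichotomy[where N = 0]) auto
  with not_lower show ?thesis by blast
qed

lemma norm_B_power_le:
  assumes "upper_growth W t"
  obtains C where "C > 0" "\<And>k. norm (blinfun_power B k) \<le> C * t ^ k"
proof -
  obtain C where C: "C > 0" "\<And>k x. norm ((blinfun_apply B ^^ k) x) \<le> C * t ^ k * norm x"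
    using norm_B_funpow_le[OF assms] by blast
  have "t > 0" using assms by (simp add: upper_growth_def)
  then have "norm (blinfun_power B k) \<le> C * t ^ k" for k
    using C by (intro norm_blinfun_bound) (auto simp: blinfun_power_apply)
  with C(1) that show ?thesis by blast
qed

lemma summable_B_power_series:
  assumes t: "upper_growth W t" "t < m" and c: "\<And>k. norm (c k) \<le> A / m ^ k"
  shows "summable (\<lambda>k. norm (cscale (c k) o\<^sub>L blinfun_power B k))"
proof -
  obtain C where C: "C > 0" "\<And>k. norm (blinfun_power B k) \<le> C * t ^ k"
    using norm_B_power_le[OF t(1)] by blast
  have "t > 0" using t by (simp add: upper_growth_def)
  have "A \<ge> 0" using c[of 0] order_trans[OF norm_ge_zero] by fastforce
  show ?thesis
  proof (rule summable_comparison_test')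
    show "summable (\<lambda>k. A * C * (t / m) ^ k)"
      using t \<open>t > 0\<close> by (intro summable_mult summable_geometric) auto
    fix k
    have "norm (cscale (c k) o\<^sub>L blinfun_power B k) \<le> norm (c k) * norm (blinfun_power B k)"
      by (intro order_trans[OF norm_blinfun_compose] mult_right_mono norm_cscale_le) auto
    also have "\<dots> \<le> (A / m ^ k) * (C * t ^ k)"
      using c[of k] C \<open>A \<ge> 0\<close> t \<open>t > 0\<close> by (intro mult_mono) auto
    finally show "norm (norm (cscale (c k) o\<^sub>L blinfun_power B k)) \<le> A * C * (t / m) ^ k"
      by (simp add: power_divide)
  qed
qed

text \<open>The Neumann series converges in operator norm because some upper rate lies below
  \<open>norm z\<close>. Its coordinate form is recorded as well, since contour integrals are
  evaluated coordinate by coordinate.\<close>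

lemma is_resolvent_Neumann:
  assumes "rad < norm z"
  shows "\<exists>R. is_resolvent B z R \<and>
    (\<forall>x n. (\<lambda>k. apply_bcontfun ((blinfun_apply B ^^ k) x) n / z ^ Suc k) sums apply_bcontfun (blinfun_apply R x) n)"
proof -
  obtain t where t: "rad < t" "t < norm z" using dense[OF assms] by blast
  have ut: "upper_growth W t" by (rule upper_growth_of_rad_less[OF t(1)])
  have z: "z \<noteq> 0" using t rad_nonneg by auto
  \<comment> \<open>Multiplying the Neumann term \<open>F k\<close> by \<open>z - B\<close> on
    either side gives \<open>a k - a (Suc k)\<close>, so both products telescope to
    \<open>a 0\<close>, the identity.\<close>
  define a where "a k = cscale (1 / z ^ k) o\<^sub>L blinfun_power B k" for k
  define F where "F k = cscale (1 / z ^ Suc k) o\<^sub>L blinfun_power B k" for k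
  have "summable (\<lambda>k. norm (F k))"
    unfolding F_def using t
    by (intro summable_B_power_series[OF ut t(2), where A = "1 / norm z"]) (auto simp: norm_divide norm_power norm_mult)
  then have F: "F sums suminf F" by (rule summable_norm_cancel[THEN summable_sums])
  have "summable (\<lambda>k. norm (a k))"
    unfolding a_def
    by (intro summable_B_power_series[OF ut t(2), where A = 1]) (auto simp: norm_divide norm_power)
  then have "a \<longlonglongrightarrow> 0" by (rule summable_LIMSEQ_zero[OF summable_norm_cancel])
  then have tele: "(\<lambda>k. a k - a (Suc k)) sums (a 0 - 0)" by (rule telescope_sums')
  have a0: "a 0 = id_blinfun"
    by (rule blinfun_eqI) (simp add: a_def blinfun_power_apply cscale_one)
  have FB: "F k o\<^sub>L (cscale z - B) = a k - a (Suc k)" for k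
  proof (rule blinfun_eqI, rule linf_eqI)
    fix x n
    show "apply_bcontfun (blinfun_apply (F k o\<^sub>L (cscale z - B)) x) n
       = apply_bcontfun (blinfun_apply (a k - a (Suc k)) x) n"
      using z w_pos[of n] by (simp add: F_def a_def blinfun.diff_left blinfun_power_apply B_funpow_apply B_apply W_Suc
          cscale_apply blinfun.diff_right field_simps)
  qed
  have BF: "(cscale z - B) o\<^sub>L F k = a k - a (Suc k)" for k
  proof (rule blinfun_eqI, rule linf_eqI)
    fix x n
    show "apply_bcontfun (blinfun_apply ((cscale z - B) o\<^sub>L F k) x) n
       = apply_bcontfun (blinfun_apply (a k - a (Suc k)) x) n"
      using z w_pos[of n] by (simp add: F_def a_def blinfun.diff_left blinfun_power_apply B_funpow_apply B_apply W_Suc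
          cscale_apply blinfun.diff_right field_simps)
  qed
  have "(\<lambda>k. F k o\<^sub>L (cscale z - B)) sums (suminf F o\<^sub>L (cscale z - B))"
    by (rule bounded_linear.sums[OF bounded_bilinear.bounded_linear_left[OF bounded_bilinear_blinfun_compose] F])
  then have 1: "suminf F o\<^sub>L (cscale z - B) = id_blinfun"
    unfolding FB using sums_unique2[OF _ tele] a0 by simp
  have "(\<lambda>k. (cscale z - B) o\<^sub>L F k) sums ((cscale z - B) o\<^sub>L suminf F)"
    by (rule bounded_linear.sums[OF bounded_bilinear.bounded_linear_right[OF bounded_bilinear_blinfun_compose] F])
  then have 2: "(cscale z - B) o\<^sub>L suminf F = id_blinfun"
    unfolding BF using sums_unique2[OF _ tele] a0 by simp
  have "(\<lambda>k. apply_bcontfun ((blinfun_apply B ^^ k) x) n / z ^ Suc k) sums apply_bcontfun (blinfun_apply (suminf F) x) n" for x n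
  proof -
    have "(\<lambda>k. blinfun_apply (F k) x) sums blinfun_apply (suminf F) x"
      by (rule bounded_linear.sums[OF blinfun.bounded_linear_left F])
    from sums_coordinate[OF this, of n] show ?thesis
      by (simp add: F_def cscale_apply blinfun_power_apply)
  qed
  with 1 2 show ?thesis unfolding is_resolvent_def by blast
qed

lemma op_spectrum_B: "op_spectrum B = cball 0 rad"
proof -
  have "rad < norm z" if "is_resolvent B z R" for z R
    using upper_growth_of_resolvent[OF that] rad_le by force
  then show ?thesis
    using is_resolvent_Neumann unfolding op_spectrum_def set_eq_iff mem_cball_0 mem_Collect_eq
    by (meson not_le)
qed

lemma resolvent_coordinate_sums:
  assumes "rad < norm z"
  shows "(\<lambda>k. apply_bcontfun ((blinfun_apply B ^^ k) x) n / z ^ Suc k)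
    sums apply_bcontfun (blinfun_apply (resolvent B z) x) n"
proof -
  obtain R where R: "is_resolvent B z R"
    "\<And>x n. (\<lambda>k. apply_bcontfun ((blinfun_apply B ^^ k) x) n / z ^ Suc k) sums apply_bcontfun (blinfun_apply R x) n"
    using is_resolvent_Neumann[OF assms] by blast
  have "resolvent B z = R"
    unfolding resolvent_def using R(1) resolvent_unique by blast
  with R(2) show ?thesis by simp
qed

end


section \<open>The functional calculus of a weighted shift as a power series\<close>

context weighted_shift
begin

text \<open>Convergence is demanded only in each coordinate, which reduces operator-valued integrals
  to complex ones. For \<open>s > rad\<close> the coefficient bound upgrades it to norm convergence
  later.\<close>

definition power_series_op :: "real \<Rightarrow> (linf \<Rightarrow>\<^sub>L linf) \<Rightarrow> bool" where
  "power_series_op s T \<longleftrightarrow> (\<exists>c A. (\<forall>k. norm (c k) \<le> A / s ^ k) \<and>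
     (\<forall>x n. (\<lambda>k. c k * apply_bcontfun ((blinfun_apply B ^^ k) x) n) sums apply_bcontfun (blinfun_apply T x) n))"

lemma power_series_op_zero: "power_series_op s 0"
  unfolding power_series_op_def by (rule exI[of _ "\<lambda>_. 0"], rule exI[of _ 0]) simp

lemma power_series_op_add:
  assumes "power_series_op s T" "power_series_op s S"
  shows "power_series_op s (T + S)"
proof -
  obtain c A d D where c: "\<And>k. norm (c k) \<le> A / s ^ k" and d: "\<And>k. norm (d k) \<le> D / s ^ k"
    and T: "\<And>x n. (\<lambda>k. c k * apply_bcontfun ((blinfun_apply B ^^ k) x) n) sums apply_bcontfun (blinfun_apply T x) n"
    and S: "\<And>x n. (\<lambda>k. d k * apply_bcontfun ((blinfun_apply B ^^ k) x) n) sums apply_bcontfun (blinfun_apply S x) n"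
    using assms unfolding power_series_op_def by blast
  have "norm (c k + d k) \<le> (A + D) / s ^ k" for k
    using norm_triangle_le[of "c k" "d k"] add_mono[OF c[of k] d[of k]] by (simp add: add_divide_distrib)
  moreover have "(\<lambda>k. (c k + d k) * apply_bcontfun ((blinfun_apply B ^^ k) x) n)
      sums apply_bcontfun (blinfun_apply (T + S) x) n" for x n
    using sums_add[OF T[of x n] S[of x n]] by (simp add: blinfun.add_left distrib_right)
  ultimately show ?thesis unfolding power_series_op_def
    by (intro exI[of _ "\<lambda>k. c k + d k"] exI[of _ "A + D"]) blast
qed

lemma power_series_op_cscale:
  assumes "power_series_op s T"
  shows "power_series_op s (cscale a o\<^sub>L T)"
proof -
  obtain c A where c: "\<And>k. norm (c k) \<le> A / s ^ k"
    and T: "\<And>x n. (\<lambda>k. c k * apply_bcontfun ((blinfun_apply B ^^ k) x) n) sums apply_bcontfun (blinfun_apply T x) n"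
    using assms unfolding power_series_op_def by blast
  have "norm (a * c k) \<le> (norm a * A) / s ^ k" for k
    using mult_left_mono[OF c[of k], of "norm a"] by (simp add: norm_mult)
  moreover have "(\<lambda>k. (a * c k) * apply_bcontfun ((blinfun_apply B ^^ k) x) n)
      sums apply_bcontfun (blinfun_apply (cscale a o\<^sub>L T) x) n" for x n
    using sums_mult[OF T[of x n], of a] by (simp add: cscale_apply mult.assoc)
  ultimately show ?thesis unfolding power_series_op_def
    by (intro exI[of _ "\<lambda>k. a * c k"] exI[of _ "norm a * A"]) blast
qed

lemma power_series_op_mono:
  assumes "power_series_op s T" "0 < r" "r \<le> s"
  shows "power_series_op r T"
proof -
  obtain c A where c: "\<And>k. norm (c k) \<le> A / s ^ k"
    and T: "\<And>x n. (\<lambda>k. c k * apply_bcontfun ((blinfun_apply B ^^ k) x) n) sums apply_bcontfun (blinfun_apply T x) n"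
    using assms unfolding power_series_op_def by blast
  have "A \<ge> 0" using c[of 0] order_trans[OF norm_ge_zero] by fastforce
  then have "norm (c k) \<le> A / r ^ k" for k
    using assms by (intro order_trans[OF c] divide_left_mono power_mono) auto
  with T show ?thesis unfolding power_series_op_def by blast
qed

text \<open>The path is compact, so it keeps away from some disc of radius \<open>s > rad\<close>,
  outside which the Neumann series converges uniformly. Termwise integration gives the coefficients,
  the contour integrals of \<open>f z / z ^ Suc k\<close>, and these are bounded by a multiple of
  \<open>1 / s ^ k\<close>.\<close>

lemma power_series_op_contour_integral:
  assumes "open U" and f: "f holomorphic_on U" and \<gamma>: "valid_path \<gamma>" "path_image \<gamma> \<subseteq> U - cball 0 rad"
  shows "\<exists>s>rad. power_series_op s (op_contour_integral \<gamma> (\<lambda>z. cscale (f z) o\<^sub>L resolvent B z))"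
proof -
  define F where "F t = cscale (vector_derivative \<gamma> (at t within {0..1})) o\<^sub>L
    (cscale (f (\<gamma> t)) o\<^sub>L resolvent B (\<gamma> t))" for t
  have op: "op_contour_integral \<gamma> (\<lambda>z. cscale (f z) o\<^sub>L resolvent B z) = integral {0..1} F"
    by (simp add: op_contour_integral_def F_def[abs_def])
  show ?thesis
  proof (cases "F integrable_on {0..1}")
    \<comment> \<open>The integral of a non-integrable function is 0 by convention, and the zero
      operator is a power series.\<close>
    case False
    then show ?thesis
      unfolding op by (intro exI[of _ "rad + 1"]) (simp add: not_integrable_integral power_series_op_zero)
  next
    case True
    have K: "compact (path_image \<gamma>)" "path_image \<gamma> \<noteq> {}"
      using \<gamma> valid_path_imp_path by (auto intro: compact_path_image)
    obtain z0 where z0: "z0 \<in> path_image \<gamma>" "\<And>z. z \<in> path_image \<gamma> \<Longrightarrow> norm z0 \<le> norm z"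
      using continuous_attains_inf[OF K, of norm] continuous_on_norm_id by blast
    have "rad < norm z0" using z0(1) \<gamma>(2) by auto
    then obtain s where s: "rad < s" "s < norm z0" using dense by blast
    obtain t where t: "rad < t" "t < s" using s dense by blast
    have pos: "0 < t" "0 < s" using s t rad_nonneg by auto
    have cont: "continuous_on U f" using f by (rule holomorphic_on_imp_continuous_on)
    have "compact (f ` path_image \<gamma>)"
      using \<gamma> by (intro compact_continuous_image K continuous_on_subset[OF cont]) auto
    then obtain M where M: "M > 0" "\<And>z. z \<in> path_image \<gamma> \<Longrightarrow> norm (f z) \<le> M"
      using bounded_pos[of "f ` path_image \<gamma>"] compact_imp_bounded by blast
    \<comment> \<open>The bound for contour integrals of holomorphic functions needs an open set
      around the path. This one keeps both \<open>norm z > s\<close> and a bound on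
      \<open>f\<close>.\<close>
    define S where "S = (U \<inter> f -` ball 0 (M + 1)) \<inter> - cball 0 s"
    have "open (U \<inter> f -` ball 0 (M + 1))"
      using continuous_open_preimage[OF cont \<open>open U\<close> open_ball] .
    then have S: "open S" unfolding S_def by (rule open_Int) auto
    have S_sub: "S \<subseteq> U" "\<And>z. z \<in> S \<Longrightarrow> s < norm z" "\<And>z. z \<in> S \<Longrightarrow> norm (f z) \<le> M + 1"
      by (auto simp: S_def)
    have pS: "path_image \<gamma> \<subseteq> S"
      using \<gamma>(2) M(2) z0(2) s unfolding S_def by (force intro: le_less_trans)
    have hf: "f holomorphic_on S" using f S_sub by (auto intro: holomorphic_on_subset)
    have S0: "0 \<notin> S" using S_sub(2)[of 0] pos by auto
    obtain L where L: "L > 0" "\<And>h D. h holomorphic_on S \<Longrightarrow> (\<And>z. z \<in> S \<Longrightarrow> norm (h z) \<le> D) \<Longrightarrow>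
        norm (contour_integral \<gamma> h) \<le> L * D"
      using contour_integral_bound_exists[OF S \<gamma>(1) pS] by blast
    define c where "c k = contour_integral \<gamma> (\<lambda>z. f z / z ^ Suc k)" for k
    have holk: "(\<lambda>z. f z / z ^ Suc k) holomorphic_on S" for k
      using S0 by (intro holomorphic_intros hf) auto
    have c: "norm (c k) \<le> (L * (M + 1) / s) / s ^ k" for k
    proof -
      have "norm (f z / z ^ Suc k) \<le> (M + 1) / s ^ Suc k" if "z \<in> S" for z
        unfolding norm_divide norm_power using S_sub that pos M(1)
        by (intro frac_le power_mono) (auto intro: less_imp_le)
      from L(2)[OF holk this] show ?thesis by (simp add: c_def mult_ac)
    qed
    have "(\<lambda>k. c k * apply_bcontfun ((blinfun_apply B ^^ k) x) n) sums
        apply_bcontfun (blinfun_apply (integral {0..1} F) x) n" for x n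
    proof -
      define b where "b k = apply_bcontfun ((blinfun_apply B ^^ k) x) n" for k
      obtain C where C: "C > 0" "\<And>k x. norm ((blinfun_apply B ^^ k) x) \<le> C * t ^ k * norm x"
        using norm_B_funpow_le[OF upper_growth_of_rad_less[OF t(1)]] by blast
      have b: "norm (b k) \<le> C * norm x * t ^ k" for k
        unfolding b_def using order_trans[OF norm_bounded C(2)[of k x]] by (simp add: mult_ac)
      define R where "R z = apply_bcontfun (blinfun_apply (resolvent B z) x) n" for z
      have R: "(\<lambda>k. b k / z ^ Suc k) sums R z" if "z \<in> S" for z
        unfolding b_def R_def using S_sub(2)[OF that] t by (intro resolvent_coordinate_sums) auto
      define q where "q = t / s"
      have q: "0 < q" "q < 1" using t pos by (auto simp: q_def)
      have bz: "norm (b k * \<zeta> ^ k) \<le> C * norm x * q ^ k" if "norm \<zeta> \<le> 1 / s" for k \<zeta>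
      proof -
        have "norm (b k * \<zeta> ^ k) \<le> (C * norm x * t ^ k) * (1 / s) ^ k"
          unfolding norm_mult norm_power using that C pos by (intro mult_mono b power_mono) auto
        then show ?thesis by (simp add: q_def power_divide)
      qed
      \<comment> \<open>Substituting \<open>1 / z\<close> turns the Neumann series of a coordinate
        into an ordinary power series, which shows that \<open>R\<close> is holomorphic on
        \<open>S\<close>.\<close>
      define G where "G \<zeta> = (\<Sum>k. b k * \<zeta> ^ k)" for \<zeta>
      have G: "(\<lambda>k. b k * \<zeta> ^ k) sums G \<zeta>" if "norm \<zeta> < 1 / s" for \<zeta>
        unfolding G_def
      proof (rule summable_sums, rule summable_comparison_test')
        show "summable (\<lambda>k. C * norm x * q ^ k)" using q by (intro summable_mult summable_geometric) auto
        show "norm (b k * \<zeta> ^ k) \<le> C * norm x * q ^ k" for k using that by (intro bz) auto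
      qed
      have hG: "G holomorphic_on ball 0 (1 / s)"
        by (rule power_series_holomorphic[of 0 "1/s" b]) (use G in auto)
      have inv: "norm (1 / z) < 1 / s" if "z \<in> S" for z
        unfolding norm_divide norm_one using S_sub(2)[OF that] pos by (intro frac_less2) auto
      have R_eq: "R z = G (1 / z) * (1 / z)" if "z \<in> S" for z
      proof -
        from sums_mult2[OF G[OF inv[OF that]], of "1 / z"]
        have "(\<lambda>k. b k / z ^ Suc k) sums (G (1 / z) * (1 / z))" by (simp add: power_divide mult_ac)
        with R[OF that] show ?thesis by (rule sums_unique2)
      qed
      have hinv: "(\<lambda>z. 1 / z) holomorphic_on S" using S0 by (intro holomorphic_intros) auto
      have "(G \<circ> (\<lambda>z. 1 / z)) holomorphic_on S"
        using inv by (intro holomorphic_on_compose_gen[OF hinv hG]) auto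
      then have "(\<lambda>z. (G \<circ> (\<lambda>z. 1 / z)) z * (1 / z)) holomorphic_on S"
        by (intro holomorphic_on_mult hinv)
      then have hR: "R holomorphic_on S"
        by (rule holomorphic_transform) (simp add: R_eq)
      have int: "((\<lambda>z. f z * R z) has_contour_integral apply_bcontfun (blinfun_apply (integral {0..1} F) x) n) \<gamma>"
      proof -
        have "bounded_linear (\<lambda>S :: linf \<Rightarrow>\<^sub>L linf. apply_bcontfun (blinfun_apply S x) n)"
          by (rule bounded_linear_compose[OF bounded_linear_coordinate blinfun.bounded_linear_left])
        from has_integral_linear[OF integrable_integral[OF True] this]
        show ?thesis
          unfolding has_contour_integral_def o_def F_def by (simp add: cscale_apply R_def mult_ac)
      qed
      \<comment> \<open>The difference is the contour integral of \<open>f\<close> times the tail of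
        the Neumann series, and this tail is geometrically small uniformly on
        \<open>S\<close>.\<close>
      have partial: "norm ((\<Sum>k<N. c k * b k) - contour_integral \<gamma> (\<lambda>z. f z * R z))
         \<le> L * ((M + 1) * (C * norm x * q ^ N / s / (1 - q)))" for N
      proof -
        define h where "h z = (\<Sum>k<N. b k * (f z / z ^ Suc k)) - f z * R z" for z
        have "h holomorphic_on S" unfolding h_def
          by (intro holomorphic_intros hf hR) (use S0 in auto)
        moreover have "norm (h z) \<le> (M + 1) * (C * norm x * q ^ N / s / (1 - q))" if z: "z \<in> S" for z
        proof -
          have "(\<lambda>k. b (k + N) / z ^ Suc (k + N)) sums (R z - (\<Sum>k<N. b k / z ^ Suc k))"
            by (rule sums_split_initial_segment[OF R[OF z]])
          moreover have "(\<lambda>k. (C * norm x * q ^ N / s) * q ^ k) sums ((C * norm x * q ^ N / s) * (1 / (1 - q)))"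
            using q by (intro sums_mult geometric_sums) auto
          moreover have "norm (b (k + N) / z ^ Suc (k + N)) \<le> (C * norm x * q ^ N / s) * q ^ k" for k
          proof -
            have "norm (b (k + N) / z ^ Suc (k + N)) \<le> (C * norm x * t ^ (k + N)) / s ^ Suc (k + N)"
              unfolding norm_divide norm_power using S_sub(2)[OF z] pos C
              by (intro frac_le b power_mono) (auto intro: less_imp_le)
            then show ?thesis by (simp add: q_def power_divide power_add mult_ac)
          qed
          ultimately have "norm (R z - (\<Sum>k<N. b k / z ^ Suc k)) \<le> C * norm x * q ^ N / s * (1 / (1 - q))"
            by (rule norm_sums_le)
          then have "norm (f z) * norm (R z - (\<Sum>k<N. b k / z ^ Suc k))
              \<le> (M + 1) * (C * norm x * q ^ N / s * (1 / (1 - q)))"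
            using S_sub(3)[OF z] M(1) by (intro mult_mono) auto
          moreover have "h z = - (f z * (R z - (\<Sum>k<N. b k / z ^ Suc k)))"
            by (simp add: h_def right_diff_distrib sum_distrib_left mult_ac)
          ultimately show ?thesis by (simp add: norm_mult)
        qed
        ultimately have "norm (contour_integral \<gamma> h) \<le> L * ((M + 1) * (C * norm x * q ^ N / s / (1 - q)))"
          by (rule L(2))
        moreover have "contour_integral \<gamma> h = (\<Sum>k<N. c k * b k) - contour_integral \<gamma> (\<lambda>z. f z * R z)"
        proof -
          have i: "(\<lambda>z. f z / z ^ Suc k) contour_integrable_on \<gamma>" for k
            by (rule contour_integrable_holomorphic_simple[OF holk S \<gamma>(1) pS])
          have "((\<lambda>z. f z / z ^ Suc k) has_contour_integral c k) \<gamma>" for k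
            unfolding c_def by (rule has_contour_integral_integral[OF i])
          then have "(h has_contour_integral (\<Sum>k<N. b k * c k) - contour_integral \<gamma> (\<lambda>z. f z * R z)) \<gamma>"
            unfolding h_def
            by (intro has_contour_integral_diff has_contour_integral_sum has_contour_integral_lmul
                has_contour_integral_integral) (use int in \<open>auto simp: contour_integrable_on_def\<close>)
          then show ?thesis by (simp add: contour_integral_unique mult.commute)
        qed
        ultimately show ?thesis by simp
      qed
      have "(\<lambda>N. q ^ N) \<longlonglongrightarrow> 0" using q by (intro LIMSEQ_power_zero) auto
      then have "(\<lambda>N. L * ((M + 1) * (C * norm x * q ^ N / s / (1 - q)))) \<longlonglongrightarrow> L * ((M + 1) * (C * norm x * 0 / s / (1 - q)))"
        using q pos by (intro tendsto_intros) auto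
      then have "(\<lambda>N. (\<Sum>k<N. c k * b k) - contour_integral \<gamma> (\<lambda>z. f z * R z)) \<longlonglongrightarrow> 0"
        by (intro Lim_null_comparison[OF always_eventually[OF allI[OF partial]]]) simp
      then have "(\<lambda>k. c k * b k) sums contour_integral \<gamma> (\<lambda>z. f z * R z)"
        unfolding sums_def by (simp add: LIM_zero_iff)
      then show ?thesis using contour_integral_unique[OF int] by (simp add: b_def)
    qed
    then show ?thesis
      unfolding op power_series_op_def using s(1) c by blast
  qed
qed

text \<open>A circle slightly larger than the disc surrounds it. Hence the choice operator in
  \<open>hol_calc\<close> really returns a surrounding cycle.\<close>

lemma surrounding_cycle_exists:
  assumes "open U" "cball 0 rad \<subseteq> U"
  shows "\<exists>\<Gamma>. surrounds_in \<Gamma> (cball 0 rad) U"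
proof -
  obtain e where e: "e > 0" "(\<Union>x\<in>cball 0 rad. ball x e) \<subseteq> U"
    using compact_subset_open_imp_ball_epsilon_subset[OF compact_cball assms] by blast
  define r where "r = rad + e / 2"
  have r: "rad < r" using e by (simp add: r_def)
  have sub: "cball 0 r \<subseteq> U"
  proof
    fix z :: complex assume z: "z \<in> cball 0 r"
    show "z \<in> U"
    proof (cases "norm z \<le> rad")
      case True
      then show ?thesis using assms by auto
    next
      case False
      \<comment> \<open>The radial projection of \<open>z\<close> to the disc; its distance from
        \<open>z\<close> is \<open>norm z - rad\<close>, at most \<open>e / 2\<close>.\<close>
      define y where "y = (rad / norm z) *\<^sub>R z"
      have n: "norm z > 0" using False rad_nonneg by auto
      have "norm y = rad" using n rad_nonneg by (simp add: y_def)
      moreover have "y - z = ((rad - norm z) / norm z) *\<^sub>R z"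
        using n by (simp add: y_def diff_divide_distrib scaleR_diff_left)
      then have "norm (y - z) = \<bar>rad - norm z\<bar>" using n by simp
      ultimately have "y \<in> cball 0 rad" "z \<in> ball y e"
        using z False e by (auto simp: dist_norm r_def)
      then show ?thesis using e(2) by blast
    qed
  qed
  have "0 < r" using r rad_nonneg by simp
  have "surrounds_in [circlepath 0 r] (cball 0 rad) U"
    unfolding surrounds_in_def
  proof (intro conjI ballI allI impI)
    fix z assume "z \<in> cball (0::complex) rad"
    then show "(\<Sum>\<gamma>\<leftarrow>[circlepath 0 r]. winding_number \<gamma> z) = 1"
      using r by (simp add: winding_number_circlepath)
  next
    fix z assume "z \<notin> U"
    then have "z \<notin> cball 0 r" using sub by blast
    then have "winding_number (circlepath 0 r) z = 0"
      using \<open>0 < r\<close> by (intro winding_number_zero_outside[where s = "cball 0 r"]) auto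
    then show "(\<Sum>\<gamma>\<leftarrow>[circlepath 0 r]. winding_number \<gamma> z) = 0" by simp
  qed (use sub r \<open>0 < r\<close> in auto)
  then show ?thesis by blast
qed

text \<open>Of the chosen cycle only the defining properties are known, but they keep each of its
  paths off the disc. Every path comes with its own radius above \<open>rad\<close>, and the minimum
  over the finite list serves the sum.\<close>

lemma power_series_op_hol_calc:
  assumes U: "open U" "op_spectrum B \<subseteq> U" and f: "f holomorphic_on U"
  shows "\<exists>s>rad. power_series_op s (hol_calc f U B)"
proof -
  define \<Gamma> where "\<Gamma> = (SOME \<Gamma>. surrounds_in \<Gamma> (op_spectrum B) U)"
  have "\<exists>\<Gamma>. surrounds_in \<Gamma> (op_spectrum B) U"
    using surrounding_cycle_exists U unfolding op_spectrum_B by blast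
  then have "surrounds_in \<Gamma> (op_spectrum B) U" unfolding \<Gamma>_def by (rule someI_ex)
  then have \<gamma>: "valid_path \<gamma>" "path_image \<gamma> \<subseteq> U - cball 0 rad" if "\<gamma> \<in> set \<Gamma>" for \<gamma>
    using that by (auto simp: surrounds_in_def op_spectrum_B)
  have "\<exists>s>rad. power_series_op s
      (\<Sum>\<gamma>\<leftarrow>\<Delta>. op_contour_integral \<gamma> (\<lambda>z. cscale (f z) o\<^sub>L resolvent B z))"
    if "set \<Delta> \<subseteq> set \<Gamma>" for \<Delta>
    using that
  proof (induction \<Delta>)
    case Nil
    then show ?case by (intro exI[of _ "rad + 1"]) (simp add: power_series_op_zero)
  next
    case (Cons \<gamma> \<Delta>)
    then obtain s where s: "s > rad" "power_series_op s
      (\<Sum>\<gamma>\<leftarrow>\<Delta>. op_contour_integral \<gamma> (\<lambda>z. cscale (f z) o\<^sub>L resolvent B z))" by auto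
    obtain r where r: "r > rad" "power_series_op r (op_contour_integral \<gamma> (\<lambda>z. cscale (f z) o\<^sub>L resolvent B z))"
      using power_series_op_contour_integral[OF U(1) f \<gamma>] Cons.prems by (meson list.set_intros(1) subsetD)
    have "power_series_op (min r s) (op_contour_integral \<gamma> (\<lambda>z. cscale (f z) o\<^sub>L resolvent B z)
       + (\<Sum>\<gamma>\<leftarrow>\<Delta>. op_contour_integral \<gamma> (\<lambda>z. cscale (f z) o\<^sub>L resolvent B z)))"
      using s r rad_nonneg by (intro power_series_op_add) (auto intro: power_series_op_mono)
    then show ?case using s r by (intro exI[of _ "min r s"]) simp
  qed
  then show ?thesis
    unfolding hol_calc_def \<Gamma>_def[symmetric] Let_def using power_series_op_cscale by blast
qed

end


section \<open>Power series in a weighted shift\<close>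

lemma fin_functional_cscale: "fin_functional v S (blinfun_apply (cscale a) x) = a * fin_functional v S x"
  by (simp add: fin_functional_def cscale_apply sum_distrib_left mult_ac)

lemma summable_Suc_geometric:
  fixes q :: real
  assumes "\<bar>q\<bar> < 1"
  shows "summable (\<lambda>k. real (Suc k) * q ^ k)"
  using geometric_deriv_sums[of q] assms sums_summable by force

locale shift_series = weighted_shift +
  fixes T :: "linf \<Rightarrow>\<^sub>L linf" and c :: "nat \<Rightarrow> complex" and A m :: real
  assumes rad_less: "rad < m" and c_le: "\<And>k. norm (c k) \<le> A / m ^ k"
    and T_coordinate: "\<And>x n. (\<lambda>k. c k * apply_bcontfun ((blinfun_apply B ^^ k) x) n)
      sums apply_bcontfun (blinfun_apply T x) n"
begin

lemma m_pos: "m > 0" using rad_less rad_nonneg by simp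

lemma A_nonneg: "A \<ge> 0" using c_le[of 0] order_trans[OF norm_ge_zero] by fastforce

text \<open>With an upper rate \<open>t\<close> strictly between \<open>rad\<close> and
  \<open>m\<close> the operator series converges absolutely, and its coordinates identify the sum as
  \<open>T\<close>. Bounded functionals may therefore be applied term by term.\<close>

lemma T_sums: "(\<lambda>k. blinfun_apply (cscale (c k)) ((blinfun_apply B ^^ k) x)) sums blinfun_apply T x"
proof -
  obtain t where t: "rad < t" "t < m" using dense[OF rad_less] by blast
  define F where "F k = cscale (c k) o\<^sub>L blinfun_power B k" for k
  have "summable (\<lambda>k. norm (F k))"
    unfolding F_def by (rule summable_B_power_series[OF upper_growth_of_rad_less[OF t(1)] t(2) c_le])
  then have "F sums suminf F" by (rule summable_norm_cancel[THEN summable_sums])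
  then have s: "(\<lambda>k. blinfun_apply (F k) x) sums blinfun_apply (suminf F) x"
    by (rule bounded_linear.sums[OF blinfun.bounded_linear_left])
  have "blinfun_apply (suminf F) x = blinfun_apply T x"
  proof (rule linf_eqI)
    fix n
    show "apply_bcontfun (blinfun_apply (suminf F) x) n = apply_bcontfun (blinfun_apply T x) n"
      using sums_coordinate[OF s, of n] T_coordinate[of x n]
      by (intro sums_unique2) (auto simp: F_def cscale_apply blinfun_power_apply)
  qed
  with s show ?thesis by (simp add: F_def blinfun_power_apply)
qed

definition g :: "complex \<Rightarrow> complex" where "g z = (\<Sum>k. c k * z ^ k)"

lemma g_sums: "norm z < m \<Longrightarrow> (\<lambda>k. c k * z ^ k) sums g z"
  unfolding g_def
proof (rule summable_sums, rule summable_comparison_test')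
  assume z: "norm z < m"
  then show "summable (\<lambda>k. A * (norm z / m) ^ k)"
    using m_pos by (intro summable_mult summable_geometric) auto
  fix k
  have "norm (c k * z ^ k) \<le> (A / m ^ k) * norm z ^ k"
    unfolding norm_mult norm_power using c_le by (intro mult_right_mono) auto
  then show "norm (c k * z ^ k) \<le> A * (norm z / m) ^ k" by (simp add: power_divide)
qed

lemma g_holomorphic: "g holomorphic_on ball 0 m"
  by (rule power_series_holomorphic[of 0 m c]) (use g_sums in auto)

lemma B_funpow_cscale:
  "(blinfun_apply B ^^ k) (blinfun_apply (cscale a) x) = blinfun_apply (cscale a) ((blinfun_apply B ^^ k) x)"
  by (induction k) (auto simp: B_cscale)

lemma T_cscale: "blinfun_apply T (blinfun_apply (cscale a) x) = blinfun_apply (cscale a) (blinfun_apply T x)"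
proof -
  have "(\<lambda>k. blinfun_apply (cscale a) (blinfun_apply (cscale (c k)) ((blinfun_apply B ^^ k) x)))
      sums blinfun_apply (cscale a) (blinfun_apply T x)"
    by (rule bounded_linear.sums[OF blinfun.bounded_linear_right T_sums])
  with T_sums[of "blinfun_apply (cscale a) x"] show ?thesis
    by (intro sums_unique2[of "\<lambda>k. blinfun_apply (cscale (c k)) ((blinfun_apply B ^^ k) (blinfun_apply (cscale a) x))"])
      (auto simp: B_funpow_cscale cscale_cscale mult.commute)
qed

lemma T_funpow_cscale:
  "(blinfun_apply T ^^ k) (blinfun_apply (cscale a) x) = blinfun_apply (cscale a) ((blinfun_apply T ^^ k) x)"
  by (induction k) (auto simp: T_cscale)

text \<open>Telescoping as in \<open>fin_functional_funpow\<close>, a defect \<delta> for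
  \<open>B\<close> becomes at most \<open>k * C * s ^ (k - 1)\<close> times \<delta> for the
  \<open>k\<close>-th power, where \<open>s\<close> exceeds both \<open>rad\<close> and
  \<open>norm z\<close>. Because \<open>s < m\<close>, these factors are summable against the
  coefficients, so \<open>K\<close> depends neither on the functional nor on its support.\<close>

lemma approximate_eigenfunctional_T:
  assumes "norm z < m"
  obtains K where "K \<ge> 0" "\<And>\<delta> v S x. \<lbrakk>\<delta> \<ge> 0;
      \<And>x. norm (fin_functional v S (blinfun_apply B x) - z * fin_functional v S x) \<le> \<delta> * norm x\<rbrakk> \<Longrightarrow>
      norm (fin_functional v S (blinfun_apply T x) - g z * fin_functional v S x) \<le> K * \<delta> * norm x"
proof -
  obtain s where s: "max rad (norm z) < s" "s < m"
    using dense[of "max rad (norm z)" m] assms rad_less by auto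
  have "s > 0" using s rad_nonneg by auto
  obtain C where C: "C > 0" "\<And>k x. norm ((blinfun_apply B ^^ k) x) \<le> C * s ^ k * norm x"
    using norm_B_funpow_le upper_growth_of_rad_less s(1) by (metis max_less_iff_conj)
  have summ: "summable (\<lambda>k. real (Suc k) * (s / m) ^ k)"
    using s \<open>s > 0\<close> by (intro summable_Suc_geometric) auto
  define K where "K = (A * C / s) * (\<Sum>k. real (Suc k) * (s / m) ^ k)"
  have "K \<ge> 0"
    unfolding K_def using A_nonneg C \<open>s > 0\<close> m_pos by (intro mult_nonneg_nonneg suminf_nonneg summ) auto
  moreover have "norm (fin_functional v S (blinfun_apply T x) - g z * fin_functional v S x) \<le> K * \<delta> * norm x"
    if \<delta>: "\<delta> \<ge> 0" and v: "\<And>x. norm (fin_functional v S (blinfun_apply B x) - z * fin_functional v S x) \<le> \<delta> * norm x"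
    for \<delta> v S x
  proof -
    let ?\<phi> = "fin_functional v S"
    have power: "norm (?\<phi> ((blinfun_apply B ^^ k) x) - z ^ k * ?\<phi> x) \<le> real k * (C * s ^ k / s) * \<delta> * norm x" for k
    proof (induction k)
      case (Suc k)
      let ?y = "(blinfun_apply B ^^ k) x"
      have "?\<phi> (blinfun_apply B ?y) - z ^ Suc k * ?\<phi> x
          = (?\<phi> (blinfun_apply B ?y) - z * ?\<phi> ?y) + z * (?\<phi> ?y - z ^ k * ?\<phi> x)"
        by (simp add: algebra_simps)
      also have "norm \<dots> \<le> norm (?\<phi> (blinfun_apply B ?y) - z * ?\<phi> ?y) + norm z * norm (?\<phi> ?y - z ^ k * ?\<phi> x)"
        by (rule norm_triangle_mono) (auto simp: norm_mult)
      also have "\<dots> \<le> \<delta> * (C * s ^ k * norm x) + s * (real k * (C * s ^ k / s) * \<delta> * norm x)"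
      proof (rule add_mono)
        show "norm (?\<phi> (blinfun_apply B ?y) - z * ?\<phi> ?y) \<le> \<delta> * (C * s ^ k * norm x)"
          by (rule order_trans[OF v[of ?y] mult_left_mono[OF C(2)[of k x] \<delta>]])
        show "norm z * norm (?\<phi> ?y - z ^ k * ?\<phi> x) \<le> s * (real k * (C * s ^ k / s) * \<delta> * norm x)"
          using s(1) \<open>s > 0\<close> by (intro mult_mono Suc.IH) auto
      qed
      also have "\<dots> = real (Suc k) * (C * s ^ Suc k / s) * \<delta> * norm x"
        using \<open>s > 0\<close> by (simp add: field_simps)
      finally show ?case by simp
    qed simp
    have "(\<lambda>k. ?\<phi> (blinfun_apply (cscale (c k)) ((blinfun_apply B ^^ k) x))) sums ?\<phi> (blinfun_apply T x)"
      by (rule bounded_linear.sums[OF bounded_linear_fin_functional T_sums])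
    then have "(\<lambda>k. c k * ?\<phi> ((blinfun_apply B ^^ k) x) - c k * z ^ k * ?\<phi> x)
        sums (?\<phi> (blinfun_apply T x) - g z * ?\<phi> x)"
      by (intro sums_diff sums_mult2 g_sums assms) (simp add: fin_functional_cscale)
    moreover have "(\<lambda>k. (real (Suc k) * (s / m) ^ k) * ((A * C / s) * \<delta> * norm x)) sums
        ((\<Sum>k. real (Suc k) * (s / m) ^ k) * ((A * C / s) * \<delta> * norm x))"
      by (intro sums_mult2 summable_sums summ)
    moreover have "norm (c k * ?\<phi> ((blinfun_apply B ^^ k) x) - c k * z ^ k * ?\<phi> x)
        \<le> (real (Suc k) * (s / m) ^ k) * ((A * C / s) * \<delta> * norm x)" for k
    proof -
      have "norm (c k * ?\<phi> ((blinfun_apply B ^^ k) x) - c k * z ^ k * ?\<phi> x)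
          = norm (c k) * norm (?\<phi> ((blinfun_apply B ^^ k) x) - z ^ k * ?\<phi> x)"
        by (simp add: right_diff_distrib mult.assoc flip: norm_mult)
      also have "\<dots> \<le> (A / m ^ k) * (real (Suc k) * (C * s ^ k / s) * \<delta> * norm x)"
        using C \<open>s > 0\<close> \<delta> A_nonneg m_pos
        by (intro mult_mono c_le order_trans[OF power] mult_right_mono) auto
      finally show ?thesis by (simp add: power_divide mult_ac)
    qed
    ultimately have "norm (?\<phi> (blinfun_apply T x) - g z * ?\<phi> x)
       \<le> (\<Sum>k. real (Suc k) * (s / m) ^ k) * ((A * C / s) * \<delta> * norm x)"
      by (rule norm_sums_le)
    then show ?thesis by (simp add: K_def mult_ac)
  qed
  ultimately show ?thesis using that by blast
qed

text \<open>For \<open>z \<noteq> 0\<close> both outcomes of the growth dichotomy are excluded: a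
  lower rate by hypothesis, an upper rate below \<open>norm z\<close> by
  \<open>norm z \<le> rad\<close>. So some interval beyond \<open>N\<close> violates its premise,
  and the normalised truncation to it is the functional.\<close>

lemma escaping_approximate_eigenfunctional_B:
  assumes z: "norm z \<le> rad" and no_lower: "\<nexists>t. norm z < t \<and> lower_growth W t" and \<delta>: "\<delta> > 0"
  shows "\<exists>S v. finite S \<and> S \<subseteq> {N..} \<and> (\<Sum>j\<in>S. norm (v j)) = 1 \<and>
    (\<forall>x. norm (fin_functional v S (blinfun_apply B x) - z * fin_functional v S x) \<le> \<delta> * norm x)"
proof (cases "z = 0")
  case False
  \<comment> \<open>The constant \<open>norm z / \<delta>\<close> makes the violated inequality say
    that the end terms, times \<open>norm z\<close>, are below \<delta> times the total
    mass.\<close>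
  have "\<not> (\<forall>a b. N \<le> a \<longrightarrow> a \<le> b \<longrightarrow> (\<Sum>j=a..b. W j / norm z ^ j)
      \<le> (norm z / \<delta>) * (W a / norm z ^ a + W (Suc b) / norm z ^ Suc b))"
  proof
    assume "\<forall>a b. N \<le> a \<longrightarrow> a \<le> b \<longrightarrow> (\<Sum>j=a..b. W j / norm z ^ j)
      \<le> (norm z / \<delta>) * (W a / norm z ^ a + W (Suc b) / norm z ^ Suc b)"
    then have "(\<exists>t<norm z. upper_growth W t) \<or> (\<exists>t>norm z. lower_growth W t)"
      using False by (intro growth_dichotomy[where N = N and M = "norm z / \<delta>", OF W_pos]) (simp, blast)
    then show False using no_lower rad_le z by force
  qed
  then obtain a b where ab: "N \<le> a" "a \<le> b"
    and less: "(norm z / \<delta>) * (W a / norm z ^ a + W (Suc b) / norm z ^ Suc b) < (\<Sum>j=a..b. W j / norm z ^ j)"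
    by (auto simp: not_le)
  define v where "v j = of_real (W j) / z ^ j" for j
  have v: "norm (v j) = W j / norm z ^ j" for j
    using W_pos[of j] by (simp add: v_def norm_divide norm_power)
  define s where "s = (\<Sum>j=a..b. norm (v j))"
  have s_eq: "(\<Sum>j=a..b. W j / norm z ^ j) = s" by (simp add: s_def v)
  have "0 \<le> (norm z / \<delta>) * (W a / norm z ^ a + W (Suc b) / norm z ^ Suc b)"
    using \<delta> W_pos[of a] W_pos[of "Suc b"]
    by (intro mult_nonneg_nonneg add_nonneg_nonneg divide_nonneg_nonneg) auto
  then have s: "s > 0" using less unfolding s_eq by (rule le_less_trans)
  have less': "norm z * (W a / norm z ^ a + W (Suc b) / norm z ^ Suc b) \<le> \<delta> * s"
    using less \<delta> unfolding s_eq times_divide_eq_left by (simp only: pos_divide_less_eq mult.commute[of s] less_imp_le)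
  have scale: "fin_functional (\<lambda>j. v j / of_real s) {a..b} x = fin_functional v {a..b} x / of_real s" for x
    by (simp add: fin_functional_def sum_divide_distrib)
  have sum1: "(\<Sum>j=a..b. norm (v j / of_real s)) = 1"
  proof -
    have "(\<Sum>j=a..b. norm (v j / of_real s)) = (\<Sum>j=a..b. norm (v j)) / s"
      using s by (simp add: norm_divide sum_divide_distrib)
    then show ?thesis using s by (simp flip: s_def)
  qed
  have est: "norm (fin_functional (\<lambda>j. v j / of_real s) {a..b} (blinfun_apply B x)
      - z * fin_functional (\<lambda>j. v j / of_real s) {a..b} x) \<le> \<delta> * norm x" for x
  proof -
    have "norm (fin_functional v {a..b} (blinfun_apply B x) - z * fin_functional v {a..b} x)
        \<le> (norm z * (W a / norm z ^ a + W (Suc b) / norm z ^ Suc b)) * norm x"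
      unfolding v_def by (rule norm_truncated_eigenfunctional[OF False ab(2)])
    also have "\<dots> \<le> (\<delta> * s) * norm x"
      using less' by (rule mult_right_mono) simp
    finally have "norm ((fin_functional v {a..b} (blinfun_apply B x) - z * fin_functional v {a..b} x) / of_real s) \<le> \<delta> * norm x"
      using s by (simp add: norm_divide field_simps)
    then show ?thesis unfolding scale by (simp add: diff_divide_distrib)
  qed
  show ?thesis
    by (rule exI[of _ "{a..b}"], rule exI[of _ "\<lambda>j. v j / of_real s"]) (use ab sum1 est in auto)
next
  \<comment> \<open>At \<open>z = 0\<close> the quotients by powers of \<open>z\<close> are
    meaningless. A single coordinate functional with small weight works instead; weights bounded
    away from 0 from \<open>N\<close> on would give a lower rate.\<close>
  case True
  have "\<exists>a\<ge>N. w a \<le> \<delta>"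
  proof (rule ccontr)
    assume "\<not> ?thesis"
    then have w: "w a > \<delta>" if "a \<ge> N" for a using that by (meson not_le)
    have pow: "\<delta> ^ k * W n \<le> W (n + k)" if "n \<ge> N" for n k
    proof (induction k)
      case (Suc k)
      have "\<delta> * (\<delta> ^ k * W n) \<le> w (n + k) * W (n + k)"
        using Suc w[of "n + k"] that \<delta> W_pos[of n] by (intro mult_mono) (auto intro: less_imp_le)
      then show ?case by (simp add: W_Suc mult_ac)
    qed simp
    have "\<exists>C. \<forall>n k. \<delta> ^ k * W n \<le> C * W (n + k)"
      by (rule lower_ratio_from[OF W_pos \<delta>, where N = N and C = 1]) (use pow in simp)
    then have "lower_growth W \<delta>" using \<delta> by (auto simp: lower_growth_def)
    with no_lower True \<delta> show False by auto
  qed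
  then obtain a where a: "a \<ge> N" "w a \<le> \<delta>" by blast
  have "norm (fin_functional (\<lambda>_. 1) {a} (blinfun_apply B x) - z * fin_functional (\<lambda>_. 1) {a} x) \<le> \<delta> * norm x" for x
    using True a w_pos[of a] \<delta>
    by (auto simp: fin_functional_def B_apply norm_mult intro!: mult_mono norm_bounded)
  then show ?thesis
    using a by (intro exI[of _ "{a}"] exI[of _ "\<lambda>_. 1"]) auto
qed

text \<open>Without such a rate the escaping functionals of \<open>B\<close> at \<open>z\<close> are
  also escaping functionals of \<open>T\<close>, now with eigenvalue \<open>g z\<close> in the
  closed unit disc.\<close>

lemma lower_growth_of_norm_g_le_1:
  assumes "0 \<in> A_set T" and z: "norm z \<le> rad" "norm (g z) \<le> 1"
  shows "\<exists>t. norm z < t \<and> lower_growth W t"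
proof (rule ccontr)
  assume no_lower: "\<nexists>t. norm z < t \<and> lower_growth W t"
  have "norm z < m" using z rad_less by simp
  then obtain K where K: "K \<ge> 0" "\<And>\<delta> v S x. \<lbrakk>\<delta> \<ge> 0;
      \<And>x. norm (fin_functional v S (blinfun_apply B x) - z * fin_functional v S x) \<le> \<delta> * norm x\<rbrakk> \<Longrightarrow>
      norm (fin_functional v S (blinfun_apply T x) - g z * fin_functional v S x) \<le> K * \<delta> * norm x"
    using approximate_eigenfunctional_T by blast
  show False
  proof (rule no_escaping_eigenfunctionals[OF assms(1) z(2)])
    fix N and e :: real assume e: "e > 0"
    \<comment> \<open>The summand 1 covers the case \<open>K = 0\<close>.\<close>
    define \<delta> where "\<delta> = e / (K + 1)"
    have \<delta>: "\<delta> > 0" using e K by (simp add: \<delta>_def)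
    obtain S v where S: "finite S" "S \<subseteq> {N..}" "(\<Sum>j\<in>S. norm (v j)) = 1"
      "\<And>x. norm (fin_functional v S (blinfun_apply B x) - z * fin_functional v S x) \<le> \<delta> * norm x"
      using escaping_approximate_eigenfunctional_B[OF z(1) no_lower \<delta>, of N] by blast
    have "K * \<delta> \<le> e" using K e by (simp add: \<delta>_def field_simps)
    then have "norm (fin_functional v S (blinfun_apply T x) - g z * fin_functional v S x) \<le> e * norm x" for x
      using order_trans[OF K(2)[OF _ S(4), of x] mult_right_mono[of "K * \<delta>" e "norm x"]] \<delta> by simp
    then show "\<exists>S v. finite S \<and> S \<subseteq> {N..} \<and> (\<Sum>j\<in>S. norm (v j)) = 1 \<and>
      (\<forall>x. norm (fin_functional v S (blinfun_apply T x) - g z * fin_functional v S x) \<le> e * norm x)"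
      using S(1-3) by blast
  qed
qed

end


section \<open>Deconvolution on an annulus\<close>

text \<open>Each side of the peak at \<open>j\<close> contributes at most
  \<open>1 / (1 - \<rho>)\<close>. The bound is uniform in \<open>j\<close>, as needed for a kernel
  whose rows are summed against a bounded sequence.\<close>

lemma two_sided_geometric_le:
  fixes \<rho> :: real
  assumes "0 \<le> \<rho>" "\<rho> < 1"
  shows "(\<Sum>k<N. if k < j then \<rho> ^ (j - k) else \<rho> ^ (k - j)) \<le> 2 / (1 - \<rho>)"
proof -
  have geo: "(\<Sum>l<n. \<rho> ^ l) \<le> 1 / (1 - \<rho>)" for n
  proof -
    have "(\<Sum>l<n. \<rho> ^ l) \<le> (\<Sum>l. \<rho> ^ l)"
      using assms by (intro sum_le_suminf summable_geometric) auto
    then show ?thesis using assms by (simp add: suminf_geometric)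
  qed
  have "(\<Sum>k<N. if k < j then \<rho> ^ (j - k) else \<rho> ^ (k - j))
      \<le> (\<Sum>k\<in>{..<j} \<union> {j..<j + N}. if k < j then \<rho> ^ (j - k) else \<rho> ^ (k - j))"
    using assms by (intro sum_mono2) auto
  also have "\<dots> = (\<Sum>k<j. \<rho> ^ (j - k)) + (\<Sum>k=j..<j+N. \<rho> ^ (k - j))"
    by (subst sum.union_disjoint) auto
  also have "(\<Sum>k<j. \<rho> ^ (j - k)) = (\<Sum>l\<in>{1..<Suc j}. \<rho> ^ l)"
    by (rule sum.reindex_bij_witness[of _ "\<lambda>l. j - l" "\<lambda>k. j - k"]) auto
  also have "\<dots> \<le> (\<Sum>l<Suc j. \<rho> ^ l)" using assms by (intro sum_mono2) auto
  also have "(\<Sum>k=j..<j+N. \<rho> ^ (k - j)) = (\<Sum>l<N. \<rho> ^ l)"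
    by (rule sum.reindex_bij_witness[of _ "\<lambda>l. l + j" "\<lambda>k. k - j"]) auto
  finally show ?thesis using geo[of "Suc j"] geo[of N] by simp
qed

text \<open>Orthogonality of monomials on a circle. The exponent \<open>j - 1 - k\<close> is kept as
  two divisions because it may be negative.\<close>

lemma contour_integral_circlepath_monomial:
  assumes "s > 0"
  shows "contour_integral (circlepath 0 s) (\<lambda>z. z ^ j / z / z ^ k) = (if k = j then 2 * of_real pi * \<i> else 0)"
proof -
  have nz: "z \<noteq> 0" if "z \<in> path_image (circlepath 0 s)" for z
    using that assms by auto
  consider "k = j" | "k < j" | "j < k" by linarith
  then show ?thesis
  proof cases
    case 1
    have "contour_integral (circlepath 0 s) (\<lambda>z. z ^ j / z / z ^ k) = contour_integral (circlepath 0 s) (\<lambda>z. 1 / (z - 0))"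
      by (rule contour_integral_eq) (use nz 1 in auto)
    then show ?thesis using contour_integral_circlepath[OF assms, of 0] 1 by simp
  next
    case 2
    have "z ^ j / z / z ^ k = z ^ (j - Suc k)" if "z \<in> path_image (circlepath 0 s)" for z
    proof -
      have "z ^ j = z ^ (j - Suc k) * (z * z ^ k)"
        using 2 by (metis Suc_leI le_add_diff_inverse2 power_Suc power_add)
      then show ?thesis using nz[OF that] by simp
    qed
    then have "contour_integral (circlepath 0 s) (\<lambda>z. z ^ j / z / z ^ k) = contour_integral (circlepath 0 s) (\<lambda>z. z ^ (j - Suc k))"
      by (rule contour_integral_eq)
    also have "\<dots> = 0"
      by (rule contour_integral_unique, rule Cauchy_theorem_convex_simple[where S = UNIV])
        (auto intro!: holomorphic_intros)
    finally show ?thesis using 2 by simp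
  next
    case 3
    define l where "l = k - j"
    have l: "k = l + j" "l > 0" using 3 by (auto simp: l_def)
    have "z ^ j / z / z ^ k = 1 / z ^ Suc l" if "z \<in> path_image (circlepath 0 s)" for z
      using nz[OF that] by (simp add: l power_add)
    then have "contour_integral (circlepath 0 s) (\<lambda>z. z ^ j / z / z ^ k) = contour_integral (circlepath 0 s) (\<lambda>z. 1 / z ^ Suc l)"
      by (rule contour_integral_eq)
    also have "\<dots> = 0"
    proof (rule contour_integral_unique, rule Cauchy_theorem_primitive[where S = "- {0}"])
      show "((\<lambda>z. - 1 / (of_nat l * z ^ l)) has_field_derivative 1 / z ^ Suc l) (at z within - {0})"
        if "z \<in> - {0}" for z :: complex
      proof -
        have "z * z ^ (l - Suc 0) = z ^ l" using l(2) by (cases l) auto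
        then show ?thesis
          using that l(2)
          by (auto intro!: derivative_eq_intros simp: field_simps power2_eq_square power_add)
      qed
    qed (use assms in auto)
    finally show ?thesis using 3 by simp
  qed
qed

section \<open>Generating functions of bounded sequences and the action of \<open>T\<close> on
  them\<close>

context shift_series
begin

text \<open>The full eigenfunctional series, read as a Laurent generating function of
  \<open>x\<close> in powers of \<open>1 / z\<close>. It converges for \<open>norm z > rad\<close>,
  and there \<open>B\<close> acts on it as multiplication by \<open>z\<close> up to one correction
  term.\<close>

definition dual :: "complex \<Rightarrow> linf \<Rightarrow> complex" where
  "dual z x = (\<Sum>p. of_real (W p) * apply_bcontfun x p / z ^ p)"

lemma dual_term_le:
  fixes z :: complex and x :: linf
  assumes C: "\<And>n k. W (n + k) \<le> C * t ^ k * W n" and r: "r \<le> norm z" "0 < r"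
  shows "norm (of_real (W p) * apply_bcontfun x p / z ^ p) \<le> C * norm x * (t / r) ^ p"
proof -
  have "norm (of_real (W p) * apply_bcontfun x p / z ^ p) = W p * norm (apply_bcontfun x p) / norm z ^ p"
    using W_pos[of p] by (simp add: norm_mult norm_divide norm_power)
  also have "\<dots> \<le> (C * t ^ p) * norm x / r ^ p"
    using C[of 0 p] W_0 r W_pos[of p]
    by (intro frac_le mult_mono power_mono norm_bounded) (auto intro: less_imp_le order_trans[OF less_imp_le[OF W_pos]])
  finally show ?thesis by (simp add: power_divide mult_ac)
qed

lemma dual_bound:
  assumes "rad < r"
  shows "\<exists>M q. 0 < q \<and> q < 1 \<and> M \<ge> 0 \<and> (\<forall>(z :: complex) (x :: linf) p. r \<le> norm z \<longrightarrow>
    norm (of_real (W p) * apply_bcontfun x p / z ^ p) \<le> M * norm x * q ^ p)"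
proof -
  obtain t where t: "rad < t" "t < r" using dense[OF assms] by blast
  obtain C where C: "t > 0" "\<And>n k. W (n + k) \<le> C * t ^ k * W n"
    using upper_growth_of_rad_less[OF t(1)] by (auto simp: upper_growth_def)
  have "1 \<le> C" using C(2)[of 0 0] W_0 by simp
  then show ?thesis
    using dual_term_le[OF C(2)] C(1) t by (intro exI[of _ C] exI[of _ "t / r"]) auto
qed

lemma dual_sums:
  assumes "rad < norm z"
  shows "(\<lambda>p. of_real (W p) * apply_bcontfun x p / z ^ p) sums dual z x"
proof -
  obtain M q where q: "0 < q" "q < 1" "M \<ge> 0"
    "\<And>(z' :: complex) (x :: linf) p. norm z \<le> norm z' \<Longrightarrow> norm (of_real (W p) * apply_bcontfun x p / z' ^ p) \<le> M * norm x * q ^ p"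
    using dual_bound[OF assms] by blast
  show ?thesis
    unfolding dual_def
  proof (rule summable_sums, rule summable_comparison_test')
    show "summable (\<lambda>p. M * norm x * q ^ p)" using q by (intro summable_mult summable_geometric) auto
    show "norm (of_real (W p) * apply_bcontfun x p / z ^ p) \<le> M * norm x * q ^ p" for p
      by (rule q(4)) simp
  qed
qed

lemma bounded_linear_dual:
  assumes "rad < norm z"
  shows "bounded_linear (dual z)"
proof -
  obtain M q where q: "0 < q" "q < 1" "M \<ge> 0"
    "\<And>(z' :: complex) (x :: linf) p. norm z \<le> norm z' \<Longrightarrow> norm (of_real (W p) * apply_bcontfun x p / z' ^ p) \<le> M * norm x * q ^ p"
    using dual_bound[OF assms] by blast
  show ?thesis
  proof (rule bounded_linear_intro[where K = "M * (1 / (1 - q))"])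
    fix x y :: linf and r :: real
    show "dual z (x + y) = dual z x + dual z y"
      using dual_sums[OF assms, of "x + y"] sums_add[OF dual_sums[OF assms, of x] dual_sums[OF assms, of y]]
      by (intro sums_unique2) (auto simp: ring_distribs add_divide_distrib)
    show "dual z (r *\<^sub>R x) = r *\<^sub>R dual z x"
      using dual_sums[OF assms, of "r *\<^sub>R x"] sums_scaleR_right[OF dual_sums[OF assms, of x], of r]
      by (intro sums_unique2) (auto simp: scaleR_conv_of_real mult_ac)
    have "(\<lambda>p. M * norm x * q ^ p) sums (M * norm x * (1 / (1 - q)))"
      using q by (intro sums_mult geometric_sums) auto
    from norm_sums_le[OF dual_sums[OF assms] this q(4)] show "norm (dual z x) \<le> norm x * (M * (1 / (1 - q)))"
      by (simp add: mult_ac)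
  qed
qed

lemma dual_cscale:
  assumes "rad < norm z"
  shows "dual z (blinfun_apply (cscale a) x) = a * dual z x"
  using dual_sums[OF assms, of "blinfun_apply (cscale a) x"] sums_mult[OF dual_sums[OF assms, of x], of a]
  by (intro sums_unique2) (auto simp: cscale_apply mult_ac)

lemma dual_B:
  assumes "rad < norm z"
  shows "dual z (blinfun_apply B x) = z * (dual z x - apply_bcontfun x 0)"
proof -
  have z: "z \<noteq> 0" using assms rad_nonneg by auto
  have "(\<lambda>p. of_real (W (Suc p)) * apply_bcontfun x (Suc p) / z ^ Suc p) sums (dual z x - apply_bcontfun x 0)"
    using dual_sums[OF assms, of x] by (subst sums_Suc_iff) (simp add: W_0)
  then have "(\<lambda>p. z * (of_real (W (Suc p)) * apply_bcontfun x (Suc p) / z ^ Suc p)) sums (z * (dual z x - apply_bcontfun x 0))"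
    by (rule sums_mult)
  with dual_sums[OF assms, of "blinfun_apply B x"] show ?thesis
    using z by (intro sums_unique2) (auto simp: B_apply W_Suc mult_ac)
qed

text \<open>After multiplication by \<open>z\<close> these are the terms of
  \<open>z ^ k * dual z x\<close> with positive powers of \<open>z\<close>, that is, the polar part
  at infinity, which the \<open>k\<close>-th power of the shift discards.\<close>

definition polar_part :: "linf \<Rightarrow> nat \<Rightarrow> complex \<Rightarrow> complex" where
  "polar_part x k z = (\<Sum>p<k. of_real (W p) * apply_bcontfun x p * z ^ (k - Suc p))"

lemma dual_B_funpow:
  assumes "rad < norm z"
  shows "dual z ((blinfun_apply B ^^ k) x) = z ^ k * dual z x - z * polar_part x k z"
proof (induction k)
  case (Suc k)
  have "polar_part x (Suc k) z = of_real (W k) * apply_bcontfun x k + (\<Sum>p<k. of_real (W p) * apply_bcontfun x p * z ^ (k - p))"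
    by (simp add: polar_part_def)
  also have "(\<Sum>p<k. of_real (W p) * apply_bcontfun x p * z ^ (k - p)) = z * polar_part x k z"
    unfolding polar_part_def sum_distrib_left
  proof (rule sum.cong)
    fix p assume "p \<in> {..<k}"
    then have "k - p = Suc (k - Suc p)" by auto
    then show "of_real (W p) * apply_bcontfun x p * z ^ (k - p) = z * (of_real (W p) * apply_bcontfun x p * z ^ (k - Suc p))"
      by (metis mult.left_commute power_Suc)
  qed simp
  finally have "polar_part x (Suc k) z = of_real (W k) * apply_bcontfun x k + z * polar_part x k z" .
  moreover have "apply_bcontfun ((blinfun_apply B ^^ k) x) 0 = of_real (W k) * apply_bcontfun x k"
    by (simp add: B_funpow_apply W_0)
  ultimately have "dual z (blinfun_apply B ((blinfun_apply B ^^ k) x))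
      = z * (z ^ k * dual z x - polar_part x (Suc k) z)"
    using dual_B[OF assms, of "(blinfun_apply B ^^ k) x"] Suc by simp
  then show ?case by (simp add: algebra_simps)
qed (simp add: polar_part_def)

text \<open>The discarded parts of all powers are summed against the coefficients. They are
  polynomials of size at most \<open>k * C * norm x * r ^ k / r\<close> on the disc of radius
  \<open>r < m\<close>, so their sum \<open>P\<close> is holomorphic on the whole disc although
  \<open>dual\<close> is only controlled outside radius \<open>rad\<close>. This is what allows a
  contour integral over the \<open>P\<close>-term to be moved inwards.\<close>

lemma dual_T:
  assumes r: "rad < r" "r < m"
  shows "\<exists>P. P holomorphic_on ball 0 r \<and>
    (\<forall>z. rad < norm z \<longrightarrow> norm z < r \<longrightarrow> dual z (blinfun_apply T x) = g z * dual z x - z * P z)"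
proof -
  have r0: "r > 0" using r rad_nonneg by simp
  obtain C where C: "\<And>n k. W (n + k) \<le> C * r ^ k * W n"
    using upper_growth_of_rad_less[OF r(1)] by (auto simp: upper_growth_def)
  have C1: "1 \<le> C" using C[of 0 0] W_0 by simp
  have polar: "norm (polar_part x k z) \<le> real k * (C * norm x * r ^ k / r)" if "norm z \<le> r" for k z
  proof -
    have "norm (polar_part x k z) \<le> (\<Sum>p<k. C * norm x * r ^ k / r)"
      unfolding polar_part_def
    proof (rule sum_norm_le)
      fix p assume p: "p \<in> {..<k}"
      have "norm (of_real (W p) * apply_bcontfun x p * z ^ (k - Suc p))
          = W p * norm (apply_bcontfun x p) * norm z ^ (k - Suc p)"
        using W_pos[of p] by (simp add: norm_mult norm_power)
      also have "\<dots> \<le> (C * r ^ p) * norm x * r ^ (k - Suc p)"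
        using C[of 0 p] W_0 that W_pos[of p] r0 C1
        by (intro mult_mono power_mono norm_bounded) (auto intro: less_imp_le)
      also have "\<dots> = C * norm x * (r ^ p * r ^ (k - Suc p))" by simp
      also have "r ^ p * r ^ (k - Suc p) = r ^ k / r"
        using p r0 by (simp add: field_simps flip: power_add power_Suc) 
      finally show "norm (of_real (W p) * apply_bcontfun x p * z ^ (k - Suc p)) \<le> C * norm x * r ^ k / r" by simp
    qed
    then show ?thesis by simp
  qed
  define M where "M k = real (Suc k) * (r / m) ^ k * (A * C * norm x / r)" for k
  have M: "summable M"
    unfolding M_def using r r0 m_pos by (intro summable_mult2 summable_Suc_geometric) auto
  have term_le: "norm (c k * polar_part x k z) \<le> M k" if "norm z \<le> r" for k z
  proof -
    have "norm (c k * polar_part x k z) \<le> (A / m ^ k) * (real (Suc k) * (C * norm x * r ^ k / r))"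
      unfolding norm_mult using A_nonneg m_pos C1 r0
      by (intro mult_mono c_le order_trans[OF polar[OF that] mult_right_mono]) auto
    then show ?thesis by (simp add: M_def power_divide mult_ac)
  qed
  define P where "P z = (\<Sum>k. c k * polar_part x k z)" for z
  have ul: "uniform_limit (ball 0 r) (\<lambda>n z. \<Sum>k<n. c k * polar_part x k z) P sequentially"
    unfolding P_def by (rule Weierstrass_m_test[OF _ M]) (use term_le in auto)
  have "P holomorphic_on ball 0 r"
  proof (rule holomorphic_uniform_sequence[OF open_ball])
    show "(\<lambda>z. \<Sum>k<n. c k * polar_part x k z) holomorphic_on ball 0 r" for n
      unfolding polar_part_def by (intro holomorphic_intros)
    fix z :: complex assume "z \<in> ball 0 r"
    then obtain d where "d > 0" "cball z d \<subseteq> ball 0 r" using open_contains_cball open_ball by blast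
    with ul show "\<exists>d>0. cball z d \<subseteq> ball 0 r \<and>
        uniform_limit (cball z d) (\<lambda>n z. \<Sum>k<n. c k * polar_part x k z) P sequentially"
      using uniform_limit_on_subset by blast
  qed
  moreover have "dual z (blinfun_apply T x) = g z * dual z x - z * P z" if z: "rad < norm z" "norm z < r" for z
  proof -
    have "(\<lambda>k. dual z (blinfun_apply (cscale (c k)) ((blinfun_apply B ^^ k) x))) sums dual z (blinfun_apply T x)"
      by (rule bounded_linear.sums[OF bounded_linear_dual[OF z(1)] T_sums])
    moreover have "summable (\<lambda>k. c k * polar_part x k z)"
      by (rule summable_comparison_test'[OF M]) (use term_le z in auto)
    then have "(\<lambda>k. (c k * z ^ k) * dual z x - z * (c k * polar_part x k z)) sums (g z * dual z x - z * P z)"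
      unfolding P_def using z r by (intro sums_diff sums_mult sums_mult2 g_sums summable_sums) auto
    ultimately show ?thesis
      by (intro sums_unique2) (auto simp: dual_cscale[OF z(1)] dual_B_funpow[OF z(1)] algebra_simps)
  qed
  ultimately show ?thesis by blast
qed

text \<open>Iterating replaces the error \<open>P\<close> by \<open>g z * P z + P' z\<close>, which
  is again holomorphic on the disc.\<close>

lemma dual_T_funpow:
  assumes r: "rad < r" "r < m"
  shows "\<exists>P. P holomorphic_on ball 0 r \<and>
    (\<forall>z. rad < norm z \<longrightarrow> norm z < r \<longrightarrow> dual z ((blinfun_apply T ^^ n) x) = g z ^ n * dual z x - z * P z)"
proof (induction n)
  case 0
  show ?case by (rule exI[of _ "\<lambda>_. 0"]) simp
next
  case (Suc n)
  then obtain P where P: "P holomorphic_on ball 0 r"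
    "\<And>z. rad < norm z \<Longrightarrow> norm z < r \<Longrightarrow> dual z ((blinfun_apply T ^^ n) x) = g z ^ n * dual z x - z * P z" by blast
  obtain P' where P': "P' holomorphic_on ball 0 r"
    "\<And>z. rad < norm z \<Longrightarrow> norm z < r \<Longrightarrow> dual z (blinfun_apply T ((blinfun_apply T ^^ n) x))
       = g z * dual z ((blinfun_apply T ^^ n) x) - z * P' z"
    using dual_T[OF r] by blast
  have "g holomorphic_on ball 0 r" using r by (intro holomorphic_on_subset[OF g_holomorphic]) auto
  then have "(\<lambda>z. g z * P z + P' z) holomorphic_on ball 0 r"
    by (intro holomorphic_intros P P')
  moreover have "dual z ((blinfun_apply T ^^ Suc n) x) = g z ^ Suc n * dual z x - z * (g z * P z + P' z)"
    if "rad < norm z" "norm z < r" for z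
    unfolding funpow.simps comp_apply P'(2)[OF that] P(2)[OF that] by (simp add: algebra_simps)
  ultimately show ?case by blast
qed

text \<open>On a circle of radius \<open>s > rad\<close> the series of \<open>dual\<close> converges
  uniformly, so it may be integrated term by term.\<close>

lemma contour_integral_dual_sums:
  assumes s: "rad < s" and F: "continuous_on (sphere 0 s) F"
  shows "(\<lambda>p. of_real (W p) * apply_bcontfun y p * contour_integral (circlepath 0 s) (\<lambda>z. F z / z ^ p))
    sums contour_integral (circlepath 0 s) (\<lambda>z. F z * dual z y)" (is ?sums)
    and "(\<lambda>z. F z * dual z y) contour_integrable_on circlepath 0 s" (is ?int)
proof -
  have s0: "s > 0" using s rad_nonneg by simp
  obtain M q where q: "0 < q" "q < 1" "M \<ge> 0"
    "\<And>(z :: complex) (x :: linf) p. s \<le> norm z \<Longrightarrow> norm (of_real (W p) * apply_bcontfun x p / z ^ p) \<le> M * norm x * q ^ p"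
    using dual_bound[OF s] by blast
  have "compact (F ` sphere 0 s)" using F by (rule compact_continuous_image) auto
  then obtain D where D: "\<And>z. z \<in> sphere 0 s \<Longrightarrow> norm (F z) \<le> D"
    using compact_imp_bounded[of "F ` sphere 0 s"] unfolding bounded_iff by blast
  have "s = norm (of_real s :: complex)" using s0 by simp
  then have D0: "D \<ge> 0" using D[of "of_real s"] order_trans[OF norm_ge_zero] by auto
  define h where "h p z = F z * (of_real (W p) * apply_bcontfun y p / z ^ p)" for p z
  have h: "norm (h p z) \<le> D * (M * norm y * q ^ p)" if "z \<in> sphere 0 s" for p z
    unfolding h_def norm_mult[of "F z"] using that D0 by (intro mult_mono D q(4)) auto
  have "summable (\<lambda>p. D * (M * norm y * q ^ p))"
    using q by (intro summable_mult summable_geometric) auto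
  from Weierstrass_m_test[OF h this]
  have "uniform_limit (sphere 0 s) (\<lambda>n z. \<Sum>p<n. h p z) (\<lambda>z. \<Sum>p. h p z) sequentially" .
  moreover have "(\<Sum>p. h p z) = F z * dual z y" if "z \<in> sphere 0 s" for z
    unfolding h_def using that s by (intro sums_unique[symmetric] sums_mult dual_sums) auto
  ultimately have ul: "uniform_limit (sphere 0 s) (\<lambda>n z. \<Sum>p<n. h p z) (\<lambda>z. F z * dual z y) sequentially"
    by (subst (asm) uniform_limit_cong') auto
  have cont: "continuous_on (sphere 0 s) (\<lambda>z. F z / z ^ p)" for p
    using F s0 by (intro continuous_intros) auto
  have int: "(\<lambda>z. F z / z ^ p) contour_integrable_on circlepath 0 s" for p
    using cont s0 by (intro contour_integrable_continuous_circlepath) simp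
  have h_eq: "h p = (\<lambda>z. (of_real (W p) * apply_bcontfun y p) * (F z / z ^ p))" for p
    by (auto simp: h_def)
  have inth: "h p contour_integrable_on circlepath 0 s" for p
    unfolding h_eq by (intro contour_integrable_lmul int)
  have "(\<lambda>n. contour_integral (circlepath 0 s) (\<lambda>z. \<Sum>p<n. h p z)) \<longlonglongrightarrow> contour_integral (circlepath 0 s) (\<lambda>z. F z * dual z y)"
    by (rule contour_integral_uniform_limit_circlepath(2)[OF _ ul _ s0])
      (auto intro!: always_eventually contour_integrable_sum inth)
  moreover have "contour_integral (circlepath 0 s) (\<lambda>z. \<Sum>p<n. h p z)
      = (\<Sum>p<n. of_real (W p) * apply_bcontfun y p * contour_integral (circlepath 0 s) (\<lambda>z. F z / z ^ p))" for n
  proof -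
    have "contour_integral (circlepath 0 s) (h p)
        = of_real (W p) * apply_bcontfun y p * contour_integral (circlepath 0 s) (\<lambda>z. F z / z ^ p)" for p
      unfolding h_eq by (rule contour_integral_lmul[OF int])
    moreover have "contour_integral (circlepath 0 s) (\<lambda>z. \<Sum>p<n. h p z) = (\<Sum>p<n. contour_integral (circlepath 0 s) (h p))"
      by (rule contour_integral_sum) (auto intro: inth)
    ultimately show ?thesis by simp
  qed
  ultimately show ?sums by (simp add: sums_def)
  show ?int
    by (rule contour_integral_uniform_limit_circlepath(1)[OF _ ul _ s0])
      (auto intro!: always_eventually contour_integrable_sum inth)
qed

text \<open>
  Multiplying \<open>dual z (T\<^sup>n x) = g z\<^sup>n * dual z x - z * P z\<close> by \<open>z\<^sup>j / z / g z\<^sup>n\<close> and integrating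
  over the circle of radius \<open>s\<close> isolates \<open>W\<^sub>j x\<^sub>j\<close>. The coefficients with \<open>k < j\<close> and the term
  with \<open>P\<close> are estimated on the inner circle of radius \<open>i\<close>; the case \<open>i = 0\<close> is meant for integrands
  that are holomorphic in the whole disc.
\<close>

lemma deconvolution:
  assumes s: "rad < s" "s < r" "r < m" and i: "0 \<le> i" "i < r"
    and g1: "\<And>z. norm z = s \<Longrightarrow> 1 \<le> norm (g z)"
    and q: "0 \<le> q" "q < 1" and C: "\<And>k l. i ^ l * W k \<le> C * q ^ l * W (k + l)"
    and inner: "\<And>n F L. F holomorphic_on ball 0 r \<Longrightarrow> (\<And>z. norm z = i \<Longrightarrow> norm (F z) \<le> L) \<Longrightarrow>
      norm (contour_integral (circlepath 0 s) (\<lambda>z. F z / g z ^ n)) \<le> 2 * pi * i * L"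
  shows "\<exists>K\<ge>0. \<forall>n x. \<exists>M. \<forall>j. norm (apply_bcontfun x j) \<le> K * norm ((blinfun_apply T ^^ n) x) + M * i * q ^ j"
proof -
  have s0: "s > 0" using s rad_nonneg by simp
  obtain t where t: "rad < t" "t < s" using dense[OF s(1)] by blast
  obtain D where D: "t > 0" "\<And>n k. W (n + k) \<le> D * t ^ k * W n"
    using upper_growth_of_rad_less[OF t(1)] by (auto simp: upper_growth_def)
  \<comment> \<open>A common ratio for both sides of the kernel: \<open>q\<close> governs the
    indices \<open>k < j\<close>, and \<open>t / s\<close> the indices
    \<open>k \<ge> j\<close>.\<close>
  define \<rho> where "\<rho> = max q (t / s)"
  have \<rho>: "0 \<le> \<rho>" "\<rho> < 1" using q D(1) t by (auto simp: \<rho>_def)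
  have C1: "1 \<le> C" using C[of 0 0] W_0 by simp
  have D1: "1 \<le> D" using D(2)[of 0 0] W_0 by simp
  define E where "E = max C D"
  define K where "K = E * (2 / (1 - \<rho>))"
  have K: "K \<ge> 0" using \<rho> C1 by (auto simp: K_def E_def)
  have main: "\<exists>M. \<forall>j. norm (apply_bcontfun x j) \<le> K * norm ((blinfun_apply T ^^ n) x) + M * i * q ^ j" for n x
  proof -
    define y where "y = (blinfun_apply T ^^ n) x"
    define J where "J F = contour_integral (circlepath 0 s) (\<lambda>z. F z / g z ^ n)" for F
    have rm: "rad < r" using s by simp
    obtain P where P: "P holomorphic_on ball 0 r"
      and dual_y: "\<And>z. rad < norm z \<Longrightarrow> norm z < r \<Longrightarrow> dual z y = g z ^ n * dual z x - z * P z"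
      using dual_T_funpow[OF rm s(3)] unfolding y_def by blast
    have "compact (P ` sphere 0 i)"
      using i by (intro compact_continuous_image continuous_on_subset[OF holomorphic_on_imp_continuous_on[OF P]]) auto
    then obtain M where "\<forall>y\<in>P ` sphere 0 i. norm y \<le> M"
      using compact_imp_bounded[of "P ` sphere 0 i"] unfolding bounded_iff by blast
    then have M: "norm (P z) \<le> M" if "norm z = i" for z using that by simp
    have cont_g: "continuous_on (sphere 0 s) g"
      using s by (intro continuous_on_subset[OF holomorphic_on_imp_continuous_on[OF g_holomorphic]]) auto
    have g_nz: "g z \<noteq> 0" if "norm z = s" for z using g1[OF that] by auto
    have nz: "z \<noteq> 0" if "norm z = s" for z using that s0 by auto
    have bound: "norm (apply_bcontfun x j) \<le> K * norm y + (M * C) * i * q ^ j" for j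
    proof -
      have "continuous_on (sphere 0 s) (\<lambda>z :: complex. z ^ j / z)" using s0 by (intro continuous_intros) auto
      from contour_integral_dual_sums(1)[OF s(1) this, of x]
      have "(\<lambda>k. if k = j then of_real (W j) * apply_bcontfun x j * (2 * of_real pi * \<i>) else 0)
          sums contour_integral (circlepath 0 s) (\<lambda>z. z ^ j / z * dual z x)"
        unfolding contour_integral_circlepath_monomial[OF s0] by (simp add: if_distrib cong: if_cong)
      then have xj: "contour_integral (circlepath 0 s) (\<lambda>z. z ^ j / z * dual z x)
          = of_real (W j) * apply_bcontfun x j * (2 * of_real pi * \<i>)"
        using sums_single[of j "\<lambda>_. of_real (W j) * apply_bcontfun x j * (2 * of_real pi * \<i>)"] sums_unique2 by blast
      have cont1: "continuous_on (sphere 0 s) (\<lambda>z. z ^ j / z / g z ^ n)"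
        using s0 g_nz by (intro continuous_intros cont_g) auto
      \<comment> \<open>Up to the factor \<open>2 * pi * \<i>\<close> these are the Laurent
        coefficients of \<open>1 / g ^ n\<close>; they form the kernel that recovers coordinate
        \<open>j\<close> of \<open>x\<close> from \<open>y\<close>.\<close>
      define I where "I k = contour_integral (circlepath 0 s) (\<lambda>z. z ^ j / z / g z ^ n / z ^ k)" for k
      have y_sums: "(\<lambda>k. of_real (W k) * apply_bcontfun y k * I k) sums
          contour_integral (circlepath 0 s) (\<lambda>z. z ^ j / z / g z ^ n * dual z y)"
        unfolding I_def by (rule contour_integral_dual_sums(1)[OF s(1) cont1])
      have split: "contour_integral (circlepath 0 s) (\<lambda>z. z ^ j / z * dual z x)
          = contour_integral (circlepath 0 s) (\<lambda>z. z ^ j / z / g z ^ n * dual z y) + J (\<lambda>z. z ^ j * P z)"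
      proof -
        have "contour_integral (circlepath 0 s) (\<lambda>z. z ^ j / z * dual z x)
            = contour_integral (circlepath 0 s) (\<lambda>z. z ^ j / z / g z ^ n * dual z y + z ^ j * P z / g z ^ n)"
        proof (rule contour_integral_eq)
          fix z assume "z \<in> path_image (circlepath 0 s)"
          then have z: "norm z = s" using s0 by simp
          have "dual z y = g z ^ n * dual z x - z * P z" using z s by (intro dual_y) auto
          then have "dual z x = (dual z y + z * P z) / g z ^ n" using g_nz[OF z] by simp
          then show "z ^ j / z * dual z x = z ^ j / z / g z ^ n * dual z y + z ^ j * P z / g z ^ n"
            using nz[OF z] g_nz[OF z] by (simp add: field_simps)
        qed
        also have "\<dots> = contour_integral (circlepath 0 s) (\<lambda>z. z ^ j / z / g z ^ n * dual z y)
            + contour_integral (circlepath 0 s) (\<lambda>z. z ^ j * P z / g z ^ n)"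
        proof (rule contour_integral_add)
          have cP: "continuous_on (sphere 0 s) P"
            using s s0 by (intro continuous_on_subset[OF holomorphic_on_imp_continuous_on[OF P]]) auto
          then have c: "continuous_on (sphere 0 s) (\<lambda>z. z ^ j * P z / g z ^ n)"
            using g_nz by (intro continuous_intros cont_g) auto
          then show "(\<lambda>z. z ^ j * P z / g z ^ n) contour_integrable_on circlepath 0 s"
            using s0 by (intro contour_integrable_continuous_circlepath) simp
          show "(\<lambda>z. z ^ j / z / g z ^ n * dual z y) contour_integrable_on circlepath 0 s"
            by (rule contour_integral_dual_sums(2)[OF s(1) cont1])
        qed
        finally show ?thesis by (simp add: J_def)
      qed
      have I_le: "norm (of_real (W k) * apply_bcontfun y k * I k)
          \<le> (2 * pi * norm y * W j * E) * (if k < j then \<rho> ^ (j - k) else \<rho> ^ (k - j))" for k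
      proof (cases "k < j")
        case True
        \<comment> \<open>For \<open>k < j\<close> the integrand is \<open>z ^ l / g z ^ n\<close>
          with a polynomial numerator, so \<open>inner\<close> applies. The length of the inner
          circle supplies one more factor \<open>i\<close>, which gives the exponent
          \<open>Suc l = j - k\<close>.\<close>
        define l where "l = j - Suc k"
        have l: "j = k + Suc l" using True by (simp add: l_def)
        have "I k = J (\<lambda>z. z ^ l)"
          unfolding I_def J_def
          by (rule contour_integral_eq) (use nz s0 in \<open>auto simp: l power_add field_simps\<close>)
        moreover have "norm (J (\<lambda>z. z ^ l)) \<le> 2 * pi * i * i ^ l"
          unfolding J_def by (rule inner) (auto intro!: holomorphic_intros simp: norm_power)
        ultimately have "norm (I k) \<le> 2 * pi * i ^ Suc l" by simp
        then have "W k * norm (apply_bcontfun y k) * norm (I k) \<le> W k * norm y * (2 * pi * i ^ Suc l)"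
          using W_pos[of k] by (intro mult_mono norm_bounded) auto
        also have "\<dots> = (2 * pi * norm y) * (i ^ Suc l * W k)" by simp
        also have "\<dots> \<le> (2 * pi * norm y) * (E * \<rho> ^ Suc l * W j)"
        proof (rule mult_left_mono)
          have "C * q ^ Suc l * W (k + Suc l) \<le> E * \<rho> ^ Suc l * W (k + Suc l)"
            using C1 q W_pos[of "k + Suc l"]
            by (intro mult_right_mono mult_mono power_mono) (auto simp: E_def \<rho>_def)
          then show "i ^ Suc l * W k \<le> E * \<rho> ^ Suc l * W j" using C[of "Suc l" k] l by simp
        qed simp
        finally show ?thesis using True W_pos[of k] l by (simp add: norm_mult mult_ac)
      next
        case False
        \<comment> \<open>For \<open>k \<ge> j\<close> the numerator has a pole, so the estimate
          stays on the outer circle, where \<open>norm (g z) \<ge> 1\<close> removes the dependence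
          on \<open>n\<close>.\<close>
        define l where "l = k - j"
        have l: "k = j + l" using False by (simp add: l_def)
        have "norm (I k) \<le> 1 / s ^ Suc l * (2 * pi * s)"
        proof (rule has_contour_integral_bound_circlepath[OF _ _ s0])
          have "continuous_on (sphere 0 s) (\<lambda>z. z ^ j / z / g z ^ n / z ^ k)"
            using s0 by (intro continuous_on_divide[OF cont1] continuous_intros) auto
          then show "((\<lambda>z. z ^ j / z / g z ^ n / z ^ k) has_contour_integral I k) (circlepath 0 s)"
            unfolding I_def using s0
            by (intro has_contour_integral_integral contour_integrable_continuous_circlepath) simp
          fix z :: complex assume "norm (z - 0) = s"
          then have z: "norm z = s" by simp
          have "norm (z ^ j / z / g z ^ n / z ^ k) = (1 / s ^ Suc l) / norm (g z) ^ n"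
            using s0 z nz[OF z] by (simp add: l norm_mult norm_divide norm_power power_add)
          also have "\<dots> \<le> (1 / s ^ Suc l) / 1"
            using s0 g1[OF z] g_nz[OF z] by (intro divide_left_mono one_le_power) (auto intro: zero_less_power)
          finally show "norm (z ^ j / z / g z ^ n / z ^ k) \<le> 1 / s ^ Suc l" by simp
        qed (use s0 in auto)
        then have "norm (I k) \<le> 2 * pi / s ^ l" using s0 by simp
        then have "W k * norm (apply_bcontfun y k) * norm (I k) \<le> W k * norm y * (2 * pi / s ^ l)"
          using W_pos[of k] by (intro mult_mono norm_bounded) auto
        also have "\<dots> = (2 * pi * norm y) * (W k / s ^ l)" by simp
        also have "\<dots> \<le> (2 * pi * norm y) * (E * \<rho> ^ l * W j)"
        proof (rule mult_left_mono)
          have "W k / s ^ l \<le> D * (t / s) ^ l * W j"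
            using D(2)[of j l] s0 by (simp add: l power_divide field_simps)
          also have "\<dots> \<le> E * \<rho> ^ l * W j"
            using D1 D(1) s0 W_pos[of j] C1
            by (intro mult_right_mono mult_mono power_mono) (auto simp: E_def \<rho>_def)
          finally show "W k / s ^ l \<le> E * \<rho> ^ l * W j" .
        qed simp
        finally show ?thesis using False W_pos[of k] l by (simp add: norm_mult mult_ac)
      qed
      have J_le: "norm (J (\<lambda>z. z ^ j * P z)) \<le> 2 * pi * i * (i ^ j * M)"
        unfolding J_def
        by (rule inner) (use i M in \<open>auto intro!: holomorphic_intros P mult_left_mono simp: norm_mult norm_power\<close>)
      have "norm (contour_integral (circlepath 0 s) (\<lambda>z. z ^ j / z / g z ^ n * dual z y))
          \<le> (2 * pi * norm y * W j * E) * (2 / (1 - \<rho>))"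
      proof (rule LIMSEQ_le_const2[OF tendsto_norm[OF y_sums[unfolded sums_def]]])
        have "norm (\<Sum>k<N. of_real (W k) * apply_bcontfun y k * I k) \<le> (2 * pi * norm y * W j * E) * (2 / (1 - \<rho>))" for N
        proof -
          have "norm (\<Sum>k<N. of_real (W k) * apply_bcontfun y k * I k)
              \<le> (\<Sum>k<N. (2 * pi * norm y * W j * E) * (if k < j then \<rho> ^ (j - k) else \<rho> ^ (k - j)))"
            by (intro sum_norm_le I_le)
          also have "\<dots> = (2 * pi * norm y * W j * E) * (\<Sum>k<N. if k < j then \<rho> ^ (j - k) else \<rho> ^ (k - j))"
            by (rule sum_distrib_left[symmetric])
          also have "\<dots> \<le> (2 * pi * norm y * W j * E) * (2 / (1 - \<rho>))"
            using W_pos[of j] C1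
            by (intro mult_left_mono two_sided_geometric_le \<rho> mult_nonneg_nonneg) (auto simp: E_def)
          finally show ?thesis .
        qed
        then show "\<exists>N. \<forall>n\<ge>N. norm (\<Sum>k<n. of_real (W k) * apply_bcontfun y k * I k) \<le> (2 * pi * norm y * W j * E) * (2 / (1 - \<rho>))"
          by blast
      qed
      then have "norm (of_real (W j) * apply_bcontfun x j * (2 * of_real pi * \<i>))
          \<le> (2 * pi * norm y * W j * E) * (2 / (1 - \<rho>)) + 2 * pi * i * (i ^ j * M)"
        unfolding xj[symmetric] split by (intro order_trans[OF norm_triangle_ineq] add_mono J_le)
      then have "2 * pi * (W j * norm (apply_bcontfun x j)) \<le> 2 * pi * (norm y * W j * K + i * (i ^ j * M))"
        using W_pos[of j] by (simp add: norm_mult K_def algebra_simps)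
      then have "W j * norm (apply_bcontfun x j) \<le> norm y * W j * K + i * (i ^ j * M)"
        by (rule mult_left_le_imp_le) simp
      \<comment> \<open>Growth from index 0 converts \<open>i ^ j\<close> into a multiple of
        \<open>q ^ j * W j\<close>. The bound \<open>M\<close> for \<open>P\<close> depends on
        \<open>n\<close> and \<open>x\<close> but not on \<open>j\<close>; it is nonnegative because
        the sphere of radius \<open>i\<close> has a point.\<close>
      also have "i * (i ^ j * M) \<le> i * ((C * q ^ j * W j) * M)"
      proof -
        have "0 \<le> M" if "i = norm z" for z :: complex using M[of z] that order_trans[OF norm_ge_zero] by auto
        then have "0 \<le> M" using i by (metis abs_of_nonneg norm_of_real)
        then show ?thesis using C[of j 0] W_0 i by (intro mult_left_mono mult_right_mono) auto
      qed
      finally have "W j * norm (apply_bcontfun x j) \<le> W j * (K * norm y + (M * C) * i * q ^ j)"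
        by (simp add: algebra_simps)
      then show ?thesis using W_pos[of j] by (rule mult_left_le_imp_le)
    qed
    then show ?thesis unfolding y_def by blast
  qed
  with K show ?thesis by blast
qed

end


section \<open>The spectral dichotomy for J-class operators\<close>

context shift_series
begin

text \<open>The moduli of points with \<open>norm (g z) \<le> 1\<close> in a slightly larger closed
  disc form a compact set disjoint from the interval from \<open>a\<close> to \<open>rad\<close>,
  hence at positive distance from it.\<close>

lemma norm_g_gt_1_neighbourhood:
  assumes a: "a \<le> rad" and g1: "\<And>z. a \<le> norm z \<Longrightarrow> norm z \<le> rad \<Longrightarrow> 1 < norm (g z)"
  obtains d where "d > 0" "rad + d < m" "\<And>z. a - d \<le> norm z \<Longrightarrow> norm z \<le> rad + d \<Longrightarrow> 1 < norm (g z)"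
proof -
  obtain m1 where m1: "rad < m1" "m1 < m" using dense[OF rad_less] by blast
  define S where "S = cball 0 m1 \<inter> g -` cball 0 1"
  have cont: "continuous_on (cball 0 m1) g"
    using m1 by (intro continuous_on_subset[OF holomorphic_on_imp_continuous_on[OF g_holomorphic]]) auto
  have "closed S" unfolding S_def by (rule continuous_closed_preimage[OF cont]) auto
  then have "compact S" using compact_Int_closed[OF compact_cball, of S 0 m1] by (simp add: S_def Int_absorb1 Int_assoc[symmetric])
  then have "compact (norm ` S)" by (intro compact_continuous_image continuous_on_norm_id)
  moreover have "norm ` S \<inter> {a..rad} = {}" using g1 by (force simp: S_def)
  ultimately obtain \<delta> where \<delta>: "\<delta> > 0" "\<And>x y. x \<in> norm ` S \<Longrightarrow> y \<in> {a..rad} \<Longrightarrow> \<delta> \<le> dist x y"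
    using separate_compact_closed[of "norm ` S" "{a..rad}"] closed_atLeastAtMost by meson
  define d where "d = min (\<delta> / 2) (m1 - rad)"
  have d: "d > 0" "d < \<delta>" "rad + d \<le> m1" using \<delta> m1 by (auto simp: d_def)
  moreover have "1 < norm (g z)" if z: "a - d \<le> norm z" "norm z \<le> rad + d" for z
  proof (rule ccontr)
    assume "\<not> 1 < norm (g z)"
    then have "norm z \<in> norm ` S" using z d by (auto simp: S_def)
    \<comment> \<open>The point of the interval nearest to \<open>norm z\<close>.\<close>
    moreover have "max a (min rad (norm z)) \<in> {a..rad}" using a by auto
    ultimately have "\<delta> \<le> dist (norm z) (max a (min rad (norm z)))" by (rule \<delta>(2))
    then show False using z d a by (auto simp: dist_real_def max_def min_def split: if_splits)
  qed
  ultimately show ?thesis using that[of d] m1 by auto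
qed

text \<open>Since \<open>K\<close> does not depend on the iterate, the estimate for a point
  \<open>x'\<close> near \<open>x\<close> with small image survives the passage to \<open>x\<close>.
  The constant \<open>M\<close> depends on \<open>e\<close>, which is harmless as
  \<open>q ^ j\<close> tends to 0.\<close>

lemma norm_coordinate_le_of_zero_mem_J_set:
  assumes K: "K \<ge> 0" "\<forall>n x. \<exists>M. \<forall>j. norm (apply_bcontfun x j) \<le> K * norm ((blinfun_apply T ^^ n) x) + M * i * q ^ j"
    and "x \<in> A_set T" "e > 0"
  shows "\<exists>M. \<forall>j. norm (apply_bcontfun x j) \<le> e + M * i * q ^ j"
proof -
  \<comment> \<open>One share for the distance from \<open>x'\<close> to \<open>x\<close> and
    \<open>K\<close> shares for the size of the image add up to \<open>e\<close>.\<close>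
  define \<epsilon> where "\<epsilon> = e / (K + 1)"
  have "\<epsilon> * (K + 1) = e" using K(1) by (simp add: \<epsilon>_def)
  then have \<epsilon>: "\<epsilon> + K * \<epsilon> = e" by (simp only: distrib_left mult.commute mult_1 add.commute)
  have \<epsilon>_pos: "\<epsilon> > 0" using K(1) assms(4) by (simp add: \<epsilon>_def)
  obtain k x' where x': "dist x' x < \<epsilon>" "dist ((blinfun_apply T ^^ k) x') 0 < \<epsilon>"
    using assms(3) \<epsilon>_pos unfolding A_set_iff by blast
  obtain M where M: "\<And>j. norm (apply_bcontfun x' j) \<le> K * norm ((blinfun_apply T ^^ k) x') + M * i * q ^ j"
    using K(2) by blast
  have "norm (apply_bcontfun x j) \<le> e + M * i * q ^ j" for j
  proof -
    have "norm (apply_bcontfun x j) \<le> norm (apply_bcontfun (x - x') j) + norm (apply_bcontfun x' j)"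
      using norm_triangle_ineq[of "apply_bcontfun (x - x') j" "apply_bcontfun x' j"] by simp
    also have "\<dots> \<le> \<epsilon> + (K * \<epsilon> + M * i * q ^ j)"
    proof (intro add_mono order_trans[OF M[of j]])
      show "norm (apply_bcontfun (x - x') j) \<le> \<epsilon>"
        using norm_bounded[of "x - x'" j] x'(1) by (simp add: dist_norm norm_minus_commute)
      show "K * norm ((blinfun_apply T ^^ k) x') \<le> K * \<epsilon>"
        using x'(2) K(1) by (intro mult_left_mono) auto
    qed simp
    finally show ?thesis using \<epsilon> by simp
  qed
  then show ?thesis by blast
qed

lemma ex_norm_g_le_1:
  assumes "J_class T"
  shows "\<exists>z. norm z \<le> rad \<and> norm (g z) \<le> 1"
proof (rule ccontr)
  assume "\<not> ?thesis"
  then have g1: "1 < norm (g z)" if "norm z \<le> rad" for z using that by (meson not_le)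
  obtain d where d: "d > 0" "rad + d < m" "\<And>z. 0 - d \<le> norm z \<Longrightarrow> norm z \<le> rad + d \<Longrightarrow> 1 < norm (g z)"
    using norm_g_gt_1_neighbourhood[of 0] rad_nonneg g1 by blast
  have g1: "1 < norm (g z)" if "norm z \<le> rad + d" for z
    using d that order_trans[of "0 - d" 0 "norm z"] by auto
  have hg: "g holomorphic_on ball 0 (rad + d)"
    using d by (intro holomorphic_on_subset[OF g_holomorphic]) auto
  \<comment> \<open>Deconvolution with inner radius 0 and ratio 0. The growth condition is trivial,
    with equality for \<open>l = 0\<close> since \<open>0 ^ 0 = 1\<close>, and the inner estimate is
    Cauchy's theorem for an integrand holomorphic on the whole disc.\<close>
  have "\<exists>K\<ge>0. \<forall>n x. \<exists>M. \<forall>j. norm (apply_bcontfun x j) \<le> K * norm ((blinfun_apply T ^^ n) x) + M * 0 * 0 ^ j"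
  proof (rule deconvolution[where s = "rad + d / 2" and r = "rad + d" and C = 1])
    show "0 ^ l * W k \<le> 1 * 0 ^ l * W (k + l)" for k l by (cases l) auto
    fix n F L assume F: "F holomorphic_on ball 0 (rad + d)"
    have "(\<lambda>z. F z / g z ^ n) holomorphic_on ball 0 (rad + d)"
      using g1 by (intro holomorphic_intros F hg) (force simp: dest: less_imp_le)
    then have "((\<lambda>z. F z / g z ^ n) has_contour_integral 0) (circlepath 0 (rad + d / 2))"
      using d(1) rad_nonneg by (intro Cauchy_theorem_disc_simple[of _ 0 "rad + d"]) auto
    then show "norm (contour_integral (circlepath 0 (rad + d / 2)) (\<lambda>z. F z / g z ^ n)) \<le> 2 * pi * 0 * L"
      by (simp add: contour_integral_unique)
  qed (use d rad_nonneg g1 in \<open>auto intro: less_imp_le\<close>)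
  then obtain K where K: "K \<ge> 0"
    "\<forall>n x. \<exists>M. \<forall>j. norm (apply_bcontfun x j) \<le> K * norm ((blinfun_apply T ^^ n) x) + M * 0 * 0 ^ j" by blast
  have "x = 0" if x: "x \<in> A_set T" for x
  proof (rule linf_eqI)
    fix j
    have "norm (apply_bcontfun x j) \<le> 0 + e" if "e > 0" for e
      using norm_coordinate_le_of_zero_mem_J_set[OF K x that] by auto
    then have "norm (apply_bcontfun x j) \<le> 0" by (rule field_le_epsilon)
    then show "apply_bcontfun x j = apply_bcontfun 0 j" by simp
  qed
  then show False using assms by (auto simp: J_class_def A_set_def)
qed

lemma A_set_subset_c0:
  assumes "J_class T"
  shows "A_set T \<subseteq> c0"
proof -
  have zero: "0 \<in> A_set T" by (rule zero_mem_A_set_of_J_class[OF assms])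
  define a where "a = Sup {t. lower_growth W t}"
  have bdd: "bdd_above {t. lower_growth W t}"
    using lower_growth_le_rad by (auto intro!: bdd_aboveI[of _ rad])
  have le_a: "t \<le> a" if "lower_growth W t" for t
    unfolding a_def using that by (intro cSup_upper bdd) auto
  \<comment> \<open>This point ensures that some lower rate exists, so that the supremum
    \<open>a\<close> is meaningful and positive.\<close>
  obtain z0 where "norm z0 \<le> rad" "norm (g z0) \<le> 1" using ex_norm_g_le_1[OF assms] by blast
  then obtain t0 where t0: "lower_growth W t0"
    using lower_growth_of_norm_g_le_1[OF zero] by blast
  then have a: "0 < a" using le_a by (force simp: lower_growth_def)
  have "a \<le> rad" unfolding a_def using t0 lower_growth_le_rad by (intro cSup_least) auto
  moreover have "1 < norm (g z)" if "a \<le> norm z" "norm z \<le> rad" for z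
    using lower_growth_of_norm_g_le_1[OF zero that(2)] le_a that(1) by force
  ultimately obtain d where d: "d > 0" "rad + d < m"
    "\<And>z. a - d \<le> norm z \<Longrightarrow> norm z \<le> rad + d \<Longrightarrow> 1 < norm (g z)"
    using norm_g_gt_1_neighbourhood by blast
  \<comment> \<open>Below \<open>a\<close>, so that some lower rate \<open>t\<close> exceeds
    \<open>i\<close>; above \<open>a - d\<close>, so that the circle lies where
    \<open>norm (g z) > 1\<close>; positive, so that it is a genuine circle.\<close>
  obtain i where i: "max (a - d) 0 < i" "i < a" using dense[of "max (a - d) 0" a] d(1) a by auto
  have i_pos: "0 < i" using i by simp
  obtain t where t: "i < t" "lower_growth W t"
    using less_cSupD[of "{t. lower_growth W t}" i] t0 i unfolding a_def by auto
  obtain C where C: "\<And>n k. t ^ k * W n \<le> C * W (n + k)" using t by (auto simp: lower_growth_def)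
  define q where "q = i / t"
  have q: "0 \<le> q" "q < 1" using t i_pos by (auto simp: q_def)
  define S :: "complex set" where "S = ball 0 (rad + d) - cball 0 (max (a - d) 0)"
  have S: "open S" unfolding S_def by (intro open_Diff) auto
  have g_S: "1 < norm (g z)" if "z \<in> S" for z using that by (intro d(3)) (auto simp: S_def)
  have hg: "g holomorphic_on S"
    using d by (intro holomorphic_on_subset[OF g_holomorphic]) (auto simp: S_def)
  have a_le: "a \<le> rad" by fact
  have "\<exists>K\<ge>0. \<forall>n x. \<exists>M. \<forall>j. norm (apply_bcontfun x j) \<le> K * norm ((blinfun_apply T ^^ n) x) + M * i * q ^ j"
  proof (rule deconvolution[where s = "rad + d / 2" and r = "rad + d" and C = C])
    show "i ^ l * W k \<le> C * q ^ l * W (k + l)" for k l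
    proof -
      have "i ^ l * W k = q ^ l * (t ^ l * W k)" using t i_pos by (simp add: q_def power_divide)
      also have "\<dots> \<le> q ^ l * (C * W (k + l))" using q C by (intro mult_left_mono) auto
      finally show ?thesis by (simp add: mult_ac)
    qed
    fix n F L assume F: "F holomorphic_on ball 0 (rad + d)" and L: "\<And>z. norm z = i \<Longrightarrow> norm (F z) \<le> L"
    have hF: "(\<lambda>z. F z / g z ^ n) holomorphic_on S"
    proof (intro holomorphic_intros hg)
      show "F holomorphic_on S" using F by (rule holomorphic_on_subset) (auto simp: S_def)
      show "g z ^ n \<noteq> 0" if "z \<in> S" for z using g_S[OF that] by auto
    qed
    \<comment> \<open>Points of the two circles with the same parameter have the same argument, so
      the segment between them is radial and stays in the annulus. The linear homotopy therefore
      moves the contour inwards.\<close>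
    have seg: "closed_segment (circlepath 0 (rad + d / 2) u) (circlepath 0 i u) \<subseteq> S" for u
    proof
      fix z assume "z \<in> closed_segment (circlepath 0 (rad + d / 2) u) (circlepath 0 i u)"
      then obtain v where v: "0 \<le> v" "v \<le> 1"
        and z: "z = (1 - v) *\<^sub>R circlepath 0 (rad + d / 2) u + v *\<^sub>R circlepath 0 i u"
        by (auto simp: closed_segment_def)
      have "z = of_real ((1 - v) * (rad + d / 2) + v * i) * exp (2 * of_real pi * \<i> * of_real u)"
        unfolding z circlepath by (simp add: scaleR_conv_of_real algebra_simps)
      then have "norm z = \<bar>(1 - v) * (rad + d / 2) + v * i\<bar>"
        by (simp add: norm_mult del: of_real_add of_real_mult of_real_diff)
      moreover have le: "i \<le> (1 - v) * (rad + d / 2) + v * i"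
        using mult_left_mono[of i "rad + d / 2" "1 - v"] v i a_le d(1) by (simp add: algebra_simps)
      moreover have "(1 - v) * (rad + d / 2) + v * i \<le> (1 - v) * (rad + d / 2) + v * (rad + d / 2)"
        using v i a_le d(1) by (intro add_left_mono mult_left_mono) auto
      then have "(1 - v) * (rad + d / 2) + v * i \<le> rad + d / 2"
        by (simp add: left_diff_distrib)
      ultimately have "i \<le> norm z" "norm z \<le> rad + d / 2" using i_pos by auto
      then show "z \<in> S" using i d(1) by (auto simp: S_def)
    qed
    have "homotopic_loops S (circlepath 0 (rad + d / 2)) (circlepath 0 i)"
      by (rule homotopic_loops_linear) (use seg in auto)
    then have "contour_integral (circlepath 0 (rad + d / 2)) (\<lambda>z. F z / g z ^ n)
        = contour_integral (circlepath 0 i) (\<lambda>z. F z / g z ^ n)"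
      by (intro Cauchy_theorem_homotopic_loops[OF _ S hF]) auto
    also have "norm \<dots> \<le> L * (2 * pi * i)"
    proof (rule has_contour_integral_bound_circlepath[OF _ _ i_pos])
      have sub: "path_image (circlepath 0 i) \<subseteq> S"
        using i i_pos a_le d(1) by (auto simp: S_def)
      show "((\<lambda>z. F z / g z ^ n) has_contour_integral contour_integral (circlepath 0 i) (\<lambda>z. F z / g z ^ n)) (circlepath 0 i)"
        by (intro has_contour_integral_integral contour_integrable_holomorphic_simple[OF hF S _ sub]) auto
      show L0: "0 \<le> L" using L[of "of_real i"] i_pos order_trans[OF norm_ge_zero] by auto
      fix z :: complex assume "norm (z - 0) = i"
      then have z: "norm z = i" by simp
      then have "z \<in> S" using i i_pos a_le d(1) by (auto simp: S_def)
      then have "1 \<le> norm (g z) ^ n" using g_S by (intro one_le_power) (auto intro: less_imp_le)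
      then have "norm (F z) / norm (g z) ^ n \<le> L / 1" using L[OF z] L0 by (intro frac_le) auto
      then show "norm (F z / g z ^ n) \<le> L" by (simp add: norm_divide norm_power)
    qed
    finally show "norm (contour_integral (circlepath 0 (rad + d / 2)) (\<lambda>z. F z / g z ^ n)) \<le> 2 * pi * i * L"
      by (simp add: mult_ac)
  next
    fix z :: complex assume "norm z = rad + d / 2"
    then show "1 \<le> norm (g z)" using d(1) a_le by (intro less_imp_le d(3)) auto
  qed (use d i i_pos a_le q in auto)
  then obtain K where K: "K \<ge> 0"
    "\<forall>n x. \<exists>M. \<forall>j. norm (apply_bcontfun x j) \<le> K * norm ((blinfun_apply T ^^ n) x) + M * i * q ^ j" by blast
  show ?thesis
  proof
    fix x assume x: "x \<in> A_set T"
    have "\<exists>N. \<forall>j\<ge>N. norm (apply_bcontfun x j - 0) < e" if e: "e > 0" for e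
    proof -
      obtain M where M: "\<And>j. norm (apply_bcontfun x j) \<le> e / 2 + M * i * q ^ j"
        using norm_coordinate_le_of_zero_mem_J_set[OF K x, of "e / 2"] e by auto
      have "(\<lambda>j. M * i * q ^ j) \<longlonglongrightarrow> M * i * 0"
        using q by (intro tendsto_intros LIMSEQ_power_zero) auto
      from LIMSEQ_D[OF this, of "e / 2"] e obtain N where N: "\<And>j. j \<ge> N \<Longrightarrow> \<bar>M * i * q ^ j\<bar> < e / 2" by auto
      have "norm (apply_bcontfun x j) < e" if "j \<ge> N" for j
        using M[of j] N[OF that] by linarith
      then show ?thesis by auto
    qed
    then show "x \<in> c0" unfolding c0_def mem_Collect_eq by (rule LIMSEQ_I)
  qed
qed

text \<open>Otherwise \<open>norm (g z) \<ge> 1\<close> on the closed disc, since points with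
  smaller modulus of \<open>g\<close> would have a lower rate beyond \<open>norm z\<close>. By
  \<open>ex_norm_g_le_1\<close> the value 1 is attained, so \<open>1 / g\<close> has an interior
  maximum on a slightly larger disc and is constant. But \<open>norm (g z) > 1\<close> on the circle
  of radius \<open>rad\<close>, because no lower rate exceeds \<open>rad\<close>.\<close>

lemma ex_norm_g_less_1:
  assumes "J_class T"
  shows "\<exists>z t. norm z < t \<and> lower_growth W t \<and> norm (g z) < 1"
proof (rule ccontr)
  assume none: "\<not> ?thesis"
  have zero: "0 \<in> A_set T" by (rule zero_mem_A_set_of_J_class[OF assms])
  have ge: "1 \<le> norm (g z)" if "norm z \<le> rad" for z
    using none lower_growth_of_norm_g_le_1[OF zero that] by (meson not_le less_imp_le)
  have gt: "1 < norm (g z)" if "norm z = rad" for z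
    using lower_growth_of_norm_g_le_1[OF zero, of z] lower_growth_le_rad that by force
  obtain d where d: "d > 0" "rad + d < m" "\<And>z. rad - d \<le> norm z \<Longrightarrow> norm z \<le> rad + d \<Longrightarrow> 1 < norm (g z)"
    using norm_g_gt_1_neighbourhood[of rad] gt by (metis order_antisym order_refl)
  have ge': "1 \<le> norm (g z)" if "z \<in> ball 0 (rad + d)" for z
    using ge[of z] d(3)[of z] d(1) that by (cases "norm z \<le> rad") auto
  obtain z1 where z1: "norm z1 \<le> rad" "norm (g z1) \<le> 1" using ex_norm_g_le_1[OF assms] by blast
  have "(\<lambda>z. 1 / g z) constant_on ball 0 (rad + d)"
  proof (rule maximum_modulus_principle[where U = "ball 0 (rad + d)" and \<xi> = z1])
    have "g holomorphic_on ball 0 (rad + d)"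
      using d by (intro holomorphic_on_subset[OF g_holomorphic]) auto
    then show "(\<lambda>z. 1 / g z) holomorphic_on ball 0 (rad + d)"
      using ge' by (intro holomorphic_intros) force+
    show "norm (1 / g z) \<le> norm (1 / g z1)" if "z \<in> ball 0 (rad + d)" for z
    proof -
      have "norm (g z1) = 1" using z1 ge[of z1] by simp
      then show ?thesis using ge'[OF that] by (simp add: norm_divide divide_le_eq)
    qed
  qed (use z1 d in auto)
  then obtain b where b: "\<And>z. z \<in> ball 0 (rad + d) \<Longrightarrow> 1 / g z = b" by (auto simp: constant_on_def)
  have "1 / g z1 = 1 / g (of_real rad)" using b[of z1] b[of "of_real rad"] z1 d(1) rad_nonneg by auto
  then have "g z1 = g (of_real rad)" by (metis div_by_1 divide_divide_eq_right mult_1)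
  then show False using gt[of "of_real rad"] z1 rad_nonneg by simp
qed

end


section \<open>Density of eigenvectors\<close>

text \<open>
  The coefficient \<open>X\<^sub>l\<close> is the limit of \<open>(F \<zeta> - \<Sum>\<^sub>j\<^sub><\<^sub>l \<zeta>\<^sup>j X\<^sub>j) / \<zeta>\<^sup>l\<close> as \<open>\<zeta> \<rightarrow> 0\<close>, so it lies in
  the subspace by induction on \<open>l\<close>.
\<close>

lemma taylor_coefficient_mem_closed_subspace:
  fixes V :: "linf set" and X :: "nat \<Rightarrow> linf"
  assumes V: "closed V" "0 \<in> V" "\<And>x y. x \<in> V \<Longrightarrow> y \<in> V \<Longrightarrow> x + y \<in> V"
      "\<And>a x. x \<in> V \<Longrightarrow> blinfun_apply (cscale a) x \<in> V"
    and \<rho>: "\<rho> > 0" and X: "\<And>l. norm (X l) \<le> C / \<rho> ^ l"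
    and r: "r > 0" and F: "\<And>\<zeta>. norm \<zeta> < r \<Longrightarrow> (\<Sum>l. blinfun_apply (cscale (\<zeta> ^ l)) (X l)) \<in> V"
  shows "X l \<in> V"
proof (induction l rule: less_induct)
  case (less l)
  have C: "C \<ge> 0" using X[of 0] order_trans[OF norm_ge_zero] by fastforce
  have sumV: "(\<Sum>j\<in>I. f j) \<in> V" if "\<And>j. j \<in> I \<Longrightarrow> f j \<in> V" for I :: "nat set" and f
    using that by (induction I rule: infinite_finite_induct) (auto intro: V)
  have approx: "\<exists>y\<in>V. dist y (X l) < e" if e: "e > 0" for e
  proof -
    \<comment> \<open>Positive even when \<open>C = 0\<close>, so that \<open>e'\<close> is defined.
      The size of \<open>e'\<close> is dictated by the final error
      \<open>2 * C * \<delta> / \<rho> ^ Suc l\<close>, which is to be at most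
      \<open>e / 2\<close>.\<close>
    define D where "D = 2 * C + 1"
    have D: "D > 0" "2 * C \<le> D" using C by (auto simp: D_def)
    define e' where "e' = e * \<rho> ^ Suc l / D / 2"
    have e': "e' > 0" using e \<rho> D by (simp add: e'_def)
    \<comment> \<open>Evaluation takes place at the real point \<delta>: below \<open>r\<close> to
      stay where \<open>F\<close> applies, and at most \<open>\<rho> / 2\<close> so that the
      geometric tail is at most doubled.\<close>
    define \<delta> where "\<delta> = min (r / 2) (min (\<rho> / 2) e')"
    have "\<delta> \<le> r / 2" by (simp add: \<delta>_def)
    then have \<delta>: "\<delta> > 0" "\<delta> < r" "\<delta> \<le> \<rho> / 2" "\<delta> \<le> e'"
      using r \<rho> e' by (simp_all add: \<delta>_def)
    define q where "q = \<delta> / \<rho>"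
    define u where "u k = blinfun_apply (cscale (of_real \<delta> ^ k)) (X k)" for k
    have u: "norm (u k) \<le> C * q ^ k" for k
      using mult_left_mono[OF X[of k], of "\<delta> ^ k"] \<delta>(1)
      by (simp add: u_def norm_cscale_apply norm_power q_def power_divide mult_ac)
    have q: "0 \<le> q" "q \<le> 1 / 2" using \<delta> \<rho> by (auto simp: q_def field_simps)
    have su: "summable u"
    proof (rule summable_comparison_test')
      show "summable (\<lambda>k. C * q ^ k)" using q by (intro summable_mult summable_geometric) auto
    qed (use u in auto)
    define y where "y = blinfun_apply (cscale (1 / of_real \<delta> ^ l)) ((\<Sum>k. u k) + blinfun_apply (cscale (-1)) (\<Sum>j<l. u j))"
    have "(\<Sum>k. u k) \<in> V" unfolding u_def using \<delta> by (intro F) auto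
    moreover have "(\<Sum>j<l. u j) \<in> V" unfolding u_def by (intro sumV V less) auto
    ultimately have "y \<in> V" unfolding y_def by (intro V)
    have neg: "blinfun_apply (cscale (-1)) x = - x" for x
      by (rule linf_eqI) (simp add: cscale_apply)
    have s1: "(\<lambda>k. u (k + l)) sums ((\<Sum>k. u k) - (\<Sum>j<l. u j))"
      by (rule sums_split_initial_segment[OF summable_sums[OF su]])
    then have s2: "(\<lambda>k. u (Suc k + l)) sums ((\<Sum>k. u k) - (\<Sum>j<l. u j) - u l)"
      by (subst sums_Suc_iff) simp
    have "norm ((\<Sum>k. u k) - (\<Sum>j<l. u j) - u l) \<le> C * q ^ Suc l * (1 / (1 - q))"
    proof (rule norm_sums_le[OF s2])
      show "(\<lambda>k. C * q ^ Suc l * q ^ k) sums (C * q ^ Suc l * (1 / (1 - q)))"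
        using q by (intro sums_mult geometric_sums) auto
      show "norm (u (Suc k + l)) \<le> C * q ^ Suc l * q ^ k" for k
        using u[of "Suc k + l"] by (simp add: power_add mult_ac)
    qed
    also have "\<dots> \<le> C * q ^ Suc l * 2"
      using q C by (intro mult_left_mono mult_nonneg_nonneg zero_le_power) (auto simp: field_simps)
    finally have est: "norm ((\<Sum>k. u k) - (\<Sum>j<l. u j) - u l) \<le> C * q ^ Suc l * 2" .
    have "X l = blinfun_apply (cscale (1 / of_real \<delta> ^ l)) (u l)"
      using \<delta>(1) by (simp add: u_def cscale_cscale cscale_one)
    then have "y - X l = blinfun_apply (cscale (1 / of_real \<delta> ^ l)) ((\<Sum>k. u k) - (\<Sum>j<l. u j) - u l)"
      by (simp add: y_def neg blinfun.diff_right blinfun.add_right blinfun.minus_right)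
    then have "dist y (X l) = norm ((\<Sum>k. u k) - (\<Sum>j<l. u j) - u l) / \<delta> ^ l"
      using \<delta>(1) by (simp add: dist_norm norm_cscale_apply norm_divide norm_power)
    also have "\<dots> \<le> C * q ^ Suc l * 2 / \<delta> ^ l"
      using est \<delta>(1) by (intro divide_right_mono) auto
    also have "\<dots> = 2 * C * \<delta> / \<rho> ^ Suc l"
      using \<delta>(1) \<rho> by (simp add: q_def power_divide field_simps)
    also have "\<dots> \<le> D * e' / \<rho> ^ Suc l"
      using \<delta> D \<rho> by (intro divide_right_mono mult_mono) auto
    also have "\<dots> = e / 2" using D \<rho> by (simp add: e'_def)
    finally show ?thesis using \<open>y \<in> V\<close> e by force
  qed
  then have "X l \<in> closure V" by (simp add: closure_approachable)
  then show ?case using V(1) by simp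
qed

section \<open>The analytic family of eigenvectors\<close>

context shift_series
begin

text \<open>The \<open>l\<close>-th derivative of \<open>eigenseq\<close> divided by
  \<open>l!\<close>. The truncated exponent for \<open>n < l\<close> does no harm because the
  binomial coefficient vanishes there.\<close>

definition eigen_deriv :: "nat \<Rightarrow> complex \<Rightarrow> linf" where
  "eigen_deriv l z = Bcontfun (\<lambda>n. of_nat (n choose l) * z ^ (n - l) / of_real (W n))"

text \<open>A Cauchy estimate obtained from the binomial theorem: a single term of the expansion of
  \<open>((t - norm z) + norm z) ^ n\<close> is at most \<open>t ^ n\<close>, hence at most
  \<open>C * W n\<close>.\<close>

lemma eigen_deriv_le:
  fixes z :: complex
  assumes C: "\<And>n k. t ^ k * W n \<le> C * W (n + k)" and z: "norm z < t"
  shows "norm (of_nat (n choose l) * z ^ (n - l) / of_real (W n)) \<le> C / (t - norm z) ^ l"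
proof -
  have \<rho>: "t - norm z > 0" using z by simp
  have "1 \<le> C" using C[of 0 0] W_0 by simp
  have "of_nat (n choose l) * norm z ^ (n - l) * (t - norm z) ^ l \<le> t ^ n"
  proof (cases "l \<le> n")
    case True
    have "of_nat (n choose l) * (t - norm z) ^ l * norm z ^ (n - l)
        \<le> (\<Sum>k\<le>n. of_nat (n choose k) * (t - norm z) ^ k * norm z ^ (n - k))"
      using True \<rho> by (intro member_le_sum) auto
    also have "\<dots> = ((t - norm z) + norm z) ^ n" by (rule binomial_ring[symmetric])
    finally show ?thesis by (simp add: mult_ac)
  next
    case False
    have "0 < t" using z norm_ge_zero[of z] by linarith
    then show ?thesis using False by (simp add: binomial_eq_0)
  qed
  also have "t ^ n \<le> C * W n" using C[of n 0] W_0 by simp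
  finally show ?thesis
    using \<rho> W_pos[of n] by (simp add: norm_mult norm_divide norm_power field_simps)
qed

lemma
  assumes C: "\<And>n k. t ^ k * W n \<le> C * W (n + k)" and z: "norm z < t"
  shows eigen_deriv_apply: "apply_bcontfun (eigen_deriv l z) n = of_nat (n choose l) * z ^ (n - l) / of_real (W n)"
    and norm_eigen_deriv_le: "norm (eigen_deriv l z) \<le> C / (t - norm z) ^ l"
proof -
  have "(\<lambda>n. of_nat (n choose l) * z ^ (n - l) / of_real (W n)) \<in> bcontfun"
    by (rule bounded_seq_bcontfun[OF eigen_deriv_le[OF C z]])
  then have *: "apply_bcontfun (eigen_deriv l z) = (\<lambda>n. of_nat (n choose l) * z ^ (n - l) / of_real (W n))"
    unfolding eigen_deriv_def by (rule Bcontfun_inverse)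
  then show "apply_bcontfun (eigen_deriv l z) n = of_nat (n choose l) * z ^ (n - l) / of_real (W n)" by simp
  show "norm (eigen_deriv l z) \<le> C / (t - norm z) ^ l"
    by (rule norm_linf_le) (simp only: * eigen_deriv_le[OF C z])
qed

text \<open>The norm bounds give convergence, and in each coordinate the identity is the binomial
  theorem with finitely many nonzero terms.\<close>

lemma eigen_deriv_taylor:
  assumes C: "\<And>n k. t ^ k * W n \<le> C * W (n + k)" and z: "norm z < t" and \<zeta>: "norm \<zeta> < t - norm z"
  shows "(\<lambda>l. blinfun_apply (cscale (\<zeta> ^ l)) (eigen_deriv l z)) sums eigen_deriv 0 (z + \<zeta>)"
proof -
  have \<rho>: "t - norm z > 0" using z by simp
  have z\<zeta>: "norm (z + \<zeta>) < t" using norm_triangle_ineq[of z \<zeta>] \<zeta> by simp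
  have "summable (\<lambda>l. blinfun_apply (cscale (\<zeta> ^ l)) (eigen_deriv l z))"
  proof (rule summable_comparison_test')
    show "summable (\<lambda>l. C * (norm \<zeta> / (t - norm z)) ^ l)"
      using \<zeta> \<rho> by (intro summable_mult summable_geometric) auto
    show "norm (blinfun_apply (cscale (\<zeta> ^ l)) (eigen_deriv l z)) \<le> C * (norm \<zeta> / (t - norm z)) ^ l" for l
      using mult_left_mono[OF norm_eigen_deriv_le[OF C z, of l], of "norm \<zeta> ^ l"]
      by (simp add: norm_cscale_apply norm_power power_divide mult_ac)
  qed
  then have s: "(\<lambda>l. blinfun_apply (cscale (\<zeta> ^ l)) (eigen_deriv l z)) sums
      (\<Sum>l. blinfun_apply (cscale (\<zeta> ^ l)) (eigen_deriv l z))" by (rule summable_sums)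
  have "(\<Sum>l. blinfun_apply (cscale (\<zeta> ^ l)) (eigen_deriv l z)) = eigen_deriv 0 (z + \<zeta>)"
  proof (rule linf_eqI)
    fix n
    have "(\<lambda>l. of_nat (n choose l) * \<zeta> ^ l * z ^ (n - l) / of_real (W n)) sums
       (\<Sum>l\<le>n. of_nat (n choose l) * \<zeta> ^ l * z ^ (n - l) / of_real (W n))"
      by (rule sums_finite) auto
    also have "(\<Sum>l\<le>n. of_nat (n choose l) * \<zeta> ^ l * z ^ (n - l) / of_real (W n)) = (\<zeta> + z) ^ n / of_real (W n)"
      unfolding binomial_ring by (simp add: sum_divide_distrib)
    also have "\<zeta> + z = z + \<zeta>" by (rule add.commute)
    finally show "apply_bcontfun (\<Sum>l. blinfun_apply (cscale (\<zeta> ^ l)) (eigen_deriv l z)) n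
        = apply_bcontfun (eigen_deriv 0 (z + \<zeta>)) n"
      using sums_coordinate[OF s, of n]
      by (intro sums_unique2) (auto simp: cscale_apply eigen_deriv_apply[OF C z] eigen_deriv_apply[OF C z\<zeta>] mult_ac)
  qed
  with s show ?thesis by simp
qed

lemma T_eigenvector:
  assumes C: "\<And>n k. t ^ k * W n \<le> C * W (n + k)" and z: "norm z < t" "norm z < m"
  shows "blinfun_apply T (eigen_deriv 0 z) = blinfun_apply (cscale (g z)) (eigen_deriv 0 z)"
proof (rule linf_eqI)
  fix n
  have "(\<lambda>k. c k * z ^ k * (z ^ n / of_real (W n))) sums (g z * (z ^ n / of_real (W n)))"
    by (intro sums_mult2 g_sums z)
  with T_coordinate[of "eigen_deriv 0 z" n]
  show "apply_bcontfun (blinfun_apply T (eigen_deriv 0 z)) n = apply_bcontfun (blinfun_apply (cscale (g z)) (eigen_deriv 0 z)) n"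
    by (intro sums_unique2) (auto simp: cscale_apply B_funpow_apply eigen_deriv_apply[OF C z(1)] power_add mult_ac)
qed

lemma T_funpow_eigenvector:
  assumes C: "\<And>n k. t ^ k * W n \<le> C * W (n + k)" and z: "norm z < t" "norm z < m"
  shows "(blinfun_apply T ^^ k) (eigen_deriv 0 z) = blinfun_apply (cscale (g z ^ k)) (eigen_deriv 0 z)"
  by (induction k) (auto simp: cscale_one T_cscale T_eigenvector[OF C z] cscale_cscale mult.commute)

lemma c0_subset_closure_null_orbits:
  assumes lower: "lower_growth W t" and z0: "norm z0 < t" "norm (g z0) < 1"
  shows "c0 \<subseteq> closure {x. (\<lambda>n. (blinfun_apply T ^^ n) x) \<longlonglongrightarrow> 0}"
proof -
  obtain C where t: "t > 0" and C: "\<And>n k. t ^ k * W n \<le> C * W (n + k)"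
    using lower by (auto simp: lower_growth_def)
  have "t < m" using lower_growth_le_rad[OF lower] rad_less by simp
  define V0 where "V0 = {x. (\<lambda>n. (blinfun_apply T ^^ n) x) \<longlonglongrightarrow> 0}"
  define V where "V = closure V0"
  have V0_zero: "0 \<in> V0" unfolding V0_def
    using linear_0[OF bounded_linear.linear[OF bounded_linear_blinfun_funpow[where T = T]]] by simp
  have V0_add: "x + y \<in> V0" if "x \<in> V0" "y \<in> V0" for x y
  proof -
    have "(\<lambda>n. (blinfun_apply T ^^ n) x + (blinfun_apply T ^^ n) y) \<longlonglongrightarrow> 0 + 0"
      using that by (intro tendsto_add) (auto simp: V0_def)
    then show ?thesis
      by (simp add: V0_def linear_add[OF bounded_linear.linear[OF bounded_linear_blinfun_funpow[where T = T]]])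
  qed
  have V0_cscale: "blinfun_apply (cscale a) x \<in> V0" if "x \<in> V0" for a x
  proof -
    have "(\<lambda>n. blinfun_apply (cscale a) ((blinfun_apply T ^^ n) x)) \<longlonglongrightarrow> blinfun_apply (cscale a) 0"
      using that by (intro tendsto_intros) (auto simp: V0_def)
    then show ?thesis by (simp add: V0_def T_funpow_cscale)
  qed
  have V: "closed V" "0 \<in> V" using V0_zero closure_subset by (auto simp: V_def)
  have V_add: "x + y \<in> V" if x: "x \<in> V" and y: "y \<in> V" for x y
  proof -
    obtain X where "\<And>n. X n \<in> V0" "X \<longlonglongrightarrow> x"
      using x unfolding V_def closure_sequential by blast
    moreover obtain Y where "\<And>n. Y n \<in> V0" "Y \<longlonglongrightarrow> y"
      using y unfolding V_def closure_sequential by blast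
    ultimately show ?thesis unfolding V_def closure_sequential
      by (intro exI[of _ "\<lambda>n. X n + Y n"]) (auto intro: V0_add tendsto_add)
  qed
  have V_cscale: "blinfun_apply (cscale a) x \<in> V" if x: "x \<in> V" for a x
  proof -
    obtain X where "\<And>n. X n \<in> V0" "X \<longlonglongrightarrow> x"
      using x unfolding V_def closure_sequential by blast
    then show ?thesis unfolding V_def closure_sequential
      by (intro exI[of _ "\<lambda>n. blinfun_apply (cscale a) (X n)"]) (auto intro: V0_cscale tendsto_intros)
  qed
  \<comment> \<open>If the eigenvectors near \<open>a\<close> lie in the closed subspace
    \<open>V\<close>, so do all Taylor coefficients of the family at \<open>a\<close>.\<close>
  have deriv_mem: "eigen_deriv l a \<in> V"
    if a: "norm a < t" and r: "r > 0" "\<And>z. z \<in> ball a r \<Longrightarrow> norm z < t \<Longrightarrow> eigen_deriv 0 z \<in> V" for a r l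
  proof (rule taylor_coefficient_mem_closed_subspace[OF V V_add V_cscale])
    show "t - norm a > 0" using a by simp
    show "norm (eigen_deriv l a) \<le> C / (t - norm a) ^ l" for l
      by (rule norm_eigen_deriv_le[OF C a])
    show "min r (t - norm a) > 0" using a r by simp
    fix \<zeta> :: complex assume \<zeta>: "norm \<zeta> < min r (t - norm a)"
    have "(\<Sum>l. blinfun_apply (cscale (\<zeta> ^ l)) (eigen_deriv l a)) = eigen_deriv 0 (a + \<zeta>)"
      using \<zeta> by (intro sums_unique[symmetric] eigen_deriv_taylor[OF C a]) auto
    moreover have "eigen_deriv 0 (a + \<zeta>) \<in> V"
      using \<zeta> norm_triangle_ineq[of a \<zeta>] by (intro r(2)) (auto simp: dist_norm)
    ultimately show "(\<Sum>l. blinfun_apply (cscale (\<zeta> ^ l)) (eigen_deriv l a)) \<in> V" by simp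
  qed
  \<comment> \<open>The restriction to \<open>norm z < t\<close> is essential: beyond
    \<open>t\<close> the sequence may be unbounded, and then \<open>eigen_deriv\<close> carries no
    information.\<close>
  define P where "P a \<longleftrightarrow> (\<exists>r>0. \<forall>z\<in>ball a r. norm z < t \<longrightarrow> eigen_deriv 0 z \<in> V)" for a
  have sumV: "(\<Sum>j\<in>I. f j) \<in> V" if "\<And>j. j \<in> I \<Longrightarrow> f j \<in> V" for I :: "nat set" and f
    using that by (induction I rule: infinite_finite_induct) (auto intro: V V_add)
  \<comment> \<open>The coefficients at \<open>a\<close> lie in \<open>V\<close>, so the sum of the
    Taylor series does too, on the full disc of radius \<open>t - norm a\<close> and not only near
    \<open>a\<close>.\<close>
  have extend: "eigen_deriv 0 (a + \<zeta>) \<in> V" if "P a" "norm a < t" "norm \<zeta> < t - norm a" for a \<zeta>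
  proof -
    have "(\<lambda>n. \<Sum>l<n. blinfun_apply (cscale (\<zeta> ^ l)) (eigen_deriv l a)) \<longlonglongrightarrow> eigen_deriv 0 (a + \<zeta>)"
      using eigen_deriv_taylor[OF C that(2,3)] by (simp add: sums_def)
    moreover have "(\<Sum>l<n. blinfun_apply (cscale (\<zeta> ^ l)) (eigen_deriv l a)) \<in> V" for n
    proof -
      obtain r where r: "r > 0" "\<And>z. z \<in> ball a r \<Longrightarrow> norm z < t \<Longrightarrow> eigen_deriv 0 z \<in> V"
        using \<open>P a\<close> unfolding P_def by blast
      show ?thesis by (intro sumV V_cscale deriv_mem[OF that(2) r])
    qed
    ultimately show ?thesis by (rule closed_sequentially[OF V(1), rotated])
  qed
  \<comment> \<open>Analytic continuation as induction over the connected disc: \<open>P\<close>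
    holds at \<open>z0\<close>, where the orbits of nearby eigenvectors decay, and it passes between
    neighbouring points.\<close>
  have "P 0"
  proof (rule connected_induction_simple[where S = "ball 0 t" and a = z0])
    show "P z0"
    proof -
      have cont: "continuous_on (ball 0 m) g" by (rule holomorphic_on_imp_continuous_on[OF g_holomorphic])
      have "open (ball 0 m \<inter> g -` ball 0 1)" by (rule continuous_open_preimage[OF cont]) auto
      moreover have "z0 \<in> ball 0 m \<inter> g -` ball 0 1" using z0 \<open>t < m\<close> by simp
      ultimately obtain r where r: "r > 0" "ball z0 r \<subseteq> ball 0 m \<inter> g -` ball 0 1"
        by (meson open_contains_ball)
      have "eigen_deriv 0 z \<in> V" if "z \<in> ball z0 r" "norm z < t" for z
      proof -
        have "z \<in> ball 0 m \<inter> g -` ball 0 1" using r(2) that(1) by (rule subsetD)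
        then have gz: "norm (g z) < 1" and zm: "norm z < m" by auto
        have "(\<lambda>k. norm (g z) ^ k * norm (eigen_deriv 0 z)) \<longlonglongrightarrow> 0 * norm (eigen_deriv 0 z)"
          using gz by (intro tendsto_intros LIMSEQ_power_zero) auto
        then have "(\<lambda>k. (blinfun_apply T ^^ k) (eigen_deriv 0 z)) \<longlonglongrightarrow> 0"
          by (subst tendsto_norm_zero_iff[symmetric])
            (simp add: T_funpow_eigenvector[OF C that(2) zm] norm_cscale_apply norm_power)
        then have "eigen_deriv 0 z \<in> V0" by (simp add: V0_def)
        then show ?thesis using closure_subset by (auto simp: V_def)
      qed
      then show ?thesis using r(1) unfolding P_def by blast
    qed
    fix a :: complex assume "a \<in> ball 0 t"
    then have a: "norm a < t" by simp
    \<comment> \<open>With a quarter of the distance to the boundary, points \<open>z\<close> within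
      \<delta> of \<open>y\<close> are less than \<open>3 * \<delta>\<close> from \<open>x\<close>,
      and \<open>3 * \<delta> \<le> t - norm x\<close>.\<close>
    define \<delta> where "\<delta> = (t - norm a) / 4"
    have \<delta>: "\<delta> > 0" using a by (simp add: \<delta>_def)
    have "P y" if x: "x \<in> ball 0 t \<inter> ball a \<delta>" and y: "y \<in> ball 0 t \<inter> ball a \<delta>" and "P x" for x y
    proof -
      have xa: "norm (x - a) < \<delta>" and ya: "norm (y - a) < \<delta>"
        using x y by (auto simp: dist_norm norm_minus_commute)
      have nx: "norm x \<le> norm a + \<delta>" using xa norm_triangle_sub[of x a] by simp
      have "eigen_deriv 0 z \<in> V" if "z \<in> ball y \<delta>" for z
      proof -
        have "norm (z - y) < \<delta>" using that by (simp add: dist_norm norm_minus_commute)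
        moreover have "norm (z - x) \<le> norm (z - y) + norm (y - a) + norm (x - a)"
          using norm_triangle_ineq[of "z - y" "y - a"] norm_triangle_ineq4[of "z - a" "x - a"] by simp
        ultimately have "norm (z - x) < 3 * \<delta>" using xa ya by simp
        also have "3 * \<delta> \<le> t - norm x" using nx unfolding \<delta>_def by (simp add: field_simps)
        finally have "norm (z - x) < t - norm x" .
        from extend[OF \<open>P x\<close> _ this] x show ?thesis by simp
      qed
      then show ?thesis using \<delta> unfolding P_def by blast
    qed
    moreover have "openin (top_of_set (ball 0 t)) (ball 0 t \<inter> ball a \<delta>)" by (intro openin_open_Int) auto
    moreover have "a \<in> ball 0 t \<inter> ball a \<delta>" using a \<delta> by simp
    ultimately show "\<exists>S. openin (top_of_set (ball 0 t)) S \<and> a \<in> S \<and> (\<forall>x\<in>S. \<forall>y\<in>S. P x \<longrightarrow> P y)"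
      by blast
  qed (use t z0 in auto)
  then obtain r where r: "r > 0" "\<And>z. z \<in> ball 0 r \<Longrightarrow> norm z < t \<Longrightarrow> eigen_deriv 0 z \<in> V"
    unfolding P_def by blast
  \<comment> \<open>At the origin only the entry with index \<open>l\<close> survives, so these are
    multiples of the unit vectors.\<close>
  have unit: "eigen_deriv l 0 \<in> V" for l by (rule deriv_mem[OF _ r]) (use t in simp)
  have "x \<in> V" if x: "x \<in> c0" for x
  proof -
    \<comment> \<open>The factor \<open>W l\<close> cancels the entry \<open>1 / W l\<close> of
      \<open>eigen_deriv l 0\<close>, so \<open>y N\<close> is \<open>x\<close> cut off at
      \<open>N\<close>. Cut-offs converge in the sup-norm because \<open>x\<close> is a null
      sequence.\<close>
    define y where "y N = (\<Sum>l<N. blinfun_apply (cscale (apply_bcontfun x l * of_real (W l))) (eigen_deriv l 0))" for N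
    have yV: "y N \<in> V" for N unfolding y_def by (intro sumV V_cscale unit)
    have unit_apply: "apply_bcontfun (eigen_deriv l 0) n = (if n = l then 1 / of_real (W l) else 0)" for l n
      using t by (subst eigen_deriv_apply[OF C]) (auto simp: power_0_left)
    have sum_apply: "apply_bcontfun (\<Sum>l\<in>I. f l) n = (\<Sum>l\<in>I. apply_bcontfun (f l) n)" for I :: "nat set" and f :: "nat \<Rightarrow> linf" and n
      by (rule linear_sum[OF bounded_linear.linear[OF bounded_linear_coordinate]])
    have y_apply: "apply_bcontfun (y N) n = (if n < N then apply_bcontfun x n else 0)" for N n
    proof -
      have "apply_bcontfun (y N) n = (\<Sum>l<N. if n = l then apply_bcontfun x l else 0)"
        unfolding y_def sum_apply by (intro sum.cong) (auto simp: cscale_apply unit_apply)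
      then show ?thesis by simp
    qed
    have "\<exists>z\<in>V. dist z x < e" if e: "e > 0" for e
    proof -
      have "apply_bcontfun x \<longlonglongrightarrow> 0" using x by (simp add: c0_def)
      from LIMSEQ_D[OF this, of "e / 2"] e obtain N where N: "\<And>n. n \<ge> N \<Longrightarrow> norm (apply_bcontfun x n) < e / 2" by auto
      have "norm (y N - x) \<le> e / 2"
      proof (rule norm_linf_le)
        show "norm (apply_bcontfun (y N - x) n) \<le> e / 2" for n
          using N[of n] e by (cases "n < N") (auto simp: y_apply not_less less_imp_le)
      qed
      then show ?thesis using yV[of N] e by (force simp: dist_norm)
    qed
    then have "x \<in> closure V" by (simp add: closure_approachable)
    then show ?thesis using V(1) by simp
  qed
  then show ?thesis unfolding V_def V0_def by blast
qed

end

theorem theorem3p19: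
  fixes w :: "nat \<Rightarrow> real" and f :: "complex \<Rightarrow> complex" and U :: "complex set"
    and T :: "linf \<Rightarrow>\<^sub>L linf"
  assumes "\<And>n. 0 < w n" and "bounded (range w)"
    and "open U" and "op_spectrum (backward_shift w) \<subseteq> U" and "f holomorphic_on U"
    and "T = hol_calc f U (backward_shift w)"
    and "J_class T"
  shows "A_set T = c0"
proof -
  interpret weighted_shift w
    using assms(1,2) by unfold_locales
  obtain s c A where "rad < s" "\<And>k. norm (c k) \<le> A / s ^ k"
    "\<And>x n. (\<lambda>k. c k * apply_bcontfun ((blinfun_apply B ^^ k) x) n) sums apply_bcontfun (blinfun_apply T x) n"
    using power_series_op_hol_calc[OF assms(3-5)] unfolding assms(6)[symmetric] power_series_op_def by blast
  then interpret shift_series w T c A s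
    by unfold_locales
  obtain z t where "norm z < t" "lower_growth W t" "norm (g z) < 1"
    using ex_norm_g_less_1[OF assms(7)] by blast
  then have "c0 \<subseteq> A_set T"
    using c0_subset_closure_null_orbits
      closure_null_orbits_subset_A_set[OF zero_mem_A_set_of_J_class[OF assms(7)]] by blast
  with A_set_subset_c0[OF assms(7)] show ?thesis by blast
qed

end
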